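(* Let $m\ge 2$ and let $H$ be the free abelian group of rank $n$ with basis $\overline{x_1},\dots,\overline{x_n}$. The classes modulo $\mathfrak{J}_H^3$ of the elements of $$Y=\{\overline{t}_{ij,hk}(p,q)\mid(i,j,h,k)\in J,\ p<q\}\cup\{\overline{u}_{ij,hk}(p,q)\mid(i,j,h,k)\in I,\ p\le q\}\cup\{\overline{v}_{ij}(p,q)\mid(i,j)\ne(m,m),\ p\le q\}$$ (with $1\le p,q\le n$) form a basis of $\mathrm{gr}^2(\mathfrak{J}_H)=\mathfrak{J}_H^2/\mathfrak{J}_H^3$ as a $\mathbf{Q}$-vector space.
   Context: Let $R^m(H)=\mathrm{Hom}(H,\mathrm{SL}(m,\mathbf{C}))$. For $x\in H$ and $1\le i,j\le m$, let $a_{ij}(x):R^m(H)\to\mathbf{C}$ be the function $\rho\mapsto$ the $(i,j)$-component of $\rho(x)$. Let $\mathfrak{R}^m_{\mathbf{Q}}(H)$ be the $\mathbf{Q}$-subalgebra of the algebra of all functions $R^m(H)\to\mathbf{C}$ (pointwise operations) generated by all $a_{ij}(x)$, $x\in H$, $1\le i,j\le m$. Put $s_{ij}(x)=a_{ij}(x)-\delta_{ij}$, and let $\mathfrak{J}_H$ be the ideal of $\mathfrak{R}^m_{\mathbf{Q}}(H)$ generated by $s_{ij}(\overline{x_l})$ for $1\le i,j\le m$, $1\le l\le n$. Put $\overline{t}_{ij,hk}(p,q)=s_{ij}(\overline{x_p})s_{hk}(\overline{x_q})-s_{ij}(\overline{x_q})s_{hk}(\overline{x_p})$, $\overline{u}_{ij,hk}(p,q)=s_{ij}(\overline{x_p})s_{hk}(\overline{x_q})+s_{ij}(\overline{x_q})s_{hk}(\overline{x_p})$,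 $\overline{v}_{ij}(p,q)=s_{ij}(\overline{x_p})s_{ij}(\overline{x_q})$. Let $<_{\mathrm{lex}}$ be the lexicographic order on pairs of natural numbers. With all indices in $\{1,\dots,m\}$, put $I=\{(i,j,h,k)\mid(i,j)<_{\mathrm{lex}}(h,k),\ (i,j),(h,k)\ne(m,m)\}$ and $J=I\setminus\{(1,j,i,1),(1,1,i,1),(1,1,1,j)\mid i,j\ne1\}$. *)

theory Defs
  imports
    "Jordan_Normal_Form.Determinant"
    "Jordan_Normal_Form.VS_Connect"
    "HOL-Algebra.Free_Abelian_Groups"
    "HOL-Algebra.Ideal_Product"
    "HOL-Algebra.Subrings"
begin

text \<open>\<open>H\<close> is free abelian with basis \<open>x 1, \<dots>, x n\<close>: it is identified with the group of
  finitely supported integer functions on \<open>{1..n}\<close>, the \<open>x l\<close> being the unit functions.\<close>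

definition free_abelian_with_basis ::
    "('a, 'b) monoid_scheme \<Rightarrow> nat \<Rightarrow> (nat \<Rightarrow> 'a) \<Rightarrow> bool" where
  "free_abelian_with_basis H n x \<longleftrightarrow> comm_group H \<and>
     (\<exists>\<phi> \<in> iso (free_Abelian_group {1..n}) H. \<forall>l\<in>{1..n}. \<phi> (Poly_Mapping.single l 1) = x l)"

definition SL :: "nat \<Rightarrow> complex mat monoid" where
  "SL m = \<lparr>carrier = {A \<in> carrier_mat m m. det A = 1}, monoid.mult = (*), monoid.one = 1\<^sub>m m\<rparr>"

text \<open>Library homomorphisms are arbitrary off the carrier; the restriction to extensional functions
  makes each homomorphism a single element. The same convention is used for functions on \<open>Rep H m\<close>.\<close>

definition Rep :: "('a, 'b) monoid_scheme \<Rightarrow> nat \<Rightarrow> ('a \<Rightarrow> complex mat) set" where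
  "Rep H m = hom H (SL m) \<inter> extensional (carrier H)"

definition fun_algebra :: "'r set \<Rightarrow> (rat, 'r \<Rightarrow> complex) module" where
  "fun_algebra R =
     \<lparr>carrier = R \<rightarrow>\<^sub>E UNIV,
      monoid.mult = (\<lambda>f g. \<lambda>\<rho>\<in>R. f \<rho> * g \<rho>),
      monoid.one = (\<lambda>\<rho>\<in>R. 1),
      ring.zero = (\<lambda>\<rho>\<in>R. 0),
      ring.add = (\<lambda>f g. \<lambda>\<rho>\<in>R. f \<rho> + g \<rho>),
      module.smult = (\<lambda>q f. \<lambda>\<rho>\<in>R. of_rat q * f \<rho>)\<rparr>"

definition is_subalgebra :: "'c set \<Rightarrow> (rat, 'c, 'd) module_scheme \<Rightarrow> bool" where
  "is_subalgebra B F \<longleftrightarrow> subring B F \<and> (\<forall>q. \<forall>f\<in>B. q \<odot>\<^bsub>F\<^esub> f \<in> B)"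

definition generated_subalgebra ::
    "(rat, 'c, 'd) module_scheme \<Rightarrow> 'c set \<Rightarrow> (rat, 'c, 'd) module_scheme" where
  "generated_subalgebra F S = F\<lparr>carrier := \<Inter> {B. is_subalgebra B F \<and> S \<subseteq> B}\<rparr>"

text \<open>Indices run from 1 as in the mathematics, whereas \<open>$$\<close> counts rows and columns from 0.\<close>

definition coord_a :: "('a, 'b) monoid_scheme \<Rightarrow> nat \<Rightarrow> nat \<Rightarrow> nat \<Rightarrow> 'a \<Rightarrow> (('a \<Rightarrow> complex mat) \<Rightarrow> complex)"
  where "coord_a H m i j h = (\<lambda>\<rho>\<in>Rep H m. \<rho> h $$ (i - 1, j - 1))"

definition coord_s :: "('a, 'b) monoid_scheme \<Rightarrow> nat \<Rightarrow> nat \<Rightarrow> nat \<Rightarrow> 'a \<Rightarrow> (('a \<Rightarrow> complex mat) \<Rightarrow> complex)"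
  where "coord_s H m i j h = (\<lambda>\<rho>\<in>Rep H m. coord_a H m i j h \<rho> - (if i = j then 1 else 0))"

definition rep_algebra ::
    "('a, 'b) monoid_scheme \<Rightarrow> nat \<Rightarrow> (rat, ('a \<Rightarrow> complex mat) \<Rightarrow> complex) module" where
  "rep_algebra H m = generated_subalgebra (fun_algebra (Rep H m))
     {coord_a H m i j h | i j h. i \<in> {1..m} \<and> j \<in> {1..m} \<and> h \<in> carrier H}"

definition ideal_J ::
    "('a, 'b) monoid_scheme \<Rightarrow> nat \<Rightarrow> nat \<Rightarrow> (nat \<Rightarrow> 'a) \<Rightarrow> (('a \<Rightarrow> complex mat) \<Rightarrow> complex) set" where
  "ideal_J H m n x = genideal (rep_algebra H m)
     {coord_s H m i j (x l) | i j l. i \<in> {1..m} \<and> j \<in> {1..m} \<and> l \<in> {1..n}}"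

primrec ideal_pow :: "('c, 'd) ring_scheme \<Rightarrow> 'c set \<Rightarrow> nat \<Rightarrow> 'c set" where
  "ideal_pow A J 0 = carrier A"
| "ideal_pow A J (Suc k) = ideal_prod A (ideal_pow A J k) J"

text \<open>\<open>J\<^sup>k / J\<^sup>k\<^sup>+\<^sup>1\<close>, realised as the set of cosets of \<open>J\<^sup>k\<^sup>+\<^sup>1\<close> with representatives in
  \<open>J\<^sup>k\<close>. The type of module records also asks for a multiplication and a unit, which play no role
  in the vector space structure; they are those of \<open>A Quot J\<^sup>k\<^sup>+\<^sup>1\<close>.\<close>

definition gr :: "(rat, 'c, 'd) module_scheme \<Rightarrow> 'c set \<Rightarrow> nat \<Rightarrow> (rat, 'c set) module" where
  "gr A J k = (let N = ideal_pow A J (Suc k) in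
     \<lparr>carrier = (\<lambda>f. N +>\<^bsub>A\<^esub> f) ` ideal_pow A J k,
      monoid.mult = rcoset_mult A N,
      monoid.one = N +>\<^bsub>A\<^esub> \<one>\<^bsub>A\<^esub>,
      ring.zero = N,
      ring.add = set_add A,
      module.smult = (\<lambda>q C. \<Union>f\<in>C. N +>\<^bsub>A\<^esub> (q \<odot>\<^bsub>A\<^esub> f))\<rparr>)"

definition gr_class :: "(rat, 'c, 'd) module_scheme \<Rightarrow> 'c set \<Rightarrow> nat \<Rightarrow> 'c \<Rightarrow> 'c set" where
  "gr_class A J k f = ideal_pow A J (Suc k) +>\<^bsub>A\<^esub> f"

definition elem_t ::
    "('a, 'b) monoid_scheme \<Rightarrow> nat \<Rightarrow> (nat \<Rightarrow> 'a) \<Rightarrow> nat \<Rightarrow> nat \<Rightarrow> nat \<Rightarrow> nat \<Rightarrow> nat \<Rightarrow> nat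
      \<Rightarrow> (('a \<Rightarrow> complex mat) \<Rightarrow> complex)" where
  "elem_t H m x i j h k p q = (let F = fun_algebra (Rep H m); s = coord_s H m in
     (s i j (x p) \<otimes>\<^bsub>F\<^esub> s h k (x q)) \<ominus>\<^bsub>F\<^esub> (s i j (x q) \<otimes>\<^bsub>F\<^esub> s h k (x p)))"

definition elem_u ::
    "('a, 'b) monoid_scheme \<Rightarrow> nat \<Rightarrow> (nat \<Rightarrow> 'a) \<Rightarrow> nat \<Rightarrow> nat \<Rightarrow> nat \<Rightarrow> nat \<Rightarrow> nat \<Rightarrow> nat
      \<Rightarrow> (('a \<Rightarrow> complex mat) \<Rightarrow> complex)" where
  "elem_u H m x i j h k p q = (let F = fun_algebra (Rep H m); s = coord_s H m in
     (s i j (x p) \<otimes>\<^bsub>F\<^esub> s h k (x q)) \<oplus>\<^bsub>F\<^esub> (s i j (x q) \<otimes>\<^bsub>F\<^esub> s h k (x p)))"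

definition elem_v ::
    "('a, 'b) monoid_scheme \<Rightarrow> nat \<Rightarrow> (nat \<Rightarrow> 'a) \<Rightarrow> nat \<Rightarrow> nat \<Rightarrow> nat \<Rightarrow> nat
      \<Rightarrow> (('a \<Rightarrow> complex mat) \<Rightarrow> complex)" where
  "elem_v H m x i j p q = (let F = fun_algebra (Rep H m); s = coord_s H m in
     s i j (x p) \<otimes>\<^bsub>F\<^esub> s i j (x q))"

definition index_I :: "nat \<Rightarrow> (nat \<times> nat \<times> nat \<times> nat) set" where
  "index_I m = {(i, j, h, k).
     i \<in> {1..m} \<and> j \<in> {1..m} \<and> h \<in> {1..m} \<and> k \<in> {1..m} \<and>
     ((i, j), (h, k)) \<in> less_than <*lex*> less_than \<and> (i, j) \<noteq> (m, m) \<and> (h, k) \<noteq> (m, m)}"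

definition index_J :: "nat \<Rightarrow> (nat \<times> nat \<times> nat \<times> nat) set" where
  "index_J m = index_I m -
     ({(1, j, i, 1) | i j. i \<in> {1..m} - {1} \<and> j \<in> {1..m} - {1}} \<union>
      {(1, 1, i, 1) | i. i \<in> {1..m} - {1}} \<union>
      {(1, 1, 1, j) | j. j \<in> {1..m} - {1}})"

definition basis_Y ::
    "('a, 'b) monoid_scheme \<Rightarrow> nat \<Rightarrow> nat \<Rightarrow> (nat \<Rightarrow> 'a) \<Rightarrow> (('a \<Rightarrow> complex mat) \<Rightarrow> complex) set" where
  "basis_Y H m n x =
     {elem_t H m x i j h k p q | i j h k p q.
        (i, j, h, k) \<in> index_J m \<and> p \<in> {1..n} \<and> q \<in> {1..n} \<and> p < q} \<union>
     {elem_u H m x i j h k p q | i j h k p q.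
        (i, j, h, k) \<in> index_I m \<and> p \<in> {1..n} \<and> q \<in> {1..n} \<and> p \<le> q} \<union>
     {elem_v H m x i j p q | i j p q.
        i \<in> {1..m} \<and> j \<in> {1..m} \<and> (i, j) \<noteq> (m, m) \<and> p \<in> {1..n} \<and> q \<in> {1..n} \<and> p \<le> q}"

end

theory Submission
  imports Defs "HOL-Library.Function_Algebras"
begin

text \<open>
  Write \<open>s a l\<close> for the function \<open>s\<^sub>i\<^sub>j(x l)\<close> with \<open>a = (i, j)\<close>, and \<open>J\<close> for the ideal that these generate.

  \<^bold>\<open>Generators.\<close> All \<open>s\<^sub>i\<^sub>j(h)\<close> lie in \<open>J\<close>, because the set of \<open>h\<close> for which they do is a subgroup
  containing the basis. Hence the algebra is \<open>\<rat> + J\<close>, the \<open>s a l\<close> span \<open>J / J\<^sup>2\<close>, and their products span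
  \<open>J\<^sup>2 / J\<^sup>3\<close> (lemmas \<open>K0_const_mod_K1\<close>, \<open>K1_span\<close>, \<open>K1_mult_span\<close>). Two families of relations cut these
  products down. The determinant of \<open>1 + S\<close> is \<open>1 + tr S\<close> modulo \<open>J\<^sup>2\<close> (\<open>det_one_plus\<close>), so the
  trace of \<open>s\<close> is zero in \<open>J / J\<^sup>2\<close> and \<open>s\<^sub>m\<^sub>m\<close> can be eliminated. The matrices \<open>\<rho>(x p)\<close> and \<open>\<rho>(x q)\<close>
  commute, so the entries of the commutator of \<open>s(x p)\<close> and \<open>s(x q)\<close> vanish; each entry is a sum
  of functions \<open>t\<close>, and together with the trace relation they express every \<open>t\<close> with index in
  \<open>index_I m - index_J m\<close> by the others (\<open>all_mem\<close>). The entries of the commutator number \<open>m\<^sup>2\<close>, with one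
  linear relation since its trace is zero, and \<open>index_I m - index_J m\<close> has \<open>m\<^sup>2 - 1\<close> elements.

  \<^bold>\<open>Independence.\<close> Given pairwise commuting real matrices \<open>A l\<close>, the matrices
  \<open>1 + e A l\<close>, scaled to determinant \<open>1\<close>, define for small \<open>e\<close> a representation \<open>\<rho> e\<close>, and \<open>\<rho> 0\<close> is
  trivial. Along this curve a function in \<open>J\<^sup>k\<close> is \<open>O(e\<^sup>k)\<close> (\<open>K_vanishing\<close>), whereas \<open>s a l\<close> is \<open>e\<close> times the
  entry \<open>a\<close> of the traceless part of \<open>A l\<close>, up to \<open>o(e)\<close> (\<open>s_limit\<close>). A linear relation modulo
  \<open>J\<^sup>3\<close> between the elements of \<open>Y\<close> therefore gives a quadratic form that vanishes on all commuting
  tuples of traceless matrices. Such a form splits according to the pair \<open>(p, q)\<close>. The symmetric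
  part of each bilinear form is zero since a matrix commutes with itself, which disposes of the
  \<open>u\<close> and the \<open>v\<close>. The alternating part vanishes on commuting pairs; then it is a
  linear functional of the commutator, and the indices missing from \<open>index_J m\<close> are just enough to make
  that functional zero (\<open>zero_on_units\<close>).

  Elements of the algebra are extensional functions on the set of representations. Calculations are done
  with arbitrary functions on the type, which form a ring in the sense of type classes; a
  function belongs to \<open>K k\<close> if its restriction lies in \<open>J\<^sup>k\<close>.
\<close>

section \<open>Multiplicative filtrations and determinants near the identity\<close>

text \<open>Two filtrations are used below: the powers of the ideal \<open>J\<close>, and the order of vanishing at
  \<open>0\<close> of functions of one real variable.\<close>

locale ring_filtration =
  fixes K :: "nat \<Rightarrow> 'c::comm_ring_1 set"
  assumes one_mem: "1 \<in> K 0"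
    and zero_mem: "0 \<in> K k"
    and add_mem: "f \<in> K k \<Longrightarrow> g \<in> K k \<Longrightarrow> f + g \<in> K k"
    and uminus_mem: "f \<in> K k \<Longrightarrow> - f \<in> K k"
    and mult_mem: "f \<in> K j \<Longrightarrow> g \<in> K k \<Longrightarrow> f * g \<in> K (j + k)"
    and Suc_subset: "K (Suc k) \<subseteq> K k"
begin

lemma diff_mem: "f \<in> K k \<Longrightarrow> g \<in> K k \<Longrightarrow> f - g \<in> K k"
  using add_mem[of f k "- g"] uminus_mem[of g k] by simp

lemma sum_mem: "(\<And>i. i \<in> I \<Longrightarrow> f i \<in> K k) \<Longrightarrow> (\<Sum>i\<in>I. f i) \<in> K k"
  by (induction I rule: infinite_finite_induct) (auto intro: zero_mem add_mem)

lemma antimono: "j \<le> k \<Longrightarrow> K k \<subseteq> K j"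
  by (rule lift_Suc_antimono_le[of K, OF Suc_subset])

lemma mult_mem_le: "f \<in> K i \<Longrightarrow> g \<in> K j \<Longrightarrow> k \<le> i + j \<Longrightarrow> f * g \<in> K k"
  using mult_mem antimono by blast

lemma prod_mem: "(\<And>i. i \<in> I \<Longrightarrow> f i \<in> K 0) \<Longrightarrow> (\<Prod>i\<in>I. f i) \<in> K 0"
  by (induction I rule: infinite_finite_induct) (auto intro: one_mem mult_mem_le)

lemma prod_one_plus:
  assumes "finite I" and "\<And>i. i \<in> I \<Longrightarrow> f i \<in> K 1"
  shows "(\<Prod>i\<in>I. 1 + f i) - 1 - (\<Sum>i\<in>I. f i) \<in> K 2"
  using assms
proof (induction I rule: finite_induct)
  case empty
  then show ?case by (simp add: zero_mem)
next
  case (insert i I)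
  let ?P = "\<Prod>i\<in>I. 1 + f i" and ?S = "\<Sum>i\<in>I. f i"
  have IH: "?P - 1 - ?S \<in> K 2" using insert by simp
  have f0: "f j \<in> K 0" if "j \<in> insert i I" for j
    using insert.prems[OF that] antimono[of 0 1] by auto
  have "?S \<in> K 1" using insert.prems by (auto intro: sum_mem)
  moreover have fi: "f i \<in> K 1" using insert.prems by auto
  ultimately have "f i * ?S \<in> K 2" by (auto intro: mult_mem_le)
  moreover have "(1 + f i) * (?P - 1 - ?S) \<in> K 2"
    by (rule mult_mem_le[OF _ IH]) (auto intro: add_mem one_mem f0)
  ultimately have "(1 + f i) * (?P - 1 - ?S) + f i * ?S \<in> K 2" by (intro add_mem)
  also have "(1 + f i) * (?P - 1 - ?S) + f i * ?S = (\<Prod>i\<in>insert i I. 1 + f i) - 1 - (\<Sum>i\<in>insert i I. f i)"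
    using insert by (simp add: algebra_simps)
  finally show ?case .
qed

text \<open>In the Leibniz formula the identity permutation contributes \<open>1 + tr S\<close> modulo the second step,
  and every other permutation contributes a product with at least two off-diagonal entries.\<close>

lemma det_one_plus:
  assumes S: "\<And>i j. i < m \<Longrightarrow> j < m \<Longrightarrow> S i j \<in> K 1"
  shows "det (mat m m (\<lambda>(i, j). (if i = j then 1 else 0) + S i j)) - 1 - (\<Sum>i<m. S i i) \<in> K 2"
proof -
  define M where "M = mat m m (\<lambda>(i, j). (if i = j then 1 else 0) + S i j)"
  have S0: "S i j \<in> K 0" if "i < m" "j < m" for i j
    using S[OF that] antimono[of 0 1] by auto
  have M0: "M $$ (i, j) \<in> K 0" if "i < m" "j < m" for i j
    using that S0 by (auto simp: M_def intro!: add_mem one_mem zero_mem)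
  define T where "T p = of_int (sign p) * (\<Prod>i = 0..<m. M $$ (i, p i))" for p
  define Q where "Q = {p. p permutes {0..<m}}"
  have fin: "finite Q" unfolding Q_def by (rule finite_permutations) simp
  have idQ: "id \<in> Q" by (simp add: Q_def permutes_id)
  have "det M = (\<Sum>p\<in>Q. T p)"
    unfolding T_def Q_def by (rule det_def') (simp add: M_def)
  also have "\<dots> = T id + (\<Sum>p\<in>Q - {id}. T p)"
    using fin idQ by (rule sum.remove)
  finally have det: "det M = T id + (\<Sum>p\<in>Q - {id}. T p)" .
  have "T p \<in> K 2" if p: "p \<in> Q - {id}" for p
  proof -
    have perm: "p permutes {0..<m}" using p by (simp add: Q_def)
    obtain i where i: "p i \<noteq> i" using p by (auto simp: fun_eq_iff)
    then have im: "i < m" using perm by (auto simp: permutes_def)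
    have lt: "p j < m" if "j < m" for j
      using permutes_in_image[OF perm, of j] that by simp
    have pi: "p (p i) \<noteq> p i"
      using permutes_inj[OF perm] i by (auto dest: injD)
    \<comment> \<open>A nontrivial permutation moves at least two indices, each contributing an entry of \<open>S\<close>.\<close>
    have split: "{0..<m} = insert i (insert (p i) ({0..<m} - {i, p i}))" using im lt by auto
    have "(\<Prod>j = 0..<m. M $$ (j, p j)) = M $$ (i, p i) * (M $$ (p i, p (p i)) *
        (\<Prod>j\<in>{0..<m} - {i, p i}. M $$ (j, p j)))"
      by (subst split) (use i in auto)
    also have "\<dots> \<in> K 2"
    proof -
      have "M $$ (i, p i) \<in> K 1" using im lt i S by (auto simp: M_def)
      moreover have "M $$ (p i, p (p i)) \<in> K 1" using im lt pi S by (auto simp: M_def)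
      moreover have "(\<Prod>j\<in>{0..<m} - {i, p i}. M $$ (j, p j)) \<in> K 0"
        by (rule prod_mem) (use lt M0 in auto)
      ultimately show ?thesis by (intro mult_mem_le[of _ 1 _ 1] mult_mem_le[of _ 1 _ 0]) auto
    qed
    finally show ?thesis
      unfolding T_def by (cases "evenperm p") (auto simp: sign_def intro: uminus_mem)
  qed
  then have 1: "(\<Sum>p\<in>Q - {id}. T p) \<in> K 2" by (rule sum_mem)
  have "T id = (\<Prod>i\<in>{0..<m}. 1 + S i i)"
    by (auto simp: T_def M_def intro: prod.cong)
  then have "T id - 1 - (\<Sum>i\<in>{0..<m}. S i i) \<in> K 2"
    using prod_one_plus[of "{0..<m}" "\<lambda>i. S i i"] S by auto
  from add_mem[OF this 1] show ?thesis
    unfolding M_def[symmetric] det by (simp add: algebra_simps atLeast0LessThan)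
qed

end

section \<open>Alternating forms that vanish on commuting matrices\<close>

text \<open>Matrices with indices from \<open>1\<close> to \<open>m\<close> are functions on pairs of natural numbers, and
  addition is pointwise. Inside the index range \<open>matmul\<close> depends only on entries in that range.\<close>

definition matmul :: "nat \<Rightarrow> (nat \<times> nat \<Rightarrow> real) \<Rightarrow> (nat \<times> nat \<Rightarrow> real) \<Rightarrow> nat \<times> nat \<Rightarrow> real" where
  "matmul m A B = (\<lambda>(i, j). \<Sum>k\<in>{1..m}. A (i, k) * B (k, j))"

definition munit :: "nat \<Rightarrow> nat \<Rightarrow> nat \<times> nat \<Rightarrow> real" where
  "munit i j = (\<lambda>a. if a = (i, j) then 1 else 0)"

lemma matmul_add_left: "matmul m (A + B) C = matmul m A C + matmul m B C"
  by (auto simp: matmul_def fun_eq_iff sum.distrib algebra_simps)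

lemma matmul_add_right: "matmul m A (B + C) = matmul m A B + matmul m A C"
  by (auto simp: matmul_def fun_eq_iff sum.distrib algebra_simps)

lemma matmul_diff_left: "matmul m (A - B) C = matmul m A C - matmul m B C"
  by (auto simp: matmul_def fun_eq_iff sum_subtractf algebra_simps)

lemma matmul_diff_right: "matmul m A (B - C) = matmul m A B - matmul m A C"
  by (auto simp: matmul_def fun_eq_iff sum_subtractf algebra_simps)

lemma matmul_zero [simp]: "matmul m A 0 = 0" "matmul m 0 A = 0"
  by (auto simp: matmul_def fun_eq_iff)

lemma matmul_munit:
  assumes "j \<in> {1..m}"
  shows "matmul m (munit i j) (munit h k) = (if j = h then munit i k else 0)"
proof
  fix a :: "nat \<times> nat"
  obtain r s where a: "a = (r, s)" by force
  have "(\<Sum>l\<in>{1..m}. munit i j (r, l) * munit h k (l, s))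
      = (\<Sum>l\<in>{1..m}. if l = j then (if j = h \<and> r = i \<and> s = k then 1 else 0) else 0)"
    by (rule sum.cong) (auto simp: munit_def)
  also have "\<dots> = (if j = h \<and> r = i \<and> s = k then 1 else 0)"
    using assms by (subst sum.delta) auto
  finally show "matmul m (munit i j) (munit h k) a = (if j = h then munit i k else 0) a"
    by (auto simp: matmul_def a munit_def)
qed

text \<open>The forms that send \<open>A\<close> and \<open>B\<close> to a linear functional of \<open>A B - B A\<close> have this property. The
  lemmas below recover such a functional from the values of \<open>\<omega>\<close> on pairs of matrix units.\<close>

locale alternating_on_matrices =
  fixes m :: nat and \<omega> :: "(nat \<times> nat \<Rightarrow> real) \<Rightarrow> (nat \<times> nat \<Rightarrow> real) \<Rightarrow> real"
  assumes add_left: "\<omega> (A + B) C = \<omega> A C + \<omega> B C"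
    and alt: "\<omega> A B = - \<omega> B A"
    and comm_zero: "matmul m A B = matmul m B A \<Longrightarrow> \<omega> A B = 0"
begin

lemma add_right: "\<omega> A (B + C) = \<omega> A B + \<omega> A C"
  using alt[of A "B + C"] alt[of A B] alt[of A C] add_left[of B C A] by linarith

lemma diff_left: "\<omega> (A - B) C = \<omega> A C - \<omega> B C"
  using add_left[of "A - B" B C] by simp

lemma diff_right: "\<omega> A (B - C) = \<omega> A B - \<omega> A C"
  using add_right[of A "B - C" C] by simp

lemma munit_disjoint:
  assumes "j \<in> {1..m}" "k \<in> {1..m}" "j \<noteq> h" "i \<noteq> k"
  shows "\<omega> (munit i j) (munit h k) = 0"
  by (rule comm_zero) (use assms in \<open>simp add: matmul_munit\<close>)

text \<open>The value that the functional takes on the unit \<open>E\<^sub>i\<^sub>k = [E\<^sub>i\<^sub>j, E\<^sub>j\<^sub>k]\<close> is independent of \<open>j\<close>, because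
  \<open>E\<^sub>i\<^sub>j + E\<^sub>i\<^sub>l\<close> commutes with \<open>E\<^sub>j\<^sub>k - E\<^sub>l\<^sub>k\<close>: both products vanish.\<close>

lemma munit_path_indep:
  assumes "i \<in> {1..m}" "j \<in> {1..m}" "l \<in> {1..m}" "k \<in> {1..m}" "i \<noteq> k"
  shows "\<omega> (munit i j) (munit j k) = \<omega> (munit i l) (munit l k)"
proof (cases "j = l")
  case False
  have "\<omega> (munit i j + munit i l) (munit j k - munit l k) = 0"
    by (rule comm_zero)
      (use assms False in \<open>simp add: matmul_add_left matmul_add_right matmul_diff_left
          matmul_diff_right matmul_munit\<close>)
  moreover have "\<omega> (munit i l) (munit j k) = 0" "\<omega> (munit i j) (munit l k) = 0"
    using assms False by (auto intro: munit_disjoint)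
  ultimately show ?thesis by (simp add: add_left diff_right)
qed simp

text \<open>The cyclic permutation matrix of \<open>i, j, k\<close> commutes with its transpose. The result is the cocycle
  identity that makes \<open>E\<^sub>i\<^sub>i - E\<^sub>j\<^sub>j = [E\<^sub>i\<^sub>j, E\<^sub>j\<^sub>i]\<close> have a well-defined value.\<close>

lemma munit_cycle:
  assumes "i \<in> {1..m}" "j \<in> {1..m}" "k \<in> {1..m}" "i \<noteq> j" "j \<noteq> k" "k \<noteq> i"
  shows "\<omega> (munit i j) (munit j i) + \<omega> (munit j k) (munit k j) + \<omega> (munit k i) (munit i k) = 0"
proof -
  have "\<omega> (munit i j + munit j k + munit k i) (munit j i + munit k j + munit i k) = 0"
    by (rule comm_zero)
      (use assms in \<open>simp add: matmul_add_left matmul_add_right matmul_munit algebra_simps\<close>)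
  then show ?thesis
    using assms by (simp add: add_left add_right munit_disjoint)
qed

text \<open>The hypotheses determine the functional on every commutator of two units: \<open>h1\<close> with \<open>i \<noteq> j\<close>
  gives its value on \<open>E\<^sub>i\<^sub>j\<close> away from the first row and column, \<open>h1\<close> with \<open>i = j\<close> gives its value on
  \<open>E\<^sub>1\<^sub>1 - E\<^sub>i\<^sub>i\<close>, and \<open>h2\<close>, \<open>h3\<close> concern the first column and the first row. The matrix
  \<open>E\<^sub>1\<^sub>1 - E\<^sub>m\<^sub>m\<close> occurs because traceless matrices have no coordinate for \<open>E\<^sub>1\<^sub>1\<close> alone.\<close>

lemma zero_on_units:
  assumes m: "m \<ge> 2"
    and h1: "\<And>i j. i \<in> {2..m} \<Longrightarrow> j \<in> {2..m} \<Longrightarrow> \<omega> (munit 1 j) (munit i 1) = 0"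
    and h2: "\<And>i. i \<in> {2..m} \<Longrightarrow> \<omega> (munit 1 1 - munit m m) (munit i 1) = 0"
    and h3: "\<And>j. j \<in> {2..m} \<Longrightarrow> \<omega> (munit 1 1 - munit m m) (munit 1 j) = 0"
    and ij: "i \<in> {1..m}" "j \<in> {1..m}" and hk: "h \<in> {1..m}" "k \<in> {1..m}"
  shows "\<omega> (munit i j) (munit h k) = 0"
proof -
  have one: "1 \<in> {1..m}" and mm: "m \<in> {1..m}" using m by auto
  have path: "\<omega> (munit i j) (munit j k) = 0"
    if "i \<in> {1..m}" "j \<in> {1..m}" "k \<in> {1..m}" "i \<noteq> k" for i j k
  proof -
    consider "i \<noteq> 1" "k \<noteq> 1" | "k = 1" "i \<noteq> 1" | "i = 1" "k \<noteq> 1" using \<open>i \<noteq> k\<close> by auto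
    then have "\<omega> (munit i 1) (munit 1 k) = 0"
    proof cases
      case 1
      then show ?thesis using h1[of i k] that alt[of "munit i 1" "munit 1 k"] by simp
    next
      case 2
      have eq: "\<omega> (munit 1 1) (munit i 1) = \<omega> (munit m m) (munit i 1)"
        using h2[of i] 2 that by (simp add: diff_left)
      show ?thesis
      proof (cases "i = m")
        case True
        \<comment> \<open>Here both terms of \<open>h2\<close> contribute, with equal values up to sign: twice the value is zero.\<close>
        have "\<omega> (munit m m) (munit m 1) = \<omega> (munit m 1) (munit 1 1)"
          by (rule munit_path_indep) (use one mm m in auto)
        with eq show ?thesis using alt[of "munit 1 1" "munit m 1"] True 2 by simp
      next
        case False
        have "\<omega> (munit m m) (munit i 1) = 0"
          by (rule munit_disjoint) (use False one mm m in auto)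
        then show ?thesis using eq alt[of "munit 1 1" "munit i 1"] 2 by simp
      qed
    next
      case 3
      have eq: "\<omega> (munit 1 1) (munit 1 k) = \<omega> (munit m m) (munit 1 k)"
        using h3[of k] 3 that by (simp add: diff_left)
      show ?thesis
      proof (cases "k = m")
        case True
        have "\<omega> (munit 1 m) (munit m m) = \<omega> (munit 1 1) (munit 1 m)"
          by (rule munit_path_indep) (use one mm m in auto)
        with eq show ?thesis using alt[of "munit m m" "munit 1 m"] True 3 by simp
      next
        case False
        have "\<omega> (munit m m) (munit 1 k) = 0"
          by (rule munit_disjoint) (use False that one mm m in auto)
        then show ?thesis using eq 3 by simp
      qed
    qed
    then show ?thesis using munit_path_indep[of i j 1 k] that one by simp
  qed
  have loop1: "\<omega> (munit 1 j) (munit j 1) = 0" if "j \<in> {1..m}" for j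
  proof (cases "j = 1")
    case True
    then show ?thesis using alt[of "munit 1 1" "munit 1 1"] by simp
  next
    case False
    then show ?thesis using h1[of j j] that by simp
  qed
  have loop: "\<omega> (munit i j) (munit j i) = 0" if "i \<in> {1..m}" "j \<in> {1..m}" for i j
  proof -
    consider "i = j" | "i = 1" | "j = 1" | "i \<noteq> j" "j \<noteq> 1" "1 \<noteq> i" by auto
    then show ?thesis
    proof cases
      case 1
      then show ?thesis using alt[of "munit i i" "munit i i"] by simp
    next
      case 2
      then show ?thesis using loop1[of j] that by simp
    next
      case 3
      then show ?thesis using loop1[of i] alt[of "munit i 1" "munit 1 i"] that by simp
    next
      case 4
      from munit_cycle[of i j 1, OF that one 4] show ?thesis
        using loop1[of i] loop1[of j] alt[of "munit j 1" "munit 1 j"] that by simp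
    qed
  qed
  consider "j \<noteq> h" "i \<noteq> k" | "j = h" "i \<noteq> k" | "j \<noteq> h" "i = k" | "j = h" "i = k" by auto
  then show ?thesis
  proof cases
    case 1
    then show ?thesis using munit_disjoint ij hk by blast
  next
    case 2
    then show ?thesis using path ij hk by blast
  next
    case 3
    then show ?thesis
      using path[of h k j] alt[of "munit i j" "munit h k"] ij hk by auto
  next
    case 4
    then show ?thesis using loop ij by blast
  qed
qed

end

section \<open>Consequences of the trace and commutator relations\<close>

text \<open>In the application \<open>W\<close> consists of the functions that are combinations of \<open>Y\<close> modulo \<open>J\<^sup>3\<close>, and
  \<open>t a b\<close> is \<open>t\<^sub>a\<^sub>b(p, q)\<close> for fixed \<open>p\<close> and \<open>q\<close>. Up to order, the pairs of different indices that satisfy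
  the premises of \<open>regular\<close> are those in \<open>index_J m\<close>. Closure under halving replaces division by \<open>2\<close>.\<close>

locale commutator_relations =
  fixes m :: nat and W :: "'c::ab_group_add set" and t :: "nat \<times> nat \<Rightarrow> nat \<times> nat \<Rightarrow> 'c"
  assumes m2: "m \<ge> 2"
    and zero_mem: "0 \<in> W"
    and add_mem: "f \<in> W \<Longrightarrow> g \<in> W \<Longrightarrow> f + g \<in> W"
    and uminus_mem: "f \<in> W \<Longrightarrow> - f \<in> W"
    and half_mem: "f + f \<in> W \<Longrightarrow> f \<in> W"
    and antisym: "t b a = - t a b"
    and trace: "a \<in> {1..m} \<times> {1..m} \<Longrightarrow> (\<Sum>r\<in>{1..m}. t a (r, r)) \<in> W"
    and commutator: "i \<in> {1..m} \<Longrightarrow> j \<in> {1..m} \<Longrightarrow> (\<Sum>k\<in>{1..m}. t (i, k) (k, j)) \<in> W"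
    and regular: "a \<in> {1..m} \<times> {1..m} - {(m, m)} \<Longrightarrow> b \<in> {1..m} \<times> {1..m} - {(m, m)} \<Longrightarrow>
      \<not> (fst a = 1 \<and> snd b = 1) \<Longrightarrow> \<not> (snd a = 1 \<and> fst b = 1) \<Longrightarrow> t a b \<in> W"
begin

lemma swap_mem: "t a b \<in> W \<Longrightarrow> t b a \<in> W"
  using uminus_mem[of "t a b"] antisym[of b a] by simp

lemma diag_mem: "t a a \<in> W"
  using antisym[of a a] half_mem[of "t a a"] zero_mem by (metis add.right_inverse)

lemma sum_mem: "(\<And>i. i \<in> I \<Longrightarrow> f i \<in> W) \<Longrightarrow> (\<Sum>i\<in>I. f i) \<in> W"
  by (induction I rule: infinite_finite_induct) (auto intro: zero_mem add_mem)

lemma sum_split_mem: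
  assumes "(\<Sum>i\<in>I. f i) \<in> W" "finite I" "A \<subseteq> I" "\<And>i. i \<in> I - A \<Longrightarrow> f i \<in> W"
  shows "(\<Sum>i\<in>A. f i) \<in> W"
proof -
  have "(\<Sum>i\<in>I. f i) = (\<Sum>i\<in>I - A. f i) + (\<Sum>i\<in>A. f i)"
    using assms by (intro sum.subset_diff) auto
  moreover have "(\<Sum>i\<in>I - A. f i) \<in> W" by (rule sum_mem) (rule assms)
  ultimately show ?thesis
    using add_mem[OF assms(1) uminus_mem] by (metis add_diff_cancel_left' diff_conv_add_uminus)
qed

lemma last_mem:
  assumes a: "a \<in> {2..m} \<times> {2..m}"
  shows "t a (m, m) \<in> W"
proof (cases "a = (m, m)")
  case True
  then show ?thesis by (simp add: diag_mem)
next
  case False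
  have "(\<Sum>r\<in>{m}. t a (r, r)) \<in> W"
    by (rule sum_split_mem[OF trace]) (use a m2 False in \<open>auto intro!: regular\<close>)
  then show ?thesis by simp
qed

lemma lower_block_mem:
  assumes "a \<in> {2..m} \<times> {2..m}" "b \<in> {2..m} \<times> {2..m}"
  shows "t a b \<in> W"
proof -
  consider "b = (m, m)" | "a = (m, m)" | "a \<noteq> (m, m)" "b \<noteq> (m, m)" by auto
  then show ?thesis
    by cases (use assms last_mem swap_mem in \<open>auto intro!: regular\<close>)
qed

text \<open>In the entry \<open>(i, j)\<close> of the commutator with \<open>i, j \<ge> 2\<close> only the summand \<open>k = 1\<close> meets the first row
  or column.\<close>

lemma row_col_mem:
  assumes ij: "i \<in> {2..m}" "j \<in> {2..m}"
  shows "t (i, 1) (1, j) \<in> W"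
proof -
  have "(\<Sum>k\<in>{1}. t (i, k) (k, j)) \<in> W"
    by (rule sum_split_mem[OF commutator]) (use ij m2 in \<open>auto intro!: lower_block_mem\<close>)
  then show ?thesis by simp
qed

text \<open>For \<open>i = m\<close> the entry \<open>(m, 1)\<close> of the commutator also contains \<open>t (m, m) (m, 1)\<close>. The trace relation
  turns this term into another copy of \<open>t (m, 1) (1, 1)\<close>, so that twice the wanted element is in \<open>W\<close>.\<close>

lemma col_corner_mem:
  assumes i: "i \<in> {2..m}"
  shows "t (i, 1) (1, 1) \<in> W"
proof (cases "i = m")
  case False
  have "(\<Sum>k\<in>{1}. t (i, k) (k, 1)) \<in> W"
    by (rule sum_split_mem[OF commutator]) (use i m2 False in \<open>auto intro!: regular\<close>)
  then show ?thesis by simp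
next
  case True
  have "(\<Sum>k\<in>{1, m}. t (m, k) (k, 1)) \<in> W"
    by (rule sum_split_mem[OF commutator]) (use m2 in \<open>auto intro!: regular\<close>)
  then have 1: "t (m, 1) (1, 1) + t (m, m) (m, 1) \<in> W" using m2 by simp
  have "(\<Sum>r\<in>{1, m}. t (m, 1) (r, r)) \<in> W"
    by (rule sum_split_mem[OF trace]) (use m2 in \<open>auto intro!: regular\<close>)
  then have 2: "t (m, 1) (1, 1) + t (m, 1) (m, m) \<in> W" using m2 by simp
  have "t (m, 1) (1, 1) + t (m, 1) (1, 1) \<in> W"
    using add_mem[OF 1 2] antisym[of "(m, m)" "(m, 1)"] by (simp add: algebra_simps)
  then show ?thesis using True half_mem by blast
qed

end

text \<open>Transposing all matrices reverses products and exchanges the first row with the first column;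
  it saves a second proof of \<open>col_corner_mem\<close> for the row.\<close>

lemma (in commutator_relations) transposed:
  "commutator_relations m W (\<lambda>a b. t (prod.swap b) (prod.swap a))"
proof unfold_locales
  fix a :: "nat \<times> nat" assume a: "a \<in> {1..m} \<times> {1..m}"
  have "(\<Sum>r\<in>{1..m}. t (r, r) (prod.swap a)) = - (\<Sum>r\<in>{1..m}. t (prod.swap a) (r, r))"
    by (subst antisym) (simp add: sum_negf)
  then show "(\<Sum>r\<in>{1..m}. t (prod.swap (r, r)) (prod.swap a)) \<in> W"
    using uminus_mem[OF trace[of "prod.swap a"]] a by auto
next
  fix i j :: nat assume "i \<in> {1..m}" "j \<in> {1..m}"
  then show "(\<Sum>k\<in>{1..m}. t (prod.swap (k, j)) (prod.swap (i, k))) \<in> W"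
    using commutator[of j i] by simp
next
  fix a b :: "nat \<times> nat"
  assume ab: "a \<in> {1..m} \<times> {1..m} - {(m, m)}" "b \<in> {1..m} \<times> {1..m} - {(m, m)}"
    "\<not> (fst a = 1 \<and> snd b = 1)" "\<not> (snd a = 1 \<and> fst b = 1)"
  show "t (prod.swap b) (prod.swap a) \<in> W"
    by (rule regular) (use ab in auto)
next
  fix a b :: "nat \<times> nat"
  show "t (prod.swap a) (prod.swap b) = - t (prod.swap b) (prod.swap a)" by (rule antisym)
qed (fact m2 zero_mem add_mem uminus_mem half_mem)+

proposition (in commutator_relations) all_mem:
  assumes a: "a \<in> {1..m} \<times> {1..m}" and b: "b \<in> {1..m} \<times> {1..m}"
  shows "t a b \<in> W"
proof -
  have corner_row: "t (1, 1) (1, j) \<in> W" if "j \<in> {2..m}" for j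
    using commutator_relations.col_corner_mem[OF transposed that] by simp
  have 1: "t a b \<in> W" if a: "a \<in> {1..m} \<times> {1..m} - {(m, m)}"
    and b: "b \<in> {1..m} \<times> {1..m} - {(m, m)}" and e: "snd a = 1" "fst b = 1" for a b
  proof -
    obtain i j where ij: "a = (i, 1)" "b = (1, j)" using e by (cases a; cases b) auto
    have "i \<in> {1} \<union> {2..m}" "j \<in> {1} \<union> {2..m}" using a b ij by auto
    then show ?thesis
      using row_col_mem col_corner_mem corner_row diag_mem ij by auto
  qed
  have proper: "t a b \<in> W" if a: "a \<in> {1..m} \<times> {1..m} - {(m, m)}"
    and b: "b \<in> {1..m} \<times> {1..m} - {(m, m)}" for a b
    using 1[OF a b] swap_mem[OF 1[OF b a]] regular[OF a b] by blast
  have last: "t a (m, m) \<in> W" if a: "a \<in> {1..m} \<times> {1..m} - {(m, m)}" for a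
  proof -
    have "(\<Sum>r\<in>{m}. t a (r, r)) \<in> W"
      by (rule sum_split_mem[OF trace]) (use a m2 in \<open>auto intro!: proper\<close>)
    then show ?thesis by simp
  qed
  consider "a = (m, m)" "b = (m, m)" | "a = (m, m)" "b \<noteq> (m, m)" | "a \<noteq> (m, m)" "b = (m, m)"
    | "a \<noteq> (m, m)" "b \<noteq> (m, m)" by blast
  then show ?thesis
    by cases (use a b diag_mem last swap_mem proper in auto)
qed

section \<open>Bases of the graded pieces of an ideal\<close>

lemma (in ring) ideal_pow_ideal: "ideal J R \<Longrightarrow> ideal (ideal_pow R J k) R"
  by (induction k) (auto simp: oneideal ideal_prod_is_ideal)

lemma (in ring) ideal_pow_Suc_subset: "ideal J R \<Longrightarrow> ideal_pow R J (Suc k) \<subseteq> ideal_pow R J k"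
  using ideal_prod_inter[OF ideal_pow_ideal] by auto

lemma (in cring) ideal_pow_mult:
  assumes J: "ideal J R" and f: "f \<in> ideal_pow R J j" and g: "g \<in> ideal_pow R J k"
  shows "f \<otimes> g \<in> ideal_pow R J (j + k)"
  using g
proof (induction k arbitrary: g)
  case 0
  then show ?case using ideal.I_r_closed[OF ideal_pow_ideal[OF J] f] by simp
next
  case (Suc k)
  have carr: "h \<in> carrier R" if "h \<in> ideal_pow R J l" for h l
    using ideal.Icarr[OF ideal_pow_ideal[OF J] that] .
  from Suc.prems have "g \<in> ideal_prod R (ideal_pow R J k) J" by simp
  then show ?case
  proof (induction g rule: ideal_prod.induct)
    case (prod a b)
    then have "f \<otimes> (a \<otimes> b) = (f \<otimes> a) \<otimes> b"
      using carr f ideal.Icarr[OF J] by (simp add: m_assoc)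
    then show ?case using Suc.IH prod by (auto intro: ideal_prod.prod)
  next
    case (sum a b)
    then have "f \<otimes> (a \<oplus> b) = f \<otimes> a \<oplus> f \<otimes> b"
      using carr[of _ "Suc k"] carr f by (simp add: r_distr)
    then show ?case using sum by (auto intro: ideal_prod.sum)
  qed
qed

text \<open>Multiplication by a scalar is multiplication by the corresponding multiple of the unit.\<close>

lemma (in algebra) smult_ideal_closed:
  assumes "ideal N M" "q \<in> carrier R" "f \<in> N"
  shows "q \<odot>\<^bsub>M\<^esub> f \<in> N"
proof -
  interpret N: ideal N M by fact
  have f: "f \<in> carrier M" using assms N.Icarr by auto
  have "q \<odot>\<^bsub>M\<^esub> f = (q \<odot>\<^bsub>M\<^esub> \<one>\<^bsub>M\<^esub>) \<otimes>\<^bsub>M\<^esub> f"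
    using smult_assoc2[of q "\<one>\<^bsub>M\<^esub>" f] assms f by simp
  then show ?thesis using N.I_l_closed assms by simp
qed

locale graded_piece = algebra "class_ring :: rat ring" A
  for A :: "(rat, 'c, 'd) module_scheme" +
  fixes J :: "'c set" and k :: nat
  assumes J: "ideal J A"
begin

abbreviation "P \<equiv> ideal_pow A J k"
abbreviation "N \<equiv> ideal_pow A J (Suc k)"
abbreviation "V \<equiv> gr A J k"
abbreviation "cls \<equiv> gr_class A J k"

lemma N_ideal: "ideal N A" by (rule ideal_pow_ideal[OF J])
lemma P_ideal: "ideal P A" by (rule ideal_pow_ideal[OF J])

sublocale N: ideal N A by (rule N_ideal)
sublocale P: ideal P A by (rule P_ideal)

lemma P_carr: "f \<in> P \<Longrightarrow> f \<in> carrier A" by (rule P.Icarr)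

lemma smult_P: "f \<in> P \<Longrightarrow> q \<odot>\<^bsub>A\<^esub> f \<in> P"
  by (rule smult_ideal_closed[OF P_ideal]) auto

lemma smult_N: "f \<in> N \<Longrightarrow> q \<odot>\<^bsub>A\<^esub> f \<in> N"
  by (rule smult_ideal_closed[OF N_ideal]) auto

lemma smult_rat:
  assumes "f \<in> carrier A"
  shows "0 \<odot>\<^bsub>A\<^esub> f = \<zero>\<^bsub>A\<^esub>" and "1 \<odot>\<^bsub>A\<^esub> f = f" and "(a * b) \<odot>\<^bsub>A\<^esub> f = a \<odot>\<^bsub>A\<^esub> (b \<odot>\<^bsub>A\<^esub> f)"
    and "(a + b) \<odot>\<^bsub>A\<^esub> f = a \<odot>\<^bsub>A\<^esub> f \<oplus>\<^bsub>A\<^esub> b \<odot>\<^bsub>A\<^esub> f"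
  using smult_l_null[of f] smult_one[of f] smult_assoc1[of a b f] smult_l_distr[of a b f] assms
  by simp_all

lemma cls_eq_iff:
  assumes "f \<in> P" "g \<in> P"
  shows "cls f = cls g \<longleftrightarrow> f \<ominus>\<^bsub>A\<^esub> g \<in> N"
  unfolding gr_class_def
  using quotient_eq_iff_same_a_r_cos[OF N_ideal] assms P_carr by blast

lemma carrier_V: "carrier V = cls ` P"
  by (simp add: gr_def gr_class_def Let_def)

lemma add_V: "f \<in> P \<Longrightarrow> g \<in> P \<Longrightarrow> cls f \<oplus>\<^bsub>V\<^esub> cls g = cls (f \<oplus>\<^bsub>A\<^esub> g)"
  by (simp add: gr_def gr_class_def Let_def N.a_rcos_sum P_carr del: ideal_pow.simps)

lemma zero_V: "\<zero>\<^bsub>V\<^esub> = cls \<zero>\<^bsub>A\<^esub>"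
  by (simp add: gr_def gr_class_def Let_def a_coset_add_zero N.a_subset del: ideal_pow.simps)

lemma smult_V:
  assumes f: "f \<in> P"
  shows "q \<odot>\<^bsub>V\<^esub> cls f = cls (q \<odot>\<^bsub>A\<^esub> f)"
proof -
  have "cls (q \<odot>\<^bsub>A\<^esub> g) = cls (q \<odot>\<^bsub>A\<^esub> f)" if g: "g \<in> cls f" for g
  proof -
    obtain n where n: "n \<in> N" "g = n \<oplus>\<^bsub>A\<^esub> f"
      using g by (auto simp: gr_class_def a_r_coset_def' simp del: ideal_pow.simps)
    have nP: "n \<in> P" using n ideal_pow_Suc_subset[OF J] by blast
    have "q \<odot>\<^bsub>A\<^esub> g \<ominus>\<^bsub>A\<^esub> q \<odot>\<^bsub>A\<^esub> f = q \<odot>\<^bsub>A\<^esub> n"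
      using n P_carr[OF nP] P_carr[OF f] 
      by (simp add: smult_r_distr M.minus_eq M.a_assoc M.r_neg)
    then have "q \<odot>\<^bsub>A\<^esub> g \<ominus>\<^bsub>A\<^esub> q \<odot>\<^bsub>A\<^esub> f \<in> N" using smult_N n by simp
    moreover have "g \<in> P" using n nP f by simp
    ultimately show ?thesis using cls_eq_iff f smult_P by blast
  qed
  moreover have "f \<in> cls f"
    using N.a_rcos_self P_carr[OF f] by (simp add: gr_class_def del: ideal_pow.simps)
  ultimately have "(\<Union>g\<in>cls f. cls (q \<odot>\<^bsub>A\<^esub> g)) = cls (q \<odot>\<^bsub>A\<^esub> f)" by blast
  then show ?thesis by (simp add: gr_def gr_class_def Let_def del: ideal_pow.simps)
qed

lemma vectorspace_V: "vectorspace (class_ring :: rat ring) V"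
proof (rule vs_criteria)
  show "field (class_ring :: rat ring)" by (rule class_field)
  show "\<zero>\<^bsub>V\<^esub> \<in> carrier V" by (auto simp: zero_V carrier_V)
  show "\<forall>v w. v \<in> carrier V \<and> w \<in> carrier V \<longrightarrow> v \<oplus>\<^bsub>V\<^esub> w \<in> carrier V"
    by (auto simp: carrier_V add_V)
  show "\<forall>v\<in>carrier V. \<exists>w\<in>carrier V. v \<oplus>\<^bsub>V\<^esub> w = \<zero>\<^bsub>V\<^esub>"
  proof
    fix v assume "v \<in> carrier V"
    then obtain f where f: "f \<in> P" "v = cls f" by (auto simp: carrier_V)
    then have "v \<oplus>\<^bsub>V\<^esub> cls (\<ominus>\<^bsub>A\<^esub> f) = \<zero>\<^bsub>V\<^esub>"
      by (simp add: add_V zero_V M.r_neg P_carr)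
    then show "\<exists>w\<in>carrier V. v \<oplus>\<^bsub>V\<^esub> w = \<zero>\<^bsub>V\<^esub>" using f by (auto simp: carrier_V)
  qed
qed (auto simp: carrier_V add_V zero_V smult_V smult_P P_carr M.a_ac smult_rat smult_r_distr)

lemma finsum_P: "(\<And>i. i \<in> I \<Longrightarrow> f i \<in> P) \<Longrightarrow> (\<Oplus>\<^bsub>A\<^esub>i\<in>I. f i) \<in> P"
  by (induction I rule: infinite_finite_induct) (auto simp: P_carr Pi_def)

lemma finsum_V:
  assumes "\<And>i. i \<in> I \<Longrightarrow> f i \<in> P"
  shows "(\<Oplus>\<^bsub>V\<^esub>i\<in>I. cls (f i)) = cls (\<Oplus>\<^bsub>A\<^esub>i\<in>I. f i)"
proof -
  interpret V: vectorspace "class_ring :: rat ring" V by (rule vectorspace_V)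
  show ?thesis
    using assms
  proof (induction I rule: infinite_finite_induct)
    case (insert i I)
    then show ?case
      by (simp add: carrier_V P_carr Pi_def add_V finsum_P)
  qed (simp_all add: zero_V)
qed

text \<open>The elements are given as a family because a coincidence \<open>y i = y j\<close> with \<open>i \<noteq> j\<close> would contradict
  \<open>indep\<close>, just as a coincidence of classes would. Injectivity thus follows from the same hypothesis
  as linear independence.\<close>

proposition basis_of_family:
  fixes y :: "'i \<Rightarrow> 'c"
  assumes fin: "finite I" and y: "\<And>i. i \<in> I \<Longrightarrow> y i \<in> P"
    and indep: "\<And>a. (\<Oplus>\<^bsub>A\<^esub>i\<in>I. a i \<odot>\<^bsub>A\<^esub> y i) \<in> N \<Longrightarrow> \<forall>i\<in>I. a i = 0"
    and span: "\<And>f. f \<in> P \<Longrightarrow> \<exists>a. f \<ominus>\<^bsub>A\<^esub> (\<Oplus>\<^bsub>A\<^esub>i\<in>I. a i \<odot>\<^bsub>A\<^esub> y i) \<in> N"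
  shows "inj_on cls (y ` I)" and "vectorspace.basis (class_ring :: rat ring) V (cls ` y ` I)"
proof -
  interpret V: vectorspace "class_ring :: rat ring" V by (rule vectorspace_V)
  have y': "i \<in> I \<Longrightarrow> y i \<in> carrier A" for i using y P_carr by blast
  have inj: "inj_on (\<lambda>i. cls (y i)) I"
  proof (rule inj_onI, rule ccontr)
    fix i j assume ij: "i \<in> I" "j \<in> I" "cls (y i) = cls (y j)" "i \<noteq> j"
    define a :: "'i \<Rightarrow> rat" where "a l = (if l = i then 1 else if l = j then - 1 else 0)" for l
    have "(\<Oplus>\<^bsub>A\<^esub>l\<in>I. a l \<odot>\<^bsub>A\<^esub> y l) = (\<Oplus>\<^bsub>A\<^esub>l\<in>{i, j}. a l \<odot>\<^bsub>A\<^esub> y l)"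
      by (rule M.add.finprod_mono_neutral_cong_right) (use ij fin y' in \<open>auto simp: a_def smult_rat\<close>)
    also have "\<dots> = y i \<ominus>\<^bsub>A\<^esub> y j"
      using ij y' smult_l_minus[of 1 "y j"] by (simp add: a_def M.minus_eq smult_rat class_ring_simps)
    also have "\<dots> \<in> N" using ij cls_eq_iff y by blast
    finally have "a i = 0" using indep ij by blast
    then show False by (simp add: a_def)
  qed
  then show "inj_on cls (y ` I)" by (auto simp: inj_on_def)
  have clsV: "cls ` y ` I \<subseteq> carrier V" using y by (auto simp: carrier_V)
  have comb: "V.lincomb b (cls ` y ` I) = cls (\<Oplus>\<^bsub>A\<^esub>i\<in>I. b (cls (y i)) \<odot>\<^bsub>A\<^esub> y i)" for b
  proof -
    have "V.lincomb b (cls ` y ` I) = (\<Oplus>\<^bsub>V\<^esub>i\<in>I. b (cls (y i)) \<odot>\<^bsub>V\<^esub> cls (y i))"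
      unfolding V.lincomb_def image_image
      by (rule V.M.add.finprod_reindex) (use inj y smult_V smult_P in \<open>auto simp: carrier_V\<close>)
    also have "\<dots> = (\<Oplus>\<^bsub>V\<^esub>i\<in>I. cls (b (cls (y i)) \<odot>\<^bsub>A\<^esub> y i))"
      by (rule V.M.add.finprod_cong') (use y smult_V smult_P in \<open>auto simp: carrier_V\<close>)
    also have "\<dots> = cls (\<Oplus>\<^bsub>A\<^esub>i\<in>I. b (cls (y i)) \<odot>\<^bsub>A\<^esub> y i)"
      by (rule finsum_V) (use y smult_P in auto)
    finally show ?thesis .
  qed
  have "V.lin_indpt (cls ` y ` I)"
  proof (rule V.finite_lin_indpt2)
    fix b assume "V.lincomb b (cls ` y ` I) = \<zero>\<^bsub>V\<^esub>"
    then have "cls (\<Oplus>\<^bsub>A\<^esub>i\<in>I. b (cls (y i)) \<odot>\<^bsub>A\<^esub> y i) = cls \<zero>\<^bsub>A\<^esub>"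
      by (simp add: comb zero_V)
    moreover have S: "(\<Oplus>\<^bsub>A\<^esub>i\<in>I. b (cls (y i)) \<odot>\<^bsub>A\<^esub> y i) \<in> P"
      by (rule finsum_P) (use y smult_P in auto)
    ultimately have "(\<Oplus>\<^bsub>A\<^esub>i\<in>I. b (cls (y i)) \<odot>\<^bsub>A\<^esub> y i) \<ominus>\<^bsub>A\<^esub> \<zero>\<^bsub>A\<^esub> \<in> N"
      using cls_eq_iff[OF S P.zero_closed] by blast
    then have "(\<Oplus>\<^bsub>A\<^esub>i\<in>I. b (cls (y i)) \<odot>\<^bsub>A\<^esub> y i) \<in> N"
      using P_carr[OF S] by (simp add: M.minus_eq)
    from indep[OF this] show "\<forall>v\<in>cls ` y ` I. b v = \<zero>\<^bsub>class_ring\<^esub>" by auto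
  qed (use fin clsV in auto)
  moreover have "V.span (cls ` y ` I) = carrier V"
  proof
    show "V.span (cls ` y ` I) \<subseteq> carrier V"
      using V.span_is_subset2[OF clsV] .
    show "carrier V \<subseteq> V.span (cls ` y ` I)"
    proof
      fix v assume "v \<in> carrier V"
      then obtain f where f: "f \<in> P" "v = cls f" by (auto simp: carrier_V)
      obtain a where a: "f \<ominus>\<^bsub>A\<^esub> (\<Oplus>\<^bsub>A\<^esub>i\<in>I. a i \<odot>\<^bsub>A\<^esub> y i) \<in> N" using span f by blast
      \<comment> \<open>Coefficients must be functions of the classes rather than of the indices.\<close>
      define b where "b = a \<circ> the_inv_into I (\<lambda>i. cls (y i))"
      have b: "b (cls (y i)) = a i" if "i \<in> I" for i
        using the_inv_into_f_f[OF inj that] by (simp add: b_def)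
      have "(\<Oplus>\<^bsub>A\<^esub>i\<in>I. b (cls (y i)) \<odot>\<^bsub>A\<^esub> y i) = (\<Oplus>\<^bsub>A\<^esub>i\<in>I. a i \<odot>\<^bsub>A\<^esub> y i)"
        by (rule M.add.finprod_cong') (use b y' in auto)
      moreover have "(\<Oplus>\<^bsub>A\<^esub>i\<in>I. a i \<odot>\<^bsub>A\<^esub> y i) \<in> P"
        by (rule finsum_P) (use y smult_P in auto)
      ultimately have "v = V.lincomb b (cls ` y ` I)"
        using a f cls_eq_iff[of f "(\<Oplus>\<^bsub>A\<^esub>i\<in>I. a i \<odot>\<^bsub>A\<^esub> y i)"] by (simp add: comb)
      then show "v \<in> V.span (cls ` y ` I)"
        unfolding V.finite_span[OF finite_imageI[OF finite_imageI[OF fin]] clsV] by auto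
    qed
  qed
  ultimately show "V.basis (cls ` y ` I)" using clsV by (simp add: V.basis_def)
qed

end

section \<open>Algebras of complex-valued functions\<close>

lemma sum_fun_apply: "(\<Sum>i\<in>I. f i) r = (\<Sum>i\<in>I. f i r)" for f :: "'i \<Rightarrow> 'r \<Rightarrow> 'c::comm_monoid_add"
  by (induction I rule: infinite_finite_induct) auto

lemma fun_algebra_sel:
  "carrier (fun_algebra R) = R \<rightarrow>\<^sub>E UNIV"
  "f \<otimes>\<^bsub>fun_algebra R\<^esub> g = restrict (\<lambda>\<rho>. f \<rho> * g \<rho>) R"
  "f \<oplus>\<^bsub>fun_algebra R\<^esub> g = restrict (\<lambda>\<rho>. f \<rho> + g \<rho>) R"
  "\<one>\<^bsub>fun_algebra R\<^esub> = restrict (\<lambda>\<rho>. 1) R"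
  "\<zero>\<^bsub>fun_algebra R\<^esub> = restrict (\<lambda>\<rho>. 0) R"
  "q \<odot>\<^bsub>fun_algebra R\<^esub> f = restrict (\<lambda>\<rho>. of_rat q * f \<rho>) R"
  by (simp_all add: fun_algebra_def)

lemma cring_fun_algebra: "cring (fun_algebra R)"
proof (rule cringI)
  show "abelian_group (fun_algebra R)"
  proof (rule abelian_groupI)
    fix f assume f: "f \<in> carrier (fun_algebra R)"
    have "restrict (\<lambda>\<rho>. - f \<rho>) R \<oplus>\<^bsub>fun_algebra R\<^esub> f = \<zero>\<^bsub>fun_algebra R\<^esub>"
      by (auto simp: fun_algebra_sel)
    then show "\<exists>g\<in>carrier (fun_algebra R). g \<oplus>\<^bsub>fun_algebra R\<^esub> f = \<zero>\<^bsub>fun_algebra R\<^esub>"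
      by (intro bexI[of _ "restrict (\<lambda>\<rho>. - f \<rho>) R"]) (auto simp: fun_algebra_sel)
  qed (auto simp: fun_algebra_sel fun_eq_iff PiE_def extensional_def algebra_simps)
  show "comm_monoid (fun_algebra R)"
    by (rule comm_monoidI)
      (auto simp: fun_algebra_sel fun_eq_iff PiE_def extensional_def algebra_simps)
qed (auto simp: fun_algebra_sel fun_eq_iff algebra_simps)

lemma fun_algebra_minus:
  assumes "g \<in> carrier (fun_algebra R)"
  shows "f \<ominus>\<^bsub>fun_algebra R\<^esub> g = restrict (f - g) R"
proof -
  interpret F: cring "fun_algebra R" by (rule cring_fun_algebra)
  have "\<ominus>\<^bsub>fun_algebra R\<^esub> g = restrict (- g) R"
    by (rule F.minus_equality) (use assms in \<open>auto simp: fun_algebra_sel\<close>)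
  then show ?thesis by (auto simp: F.minus_eq fun_algebra_sel fun_eq_iff)
qed

lemma is_subalgebra_carrier: "is_subalgebra (carrier (fun_algebra R)) (fun_algebra R)"
proof -
  interpret cring "fun_algebra R" by (rule cring_fun_algebra)
  show ?thesis using carrier_is_subring by (auto simp: is_subalgebra_def fun_algebra_sel)
qed

lemma is_subalgebra_generated:
  assumes "S \<subseteq> carrier (fun_algebra R)"
  shows "is_subalgebra (carrier (generated_subalgebra (fun_algebra R) S)) (fun_algebra R)"
proof -
  interpret cring "fun_algebra R" by (rule cring_fun_algebra)
  let ?B = "{B. is_subalgebra B (fun_algebra R) \<and> S \<subseteq> B}"
  have "subring (\<Inter>?B) (fun_algebra R)"
  proof (rule subring_Inter)
    show "?B \<noteq> {}" using assms is_subalgebra_carrier by blast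
  qed (auto simp: is_subalgebra_def)
  then show ?thesis by (simp add: is_subalgebra_def generated_subalgebra_def)
qed

lemma generated_subalgebra_minimal:
  "is_subalgebra B (fun_algebra R) \<Longrightarrow> S \<subseteq> B \<Longrightarrow> carrier (generated_subalgebra (fun_algebra R) S) \<subseteq> B"
  by (auto simp: generated_subalgebra_def)

lemma generated_subalgebra_superset: "S \<subseteq> carrier (generated_subalgebra (fun_algebra R) S)"
  by (auto simp: generated_subalgebra_def)

text \<open>The values at arguments outside \<open>R\<close> are forced to be \<open>undefined\<close> in \<open>B\<close>. The rules \<open>restrict_ops\<close>
  transport pointwise calculations with arbitrary functions to \<open>B\<close>.\<close>

locale function_subalgebra =
  fixes R :: "'r set" and B :: "('r \<Rightarrow> complex) set"
  assumes subalgebra: "is_subalgebra B (fun_algebra R)"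
begin

abbreviation "A \<equiv> fun_algebra R\<lparr>carrier := B\<rparr>"

lemma B_subset: "B \<subseteq> R \<rightarrow>\<^sub>E UNIV"
  using subalgebra subring.axioms(1)[of B "fun_algebra R"] subringE(1)[of B "fun_algebra R"]
  by (simp add: is_subalgebra_def fun_algebra_sel)

lemma restrict_B: "f \<in> B \<Longrightarrow> restrict f R = f"
  using B_subset by (auto simp: PiE_def extensional_restrict)

lemma cring_A: "cring A"
proof -
  interpret F: cring "fun_algebra R" by (rule cring_fun_algebra)
  have "subring B (fun_algebra R)" using subalgebra by (simp add: is_subalgebra_def)
  then have "subcring B (fun_algebra R)" by (rule F.subcringI')
  then show ?thesis using F.subcring_iff B_subset by (simp add: fun_algebra_sel(1))
qed

lemma algebra_A: "algebra (class_ring :: rat ring) A"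
proof -
  interpret cring A by (rule cring_A)
  have "q \<odot>\<^bsub>A\<^esub> f \<in> B" if "f \<in> B" for q f
    using subalgebra that by (simp add: is_subalgebra_def)
  moreover have "1 \<odot>\<^bsub>A\<^esub> f = f" if "f \<in> B" for f
    using restrict_B[OF that] by (simp add: fun_algebra_sel)
  ultimately show ?thesis
    by (intro algebra.intro Module.module.intro cring_axioms abelian_group_axioms
        class_cring.cring_axioms algebra_axioms.intro module_axioms.intro)
      (auto simp: fun_algebra_sel fun_eq_iff algebra_simps of_rat_add of_rat_mult restrict_def
        simp del: restrict_apply)
qed

sublocale C: cring A by (rule cring_A)

sublocale A: algebra "class_ring :: rat ring" A by (rule algebra_A)

lemma fun_algebra_ops:
  "f \<otimes>\<^bsub>A\<^esub> g = restrict (f * g) R"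
  "f \<oplus>\<^bsub>A\<^esub> g = restrict (f + g) R"
  "\<one>\<^bsub>A\<^esub> = restrict 1 R"
  "\<zero>\<^bsub>A\<^esub> = restrict 0 R"
  "q \<odot>\<^bsub>A\<^esub> f = restrict ((\<lambda>\<rho>. of_rat q) * f) R"
  by (auto simp: fun_algebra_sel)

lemma restrict_ops:
  "restrict f R \<otimes>\<^bsub>A\<^esub> restrict g R = restrict (f * g) R"
  "restrict f R \<oplus>\<^bsub>A\<^esub> restrict g R = restrict (f + g) R"
  "q \<odot>\<^bsub>A\<^esub> restrict f R = restrict ((\<lambda>\<rho>. of_rat q) * f) R"
  by (auto simp: fun_algebra_sel fun_eq_iff)

lemma restrict_uminus:
  assumes "restrict f R \<in> B"
  shows "restrict (- f) R = \<ominus>\<^bsub>A\<^esub> restrict f R"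
proof -
  have "restrict (- f) R = (- 1) \<odot>\<^bsub>A\<^esub> restrict f R"
    by (auto simp: fun_algebra_sel fun_eq_iff)
  also have "\<dots> = \<ominus>\<^bsub>A\<^esub> restrict f R"
    using A.smult_l_minus[of 1 "restrict f R"] A.smult_one[of "restrict f R"] assms
    by (simp add: class_ring_simps)
  finally show ?thesis .
qed

end

locale function_algebra_ideal = function_subalgebra R B
  for R :: "'r set" and B :: "('r \<Rightarrow> complex) set" +
  fixes J :: "('r \<Rightarrow> complex) set"
  assumes ideal: "ideal J (fun_algebra R\<lparr>carrier := B\<rparr>)"
begin

text \<open>The powers of \<open>J\<close>, pulled back to arbitrary functions: membership ignores the values outside \<open>R\<close>.\<close>

definition K :: "nat \<Rightarrow> ('r \<Rightarrow> complex) set" where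
  "K k = {f. restrict f R \<in> ideal_pow A J k}"

lemma pow_ideal: "ideal (ideal_pow A J k) A"
  by (rule C.ideal_pow_ideal[OF ideal])

lemma pow_subset: "ideal_pow A J k \<subseteq> B"
  using ideal.Icarr[OF pow_ideal] by auto

lemma pow_subset_K: "f \<in> ideal_pow A J k \<Longrightarrow> f \<in> K k"
  using pow_subset restrict_B by (fastforce simp: K_def)

lemma K_cong: "(\<And>\<rho>. \<rho> \<in> R \<Longrightarrow> f \<rho> = g \<rho>) \<Longrightarrow> f \<in> K k \<longleftrightarrow> g \<in> K k"
  by (simp add: K_def cong: restrict_cong)

sublocale ring_filtration K
proof
  show "1 \<in> K 0" using C.one_closed by (simp add: K_def fun_algebra_sel one_fun_def)
  show "0 \<in> K k" for k
    using additive_subgroup.zero_closed[OF ideal.axioms(1)[OF pow_ideal]]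
    by (simp add: K_def fun_algebra_sel zero_fun_def)
  show "f + g \<in> K k" if "f \<in> K k" "g \<in> K k" for f g k
    using additive_subgroup.a_closed[OF ideal.axioms(1)[OF pow_ideal], of "restrict f R" k "restrict g R"] that
    by (simp only: K_def mem_Collect_eq restrict_ops(2))
  show "- f \<in> K k" if "f \<in> K k" for f k
    using additive_subgroup.a_inv_closed[OF ideal.axioms(1)[OF pow_ideal], of "restrict f R" k] that
      pow_subset[of k] by (auto simp: K_def restrict_uminus simp del: restrict_apply)
  show "f * g \<in> K (j + k)" if "f \<in> K j" "g \<in> K k" for f g j k
    using C.ideal_pow_mult[OF ideal, of "restrict f R" j "restrict g R" k] that
    by (simp only: K_def mem_Collect_eq restrict_ops(1))
  show "K (Suc k) \<subseteq> K k" for k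
    using C.ideal_pow_Suc_subset[OF ideal, of k] by (auto simp: K_def)
qed

definition cst :: "rat \<Rightarrow> 'r \<Rightarrow> complex" where "cst q = (\<lambda>\<rho>. of_rat q)"

lemma cst_hom:
  "cst 0 = 0" "cst 1 = 1" "cst (- p) = - cst p" "cst (p + q) = cst p + cst q" "cst (p * q) = cst p * cst q"
  by (auto simp: cst_def fun_eq_iff of_rat_add of_rat_mult of_rat_minus)

lemma cst_mem: "cst q \<in> K 0"
proof -
  have "q \<odot>\<^bsub>A\<^esub> \<one>\<^bsub>A\<^esub> \<in> B" using A.smult_closed[of q "\<one>\<^bsub>A\<^esub>"] C.one_closed by simp
  moreover have "q \<odot>\<^bsub>A\<^esub> \<one>\<^bsub>A\<^esub> = restrict (\<lambda>\<rho>. of_rat q) R"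
    by (auto simp: fun_algebra_sel)
  ultimately show ?thesis by (simp add: K_def cst_def)
qed

lemma cst_mult_mem: "f \<in> K k \<Longrightarrow> cst q * f \<in> K k" using mult_mem[OF cst_mem] by simp

lemma finsum_restrict:
  assumes "\<And>i. i \<in> I \<Longrightarrow> f i \<in> K 0" and "finite I"
  shows "(\<Oplus>\<^bsub>A\<^esub>i\<in>I. restrict (f i) R) = restrict (\<Sum>i\<in>I. f i) R"
  using assms(2,1)
proof (induction I rule: finite_induct)
  case empty
  then show ?case by (auto simp: fun_algebra_sel)
next
  case (insert i I)
  then have "(\<Oplus>\<^bsub>A\<^esub>i\<in>insert i I. restrict (f i) R)
      = restrict (f i) R \<oplus>\<^bsub>A\<^esub> (\<Oplus>\<^bsub>A\<^esub>i\<in>I. restrict (f i) R)"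
    by (intro C.finsum_insert) (auto simp: K_def)
  moreover have "(\<Oplus>\<^bsub>A\<^esub>i\<in>I. restrict (f i) R) = restrict (\<Sum>i\<in>I. f i) R"
    using insert by blast
  ultimately show ?case by (simp only: restrict_ops(2) sum.insert[OF insert.hyps])
qed

lemma K_Suc_induct [consumes 1, case_names cong mult add]:
  assumes f: "f \<in> K (Suc k)"
    and cong: "\<And>f g. (\<And>\<rho>. \<rho> \<in> R \<Longrightarrow> f \<rho> = g \<rho>) \<Longrightarrow> Q f \<Longrightarrow> Q g"
    and mult: "\<And>g h. g \<in> K k \<Longrightarrow> restrict h R \<in> J \<Longrightarrow> Q (g * h)"
    and add: "\<And>g h. g \<in> K (Suc k) \<Longrightarrow> h \<in> K (Suc k) \<Longrightarrow> Q g \<Longrightarrow> Q h \<Longrightarrow> Q (g + h)"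
  shows "Q f"
proof -
  have "restrict f R \<in> ideal_prod A (ideal_pow A J k) J" using f by (simp add: K_def)
  then have "Q (restrict f R)"
  proof (induction rule: ideal_prod.induct)
    case (prod g h)
    then have "Q (g * h)"
      using restrict_B[of h] ideal.Icarr[OF ideal, of h] by (auto intro!: mult pow_subset_K)
    then show ?case by (rule cong[rotated]) (simp add: fun_algebra_sel)
  next
    case (sum g h)
    then have "Q (g + h)" using pow_subset_K[of _ "Suc k"] by (auto intro!: add)
    then show ?case by (rule cong[rotated]) (simp add: fun_algebra_sel)
  qed
  then show ?thesis by (rule cong[rotated]) simp
qed

lemma mem_K1_iff: "f \<in> K 1 \<longleftrightarrow> restrict f R \<in> J"
proof -
  interpret J: ideal J A by (rule ideal)
  have "ideal_prod A B J = J"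
  proof
    show "ideal_prod A B J \<subseteq> J"
    proof
      fix f assume "f \<in> ideal_prod A B J"
      then show "f \<in> J"
        by (induction rule: ideal_prod.induct) (use J.I_l_closed J.a_closed in auto)
    qed
    show "J \<subseteq> ideal_prod A B J"
    proof
      fix f assume f: "f \<in> J"
      then have "\<one>\<^bsub>A\<^esub> \<otimes>\<^bsub>A\<^esub> f \<in> ideal_prod A B J"
        using C.one_closed by (intro ideal_prod.prod) auto
      moreover have "\<one>\<^bsub>A\<^esub> \<otimes>\<^bsub>A\<^esub> f = f" using J.Icarr[OF f] by (rule C.l_one)
      ultimately show "f \<in> ideal_prod A B J" by simp
    qed
  qed
  then show ?thesis by (simp add: K_def)
qed

end

context function_algebra_ideal
begin

definition span_mod :: "('i \<Rightarrow> 'r \<Rightarrow> complex) \<Rightarrow> 'i set \<Rightarrow> nat \<Rightarrow> ('r \<Rightarrow> complex) set" where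
  "span_mod y I k = {f. \<exists>a. f - (\<Sum>i\<in>I. cst (a i) * y i) \<in> K k}"

lemma span_modI: "f - (\<Sum>i\<in>I. cst (a i) * y i) \<in> K k \<Longrightarrow> f \<in> span_mod y I k"
  by (auto simp: span_mod_def)

lemma K_subset_span_mod: "f \<in> K k \<Longrightarrow> f \<in> span_mod y I k"
  by (rule span_modI[of _ "\<lambda>_. 0"]) (simp add: cst_hom)

lemma base_span_mod: "finite I \<Longrightarrow> i \<in> I \<Longrightarrow> y i \<in> span_mod y I k"
proof (rule span_modI[of _ "\<lambda>j. if j = i then 1 else 0"])
  assume I: "finite I" "i \<in> I"
  have "(\<Sum>j\<in>I. cst (if j = i then 1 else 0) * y j) = (\<Sum>j\<in>I. if j = i then y j else 0)"
    by (rule sum.cong) (auto simp: cst_hom)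
  also have "\<dots> = y i" using I by (simp add: sum.delta)
  finally show "y i - (\<Sum>j\<in>I. cst (if j = i then 1 else 0) * y j) \<in> K k" by (simp add: zero_mem)
qed

lemma add_span_mod:
  assumes "f \<in> span_mod y I k" "g \<in> span_mod y I k"
  shows "f + g \<in> span_mod y I k"
proof -
  obtain a b where ab: "f - (\<Sum>i\<in>I. cst (a i) * y i) \<in> K k" "g - (\<Sum>i\<in>I. cst (b i) * y i) \<in> K k"
    using assms by (auto simp: span_mod_def)
  have eq: "(f - (\<Sum>i\<in>I. cst (a i) * y i)) + (g - (\<Sum>i\<in>I. cst (b i) * y i))
      = f + g - (\<Sum>i\<in>I. cst (a i + b i) * y i)"
    by (simp add: cst_hom algebra_simps sum.distrib)
  show ?thesis using add_mem[OF ab] unfolding eq by (rule span_modI)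
qed

lemma cst_mult_span_mod:
  assumes "f \<in> span_mod y I k"
  shows "cst q * f \<in> span_mod y I k"
proof -
  obtain a where a: "f - (\<Sum>i\<in>I. cst (a i) * y i) \<in> K k"
    using assms by (auto simp: span_mod_def)
  have "cst q * (f - (\<Sum>i\<in>I. cst (a i) * y i)) = cst q * f - (\<Sum>i\<in>I. cst (q * a i) * y i)"
    by (simp add: cst_hom right_diff_distrib sum_distrib_left mult.assoc)
  then show ?thesis using cst_mult_mem[OF a, of q] by (auto intro: span_modI)
qed

lemma uminus_span_mod: "f \<in> span_mod y I k \<Longrightarrow> - f \<in> span_mod y I k"
  using cst_mult_span_mod[of f y I k "-1"] by (simp add: cst_hom)

lemma half_span_mod: "f + f \<in> span_mod y I k \<Longrightarrow> f \<in> span_mod y I k"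
proof -
  assume "f + f \<in> span_mod y I k"
  then have "cst (1/2) * (f + f) \<in> span_mod y I k" by (rule cst_mult_span_mod)
  moreover have "cst (1/2) * (f + f) = f" by (auto simp: cst_def fun_eq_iff of_rat_divide)
  ultimately show ?thesis by simp
qed

lemma sum_span_mod: "(\<And>j. j \<in> S \<Longrightarrow> f j \<in> span_mod y I k) \<Longrightarrow> (\<Sum>j\<in>S. f j) \<in> span_mod y I k"
  by (induction S rule: infinite_finite_induct)
    (auto intro: add_span_mod K_subset_span_mod[OF zero_mem])

lemma span_mod_cong_K:
  assumes "f - g \<in> K k" "g \<in> span_mod y I k"
  shows "f \<in> span_mod y I k"
  using add_span_mod[OF K_subset_span_mod[OF assms(1)] assms(2)] by simp

lemma mem_K_if_zero: "(\<And>\<rho>. \<rho> \<in> R \<Longrightarrow> f \<rho> = 0) \<Longrightarrow> f \<in> K k"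
  using K_cong[of f 0 k] zero_mem[of k] by simp

end

section \<open>Representations of free abelian groups in the special linear group\<close>

definition centralizer :: "('a, 'b) monoid_scheme \<Rightarrow> 'a set \<Rightarrow> 'a set" where
  "centralizer G S = {g \<in> carrier G. \<forall>s\<in>S. g \<otimes>\<^bsub>G\<^esub> s = s \<otimes>\<^bsub>G\<^esub> g}"

lemma (in group) centralizer_subgroup:
  assumes "S \<subseteq> carrier G"
  shows "subgroup (centralizer G S) G"
proof (rule subgroupI)
  fix g assume g: "g \<in> centralizer G S"
  have "inv g \<otimes> s = s \<otimes> inv g" if s: "s \<in> S" for s
  proof -
    have c: "g \<in> carrier G" "s \<in> carrier G" "g \<otimes> s = s \<otimes> g"
      using g s assms by (auto simp: centralizer_def)
    then have "g \<otimes> (s \<otimes> inv g) = s" by (simp add: m_assoc[symmetric]) (simp add: m_assoc)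
    then show ?thesis using c inv_solve_left[of "s \<otimes> inv g" g s] by simp
  qed
  then show "inv g \<in> centralizer G S" using g by (auto simp: centralizer_def)
next
  fix g h assume gh: "g \<in> centralizer G S" "h \<in> centralizer G S"
  have "g \<otimes> h \<otimes> s = s \<otimes> (g \<otimes> h)" if s: "s \<in> S" for s
  proof -
    have c: "g \<in> carrier G" "h \<in> carrier G" "s \<in> carrier G" "g \<otimes> s = s \<otimes> g" "h \<otimes> s = s \<otimes> h"
      using gh s assms by (auto simp: centralizer_def)
    have "g \<otimes> h \<otimes> s = g \<otimes> (s \<otimes> h)" by (simp only: m_assoc[OF c(1-3)] c(5))
    also have "\<dots> = g \<otimes> s \<otimes> h" by (rule m_assoc[symmetric]) (rule c)+
    also have "\<dots> = s \<otimes> (g \<otimes> h)" by (simp only: c(4) m_assoc[OF c(3,1,2)])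
    finally show ?thesis .
  qed
  then show "g \<otimes> h \<in> centralizer G S" using gh by (auto simp: centralizer_def)
next
  have "\<one> \<in> centralizer G S" using assms by (auto simp: centralizer_def)
  then show "centralizer G S \<noteq> {}" by blast
qed (auto simp: centralizer_def)

text \<open>The double centralizer of a commuting set contains the set and is contained in the centralizer,
  hence is commutative. It serves as target for the universal property of free abelian groups,
  which speaks of commutative groups only.\<close>

lemma (in group) commuting_subset_comm_subgroup:
  assumes S: "S \<subseteq> carrier G" and comm: "\<And>a b. a \<in> S \<Longrightarrow> b \<in> S \<Longrightarrow> a \<otimes> b = b \<otimes> a"
  obtains C where "subgroup C G" "S \<subseteq> C" "comm_group (G\<lparr>carrier := C\<rparr>)"
proof
  let ?C = "centralizer G (centralizer G S)"
  have sub: "centralizer G S \<subseteq> carrier G" by (auto simp: centralizer_def)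
  have S1: "S \<subseteq> centralizer G S" using S comm by (auto simp: centralizer_def)
  show C: "subgroup ?C G" by (rule centralizer_subgroup[OF sub])
  show "S \<subseteq> ?C" using S by (auto simp: centralizer_def)
  have C1: "?C \<subseteq> centralizer G S" using S1 by (auto simp: centralizer_def)
  interpret C: group "G\<lparr>carrier := ?C\<rparr>" by (rule subgroup_imp_group[OF C])
  show "comm_group (G\<lparr>carrier := ?C\<rparr>)"
    by (rule C.group_comm_groupI) (use C1 in \<open>auto simp: centralizer_def[of _ "centralizer G S"]\<close>)
qed

lemma SL_sel:
  "carrier (SL m) = {A \<in> carrier_mat m m. det A = 1}"
  "A \<otimes>\<^bsub>SL m\<^esub> B = A * B"
  "\<one>\<^bsub>SL m\<^esub> = 1\<^sub>m m"
  by (simp_all add: SL_def)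

lemma adj_mat_SL:
  assumes "A \<in> carrier (SL m)"
  shows "adj_mat A \<in> carrier (SL m)" and "adj_mat A * A = 1\<^sub>m m"
proof -
  have A: "A \<in> carrier_mat m m" "det A = 1" using assms by (auto simp: SL_sel)
  show inv: "adj_mat A * A = 1\<^sub>m m" using adj_mat(3)[OF A(1)] A(2) by auto
  have "det (adj_mat A) * det A = 1"
    using det_mult[OF adj_mat(1)[OF A(1)] A(1)] inv by simp
  then show "adj_mat A \<in> carrier (SL m)" using adj_mat(1)[OF A(1)] A(2) by (simp add: SL_sel)
qed

lemma group_SL: "group (SL m)"
proof (rule groupI)
  fix A assume "A \<in> carrier (SL m)"
  then show "\<exists>B\<in>carrier (SL m). B \<otimes>\<^bsub>SL m\<^esub> A = \<one>\<^bsub>SL m\<^esub>"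
    using adj_mat_SL[of A m] by (intro bexI[of _ "adj_mat A"]) (auto simp: SL_sel(2,3))
qed (auto simp: SL_sel det_mult intro: assoc_mult_mat)

lemma SL_inv: "A \<in> carrier (SL m) \<Longrightarrow> inv\<^bsub>SL m\<^esub> A = adj_mat A"
  by (rule group.inv_equality[OF group_SL]) (auto simp: SL_sel(2,3) adj_mat_SL)

lemma free_abelian_induct:
  assumes free: "free_abelian_with_basis H n x" and h: "h \<in> carrier H"
    and one: "Q \<one>\<^bsub>H\<^esub>"
    and diff: "\<And>g h. g \<in> carrier H \<Longrightarrow> h \<in> carrier H \<Longrightarrow> Q g \<Longrightarrow> Q h \<Longrightarrow> Q (g \<otimes>\<^bsub>H\<^esub> inv\<^bsub>H\<^esub> h)"
    and basis: "\<And>l. l \<in> {1..n} \<Longrightarrow> Q (x l)"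
  shows "Q h"
proof -
  let ?F = "free_Abelian_group {1..n}"
  interpret H: comm_group H using free by (simp add: free_abelian_with_basis_def)
  obtain \<phi> where \<phi>: "\<phi> \<in> iso ?F H" "\<forall>l\<in>{1..n}. \<phi> (frag_of l) = x l"
    using free by (auto simp: free_abelian_with_basis_def)
  interpret \<phi>: group_hom ?F H \<phi>
    using \<phi>(1) by (intro group_hom.intro group_hom_axioms.intro) (auto simp: iso_def)
  have "Q (\<phi> c)" if "Poly_Mapping.keys c \<subseteq> {1..n}" for c
  proof (rule free_Abelian_group_induct[of c "{1..n}" "\<lambda>c. Q (\<phi> c)"])
    show "Q (\<phi> 0)" using one \<phi>.hom_one by simp
  next
    fix a b :: "nat \<Rightarrow>\<^sub>0 int"
    assume ab: "Poly_Mapping.keys a \<subseteq> {1..n}" "Poly_Mapping.keys b \<subseteq> {1..n}" "Q (\<phi> a)" "Q (\<phi> b)"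
    then have "\<phi> (a - b) = \<phi> a \<otimes>\<^bsub>H\<^esub> inv\<^bsub>H\<^esub> \<phi> b"
      using \<phi>.hom_mult[of a "- b"] \<phi>.hom_inv[of b] by simp
    then show "Q (\<phi> (a - b))" using diff[of "\<phi> a" "\<phi> b"] ab \<phi>.hom_closed by simp
  next
    fix l assume "l \<in> {1..n}"
    then show "Q (\<phi> (frag_of l))" using basis \<phi>(2) by auto
  qed (rule that)
  moreover have "h \<in> \<phi> ` carrier ?F" using \<phi>(1) h by (auto simp: iso_def bij_betw_def)
  then obtain c where "c \<in> carrier ?F" "h = \<phi> c" by blast
  ultimately show ?thesis by simp
qed

lemma basis_in_carrier:
  assumes free: "free_abelian_with_basis H n x" and l: "l \<in> {1..n}"
  shows "x l \<in> carrier H"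
proof -
  obtain \<phi> where \<phi>: "\<phi> \<in> iso (free_Abelian_group {1..n}) H" "\<phi> (frag_of l) = x l"
    using free l by (auto simp: free_abelian_with_basis_def)
  have "frag_of l \<in> carrier (free_Abelian_group {1..n})" using l by simp
  moreover have "\<phi> \<in> hom (free_Abelian_group {1..n}) H" using \<phi>(1) by (simp add: iso_def)
  ultimately have "\<phi> (frag_of l) \<in> carrier H" by (rule hom_in_carrier[rotated])
  then show ?thesis using \<phi>(2) by simp
qed

lemma exists_rep:
  assumes free: "free_abelian_with_basis H n x"
    and X: "\<And>l. l \<in> {1..n} \<Longrightarrow> X l \<in> carrier (SL m)"
    and comm: "\<And>k l. k \<in> {1..n} \<Longrightarrow> l \<in> {1..n} \<Longrightarrow> X k * X l = X l * X k"
  shows "\<exists>\<rho>\<in>Rep H m. \<forall>l\<in>{1..n}. \<rho> (x l) = X l"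
proof -
  let ?F = "free_Abelian_group {1..n}"
  interpret SL: group "SL m" by (rule group_SL)
  interpret H: comm_group H using free by (simp add: free_abelian_with_basis_def)
  obtain \<phi> where \<phi>: "\<phi> \<in> iso ?F H" "\<forall>l\<in>{1..n}. \<phi> (frag_of l) = x l"
    using free by (auto simp: free_abelian_with_basis_def)
  obtain C where C: "subgroup C (SL m)" "X ` {1..n} \<subseteq> C" "comm_group (SL m\<lparr>carrier := C\<rparr>)"
    using X comm by (auto intro: SL.commuting_subset_comm_subgroup[of "X ` {1..n}"] simp: SL_sel(2))
  then interpret C: comm_group "SL m\<lparr>carrier := C\<rparr>" by simp
  obtain g where g: "g \<in> hom ?F (SL m\<lparr>carrier := C\<rparr>)" "\<And>l. l \<in> {1..n} \<Longrightarrow> g (frag_of l) = X l"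
    using C.free_Abelian_group_universal[of X "{1..n}"] C(2) by auto
  define \<psi> where "\<psi> = inv_into (carrier ?F) \<phi>"
  have \<psi>: "\<psi> \<in> iso H ?F"
    unfolding \<psi>_def by (rule group.iso_set_sym[OF group_free_Abelian_group \<phi>(1)])
  have "g \<in> hom ?F (SL m)"
    using g(1) subgroup.subset[OF C(1)] by (auto simp: hom_def)
  then have comp: "g \<circ> \<psi> \<in> hom H (SL m)"
    using \<psi> by (auto simp: hom_def iso_def)
  define \<rho> where "\<rho> = restrict (g \<circ> \<psi>) (carrier H)"
  have "\<rho> \<in> Rep H m"
    using comp by (auto simp: Rep_def \<rho>_def hom_def)
  moreover have "\<rho> (x l) = X l" if l: "l \<in> {1..n}" for l
  proof -
    have "frag_of l \<in> carrier ?F" using l by simp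
    then have "\<psi> (x l) = frag_of l"
      using \<phi> l inv_into_f_f[of \<phi> "carrier ?F" "frag_of l"]
      by (auto simp: \<psi>_def iso_def bij_betw_def)
    then show ?thesis using basis_in_carrier[OF free l] g(2)[OF l] by (simp add: \<rho>_def)
  qed
  ultimately show ?thesis by blast
qed

section \<open>The augmentation filtration of the representation algebra\<close>

text \<open>With \<open>sentry\<close> below, these are the functions \<open>a\<^sub>i\<^sub>j(h)\<close> and \<open>s\<^sub>i\<^sub>j(h)\<close> before restriction to the set of
  representations; shifting the indices by one matches the counting of rows and columns from \<open>0\<close>.\<close>

definition entry :: "nat \<Rightarrow> nat \<Rightarrow> 'a \<Rightarrow> ('a \<Rightarrow> complex mat) \<Rightarrow> complex" where
  "entry i j h = (\<lambda>\<rho>. \<rho> h $$ (i - 1, j - 1))"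

definition sentry :: "nat \<Rightarrow> nat \<Rightarrow> 'a \<Rightarrow> ('a \<Rightarrow> complex mat) \<Rightarrow> complex" where
  "sentry i j h = entry i j h - (if i = j then 1 else 0)"

lemma coord_a_eq: "coord_a H m i j h = restrict (entry i j h) (Rep H m)"
  by (auto simp: coord_a_def entry_def)

lemma coord_s_eq: "coord_s H m i j h = restrict (sentry i j h) (Rep H m)"
  by (auto simp: coord_s_def coord_a_def sentry_def entry_def fun_eq_iff)

locale free_abelian_reps =
  fixes H :: "('a, 'b) monoid_scheme" and n m :: nat and x :: "nat \<Rightarrow> 'a"
  assumes m2: "m \<ge> 2" and free: "free_abelian_with_basis H n x"
begin

abbreviation "R \<equiv> Rep H m"
abbreviation "B \<equiv> carrier (rep_algebra H m)"
abbreviation "J \<equiv> ideal_J H m n x"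

sublocale H: comm_group H using free by (simp add: free_abelian_with_basis_def)

lemma x_carrier: "l \<in> {1..n} \<Longrightarrow> x l \<in> carrier H"
  by (rule basis_in_carrier[OF free])

lemma rep_algebra_eq: "rep_algebra H m = fun_algebra R\<lparr>carrier := B\<rparr>"
  by (simp add: rep_algebra_def generated_subalgebra_def)

lemma entry_mem_B:
  "i \<in> {1..m} \<Longrightarrow> j \<in> {1..m} \<Longrightarrow> h \<in> carrier H \<Longrightarrow> restrict (entry i j h) R \<in> B"
  unfolding rep_algebra_def coord_a_eq
  by (rule subsetD[OF generated_subalgebra_superset]) blast

lemma subalgebra_B: "is_subalgebra B (fun_algebra R)"
  unfolding rep_algebra_def
  by (rule is_subalgebra_generated) (auto simp: coord_a_eq fun_algebra_sel)

interpretation function_subalgebra R B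
  using subalgebra_B by unfold_locales

lemma sentry_mem_B:
  assumes "i \<in> {1..m}" "j \<in> {1..m}" "h \<in> carrier H"
  shows "restrict (sentry i j h) R \<in> B"
proof (cases "i = j")
  case True
  have one: "restrict 1 R \<in> carrier A" using C.one_closed by (simp only: fun_algebra_ops(3))
  then have "restrict (- 1) R \<in> carrier A"
    using restrict_uminus[of 1] C.a_inv_closed[OF one] by simp
  moreover have "restrict (entry i j h) R \<in> carrier A" using entry_mem_B[OF assms] by simp
  ultimately have "restrict (entry i j h + - 1) R \<in> carrier A"
    unfolding restrict_ops(2)[symmetric] by (rule C.a_closed[rotated])
  then show ?thesis using True by (simp add: sentry_def)
next
  case False
  then show ?thesis using entry_mem_B[OF assms] by (simp add: sentry_def)
qed

lemma ideal_J: "ideal J A"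
proof -
  have "{coord_s H m i j (x l) | i j l. i \<in> {1..m} \<and> j \<in> {1..m} \<and> l \<in> {1..n}} \<subseteq> carrier A"
    using sentry_mem_B x_carrier by (auto simp: coord_s_eq)
  from C.genideal_ideal[OF this] show ?thesis
    unfolding ideal_J_def rep_algebra_eq[symmetric] .
qed

end

sublocale free_abelian_reps \<subseteq> function_algebra_ideal R B J
  using subalgebra_B ideal_J
  by (intro function_algebra_ideal.intro function_subalgebra.intro function_algebra_ideal_axioms.intro)

lemma sum_shift_index: "(\<Sum>k<m. f k) = (\<Sum>k\<in>{1..m}. f (k - 1))"
  for f :: "nat \<Rightarrow> 'c::comm_monoid_add"
  by (rule sum.reindex_bij_witness[of _ "\<lambda>k. k - 1" Suc]) auto

context free_abelian_reps
begin

lemma rep_carrier: "\<rho> \<in> R \<Longrightarrow> h \<in> carrier H \<Longrightarrow> \<rho> h \<in> carrier (SL m)"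
  by (auto simp: Rep_def hom_def)

lemma rep_mat: "\<rho> \<in> R \<Longrightarrow> h \<in> carrier H \<Longrightarrow> \<rho> h \<in> carrier_mat m m"
  using rep_carrier by (auto simp: SL_sel)

lemma rep_mult: "\<rho> \<in> R \<Longrightarrow> g \<in> carrier H \<Longrightarrow> h \<in> carrier H \<Longrightarrow> \<rho> (g \<otimes>\<^bsub>H\<^esub> h) = \<rho> g * \<rho> h"
  by (auto simp: Rep_def hom_def SL_sel)

lemma rep_group_hom: "\<rho> \<in> R \<Longrightarrow> group_hom H (SL m) \<rho>"
  by (intro group_hom.intro group_hom_axioms.intro H.is_group group_SL) (simp add: Rep_def)

lemma rep_one: "\<rho> \<in> R \<Longrightarrow> \<rho> \<one>\<^bsub>H\<^esub> = 1\<^sub>m m"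
  using group_hom.hom_one[OF rep_group_hom] by (simp add: SL_sel)

lemma entry_mult:
  assumes "\<rho> \<in> R" "g \<in> carrier H" "h \<in> carrier H" "i \<in> {1..m}" "j \<in> {1..m}"
  shows "entry i j (g \<otimes>\<^bsub>H\<^esub> h) \<rho> = (\<Sum>k\<in>{1..m}. entry i k g \<rho> * entry k j h \<rho>)"
proof -
  have c: "\<rho> g \<in> carrier_mat m m" "\<rho> h \<in> carrier_mat m m" using assms rep_mat by auto
  have "entry i j (g \<otimes>\<^bsub>H\<^esub> h) \<rho> = (\<rho> g * \<rho> h) $$ (i - 1, j - 1)"
    using assms by (simp add: entry_def rep_mult)
  also have "\<dots> = (\<Sum>k<m. \<rho> g $$ (i - 1, k) * \<rho> h $$ (k, j - 1))"
    using c assms by (auto simp: scalar_prod_def atLeast0LessThan)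
  finally show ?thesis by (simp add: sum_shift_index entry_def)
qed

lemma entry_one:
  "\<rho> \<in> R \<Longrightarrow> i \<in> {1..m} \<Longrightarrow> j \<in> {1..m} \<Longrightarrow> entry i j \<one>\<^bsub>H\<^esub> \<rho> = (if i = j then 1 else 0)"
  by (auto simp: entry_def rep_one)

lemma entry_mem_K0: "i \<in> {1..m} \<Longrightarrow> j \<in> {1..m} \<Longrightarrow> h \<in> carrier H \<Longrightarrow> entry i j h \<in> K 0"
  using entry_mem_B by (simp add: K_def)

lemma K0_induct [consumes 1, case_names cong entry cst add mult]:
  assumes f: "f \<in> K 0"
    and cong: "\<And>f g. (\<And>\<rho>. \<rho> \<in> R \<Longrightarrow> f \<rho> = g \<rho>) \<Longrightarrow> Q f \<Longrightarrow> Q g"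
    and entry: "\<And>i j h. i \<in> {1..m} \<Longrightarrow> j \<in> {1..m} \<Longrightarrow> h \<in> carrier H \<Longrightarrow> Q (entry i j h)"
    and cst: "\<And>q. Q (cst q)"
    and add: "\<And>f g. Q f \<Longrightarrow> Q g \<Longrightarrow> Q (f + g)"
    and mult: "\<And>f g. Q f \<Longrightarrow> Q g \<Longrightarrow> Q (f * g)"
  shows "Q f"
proof -
  interpret F: cring "fun_algebra R" by (rule cring_fun_algebra)
  let ?D = "{f \<in> R \<rightarrow>\<^sub>E UNIV. Q f}"
  have "is_subalgebra ?D (fun_algebra R)"
    unfolding is_subalgebra_def
  proof (intro conjI F.subringI allI ballI)
    have "Q (restrict 1 R)" using cong[OF _ cst[of 1]] by (simp add: cst_hom)
    then show "\<one>\<^bsub>fun_algebra R\<^esub> \<in> ?D" by (auto simp: fun_algebra_sel one_fun_def)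
  next
    fix f assume f: "f \<in> ?D"
    have "Q (restrict (- f) R)"
      using cong[OF _ mult[OF cst[of "-1"], of f], of "restrict (- f) R"] f by (simp add: cst_hom)
    moreover have "\<ominus>\<^bsub>fun_algebra R\<^esub> f = restrict (- f) R"
      by (rule F.minus_equality) (use f in \<open>auto simp: fun_algebra_sel\<close>)
    ultimately show "\<ominus>\<^bsub>fun_algebra R\<^esub> f \<in> ?D" by simp
  next
    fix f g assume "f \<in> ?D" "g \<in> ?D"
    then have fg: "Q f" "Q g" by auto
    have "Q (restrict (f * g) R)" by (rule cong[OF _ mult[OF fg]]) simp
    then show "f \<otimes>\<^bsub>fun_algebra R\<^esub> g \<in> ?D" by (auto simp: fun_algebra_sel times_fun_def)
    have "Q (restrict (f + g) R)" by (rule cong[OF _ add[OF fg]]) simp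
    then show "f \<oplus>\<^bsub>fun_algebra R\<^esub> g \<in> ?D" by (auto simp: fun_algebra_sel plus_fun_def)
  next
    fix q f assume "f \<in> ?D"
    then have f: "Q f" by simp
    have "Q (restrict (cst q * f) R)" by (rule cong[OF _ mult[OF cst[of q] f]]) simp
    then show "q \<odot>\<^bsub>fun_algebra R\<^esub> f \<in> ?D" by (auto simp: fun_algebra_sel times_fun_def cst_def)
  qed (auto simp: fun_algebra_sel)
  moreover have "{coord_a H m i j h | i j h. i \<in> {1..m} \<and> j \<in> {1..m} \<and> h \<in> carrier H} \<subseteq> ?D"
    using cong[OF _ entry] by (auto simp: coord_a_eq)
  ultimately have "B \<subseteq> ?D"
    unfolding rep_algebra_def by (rule generated_subalgebra_minimal)
  then have "Q (restrict f R)" using f by (auto simp: K_def)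
  then show ?thesis by (rule cong[rotated]) simp
qed

lemma sentry_x_mem_K1:
  assumes "i \<in> {1..m}" "j \<in> {1..m}" "l \<in> {1..n}"
  shows "sentry i j (x l) \<in> K 1"
proof -
  let ?S = "{coord_s H m i j (x l) | i j l. i \<in> {1..m} \<and> j \<in> {1..m} \<and> l \<in> {1..n}}"
  have "?S \<subseteq> carrier A" using sentry_mem_B x_carrier by (auto simp: coord_s_eq)
  then have "?S \<subseteq> genideal A ?S" by (rule C.genideal_self)
  then have "?S \<subseteq> J" unfolding ideal_J_def rep_algebra_eq[symmetric] .
  moreover have "coord_s H m i j (x l) \<in> ?S" using assms by blast
  ultimately show ?thesis unfolding mem_K1_iff coord_s_eq by blast
qed

lemma K1_induct [consumes 1, case_names cong sentry zero add mult]: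
  assumes f: "f \<in> K 1"
    and cong: "\<And>f g. (\<And>\<rho>. \<rho> \<in> R \<Longrightarrow> f \<rho> = g \<rho>) \<Longrightarrow> Q f \<Longrightarrow> Q g"
    and sentry: "\<And>i j l. i \<in> {1..m} \<Longrightarrow> j \<in> {1..m} \<Longrightarrow> l \<in> {1..n} \<Longrightarrow> Q (sentry i j (x l))"
    and zero: "Q 0"
    and add: "\<And>f g. f \<in> K 1 \<Longrightarrow> g \<in> K 1 \<Longrightarrow> Q f \<Longrightarrow> Q g \<Longrightarrow> Q (f + g)"
    and mult: "\<And>f g. f \<in> K 0 \<Longrightarrow> g \<in> K 1 \<Longrightarrow> Q g \<Longrightarrow> Q (f * g)"
  shows "Q f"
proof -
  let ?S = "{coord_s H m i j (x l) | i j l. i \<in> {1..m} \<and> j \<in> {1..m} \<and> l \<in> {1..n}}"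
  let ?I = "{f \<in> J. Q f}"
  interpret J: ideal J A by (rule ideal)
  have K1: "g \<in> K 1" if "g \<in> J" for g
    unfolding mem_K1_iff using that J.Icarr restrict_B by auto
  have K0: "g \<in> K 0" if "g \<in> B" for g
    using that restrict_B by (auto simp: K_def)
  have multI: "g \<otimes>\<^bsub>A\<^esub> f \<in> ?I" if "f \<in> ?I" "g \<in> carrier A" for f g
  proof -
    have "Q (g * f)" using that K1 K0 by (intro mult) auto
    then have "Q (g \<otimes>\<^bsub>A\<^esub> f)" unfolding fun_algebra_ops by (rule cong[rotated]) simp
    then show ?thesis using that J.I_l_closed by blast
  qed
  have "ideal ?I A"
  proof (rule idealI)
    show "subgroup ?I (add_monoid A)"
    proof (rule group.subgroupI[OF abelian_group.a_group[OF C.abelian_group_axioms]])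
      show "?I \<subseteq> carrier (add_monoid A)" using J.Icarr by auto
      have "Q \<zero>\<^bsub>A\<^esub>" unfolding fun_algebra_ops by (rule cong[OF _ zero]) simp
      then show "?I \<noteq> {}" using J.zero_closed by blast
      fix f assume f: "f \<in> ?I"
      have "Q (restrict (- f) R)"
        using cong[OF _ mult[OF cst_mem[of "-1"] K1], of f "restrict (- f) R"] f
        by (simp add: cst_hom)
      moreover have "restrict (- f) R = \<ominus>\<^bsub>A\<^esub> f"
        using restrict_uminus[of f] restrict_B[of f] f J.Icarr by auto
      ultimately show "inv\<^bsub>add_monoid A\<^esub> f \<in> ?I"
        using f J.a_inv_closed[of f] by (simp add: a_inv_def)
      fix g assume g: "g \<in> ?I"
      have "Q (f + g)" using f g K1 by (intro add) auto
      then have "Q (f \<oplus>\<^bsub>A\<^esub> g)" unfolding fun_algebra_ops by (rule cong[rotated]) simp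
      then show "f \<otimes>\<^bsub>add_monoid A\<^esub> g \<in> ?I"
        using f g J.a_closed by auto
    qed
    fix f g assume fg: "f \<in> ?I" "g \<in> carrier A"
    show "g \<otimes>\<^bsub>A\<^esub> f \<in> ?I" using multI[OF fg] .
    then show "f \<otimes>\<^bsub>A\<^esub> g \<in> ?I" using C.m_comm[of f g] fg J.Icarr by auto
  qed (rule C.ring_axioms)
  moreover have "?S \<subseteq> ?I"
  proof -
    have "restrict (sentry i j (x l)) R \<in> ?I" if "i \<in> {1..m}" "j \<in> {1..m}" "l \<in> {1..n}" for i j l
      using cong[OF _ sentry[OF that]] sentry_x_mem_K1[OF that] unfolding mem_K1_iff by simp
    then show ?thesis by (auto simp: coord_s_eq)
  qed
  ultimately have "genideal A ?S \<subseteq> ?I" by (rule C.genideal_minimal)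
  then have "J \<subseteq> ?I" unfolding ideal_J_def rep_algebra_eq[symmetric] .
  then have "Q (restrict f R)" using f unfolding mem_K1_iff by blast
  then show ?thesis by (rule cong[rotated]) simp
qed

text \<open>The elements \<open>h\<close> with this property form a subgroup containing the basis, since
  \<open>\<rho>(g) \<rho>(h)\<^sup>-\<^sup>1 - 1 = (\<rho>(g) - \<rho>(h)) \<rho>(h)\<^sup>-\<^sup>1\<close>.\<close>

lemma sentry_mem_K1:
  assumes "h \<in> carrier H" "i \<in> {1..m}" "j \<in> {1..m}"
  shows "sentry i j h \<in> K 1"
proof -
  have "\<forall>i\<in>{1..m}. \<forall>j\<in>{1..m}. sentry i j h \<in> K 1"
    using free assms(1)
  proof (rule free_abelian_induct; intro ballI)
    fix i j assume "i \<in> {1..m}" "j \<in> {1..m}"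
    then show "sentry i j \<one>\<^bsub>H\<^esub> \<in> K 1"
      by (intro mem_K_if_zero) (simp add: sentry_def entry_one)
  next
    fix g h i j
    assume gh: "g \<in> carrier H" "h \<in> carrier H" and ij: "i \<in> {1..m}" "j \<in> {1..m}"
      and IH: "\<forall>i\<in>{1..m}. \<forall>j\<in>{1..m}. sentry i j g \<in> K 1"
        "\<forall>i\<in>{1..m}. \<forall>j\<in>{1..m}. sentry i j h \<in> K 1"
    have "(sentry i k g - sentry i k h) * entry k j (inv\<^bsub>H\<^esub> h) \<in> K 1" if k: "k \<in> {1..m}" for k
    proof -
      have "sentry i k g - sentry i k h \<in> K 1" using IH ij k by (blast intro: diff_mem)
      moreover have "entry k j (inv\<^bsub>H\<^esub> h) \<in> K 0" using gh ij k by (blast intro: entry_mem_K0 H.inv_closed)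
      ultimately show ?thesis by (rule mult_mem_le) simp
    qed
    then have "(\<Sum>k\<in>{1..m}. (sentry i k g - sentry i k h) * entry k j (inv\<^bsub>H\<^esub> h)) \<in> K 1"
      by (rule sum_mem)
    also have "?this \<longleftrightarrow> sentry i j (g \<otimes>\<^bsub>H\<^esub> inv\<^bsub>H\<^esub> h) \<in> K 1"
    proof (rule K_cong)
      fix \<rho> assume \<rho>: "\<rho> \<in> R"
      have s: "sentry i k g \<rho> - sentry i k h \<rho> = entry i k g \<rho> - entry i k h \<rho>" for k
        by (simp add: sentry_def)
      have "(\<Sum>k\<in>{1..m}. (sentry i k g \<rho> - sentry i k h \<rho>) * entry k j (inv\<^bsub>H\<^esub> h) \<rho>)
        = (\<Sum>k\<in>{1..m}. entry i k g \<rho> * entry k j (inv\<^bsub>H\<^esub> h) \<rho>)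
          - (\<Sum>k\<in>{1..m}. entry i k h \<rho> * entry k j (inv\<^bsub>H\<^esub> h) \<rho>)"
        by (simp only: s left_diff_distrib sum_subtractf)
      also have "\<dots> = entry i j (g \<otimes>\<^bsub>H\<^esub> inv\<^bsub>H\<^esub> h) \<rho> - entry i j (h \<otimes>\<^bsub>H\<^esub> inv\<^bsub>H\<^esub> h) \<rho>"
        by (simp only: entry_mult[OF \<rho> gh(1) H.inv_closed[OF gh(2)] ij]
            entry_mult[OF \<rho> gh(2) H.inv_closed[OF gh(2)] ij])
      also have "\<dots> = sentry i j (g \<otimes>\<^bsub>H\<^esub> inv\<^bsub>H\<^esub> h) \<rho>"
        using entry_one[OF \<rho> ij] gh by (simp add: sentry_def)
      finally show "(\<Sum>k\<in>{1..m}. (sentry i k g - sentry i k h) * entry k j (inv\<^bsub>H\<^esub> h)) \<rho>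
          = sentry i j (g \<otimes>\<^bsub>H\<^esub> inv\<^bsub>H\<^esub> h) \<rho>"
        by (simp add: sum_fun_apply)
    qed
    finally show "sentry i j (g \<otimes>\<^bsub>H\<^esub> inv\<^bsub>H\<^esub> h) \<in> K 1" .
  qed (rule sentry_x_mem_K1)
  then show ?thesis using assms by blast
qed

text \<open>The algebra is \<open>\<rat> + J\<close>: modulo \<open>J\<close> each generator \<open>a\<^sub>i\<^sub>j(h)\<close> is the constant \<open>\<delta>\<^sub>i\<^sub>j\<close>.\<close>

lemma K0_const_mod_K1: "f \<in> K 0 \<Longrightarrow> \<exists>q. f - cst q \<in> K 1"
proof (induction rule: K0_induct)
  case (cong f g)
  then obtain q where "f - cst q \<in> K 1" by blast
  then have "g - cst q \<in> K 1" by (subst K_cong[of _ "f - cst q"]) (use cong in auto)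
  then show ?case by blast
next
  case (entry i j h)
  have "entry i j h - cst (if i = j then 1 else 0) = sentry i j h"
    by (auto simp: sentry_def cst_hom)
  then show ?case using sentry_mem_K1 entry by metis
next
  case (cst q)
  then show ?case using zero_mem[of 1] by (intro exI[of _ q]) (simp only: diff_self)
next
  case (add f g)
  then obtain p q where "f - cst p \<in> K 1" "g - cst q \<in> K 1" by blast
  then have "(f - cst p) + (g - cst q) \<in> K 1" by (rule add_mem)
  also have "(f - cst p) + (g - cst q) = f + g - cst (p + q)"
    by (simp add: cst_hom)
  finally show ?case by blast
next
  case (mult f g)
  then obtain p q where pq: "f - cst p \<in> K 1" "g - cst q \<in> K 1" by blast
  have "(f - cst p) * (g - cst q) + (cst p * (g - cst q) + cst q * (f - cst p)) \<in> K 1"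
    using pq by (intro add_mem cst_mult_mem mult_mem_le[of _ 1 _ 1]) auto
  also have "(f - cst p) * (g - cst q) + (cst p * (g - cst q) + cst q * (f - cst p))
      = f * g - cst (p * q)"
    by (simp add: cst_hom algebra_simps)
  finally show ?case by blast
qed

text \<open>A multiple of a generator of \<open>J\<close> by an element of \<open>\<rat> + J\<close> is a rational multiple modulo \<open>J\<^sup>2\<close>.\<close>

lemma K1_span: "f \<in> K 1 \<Longrightarrow> f \<in> span_mod (\<lambda>(i, j, l). sentry i j (x l)) ({1..m} \<times> {1..m} \<times> {1..n}) 2"
  (is "_ \<Longrightarrow> _ \<in> ?W")
proof (induction rule: K1_induct)
  case (cong f g)
  have "g - f \<in> K 2" by (rule mem_K_if_zero) (simp add: cong(1))
  then show ?case by (rule span_mod_cong_K[OF _ cong(2)])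
next
  case (sentry i j l)
  have "(\<lambda>(i, j, l). sentry i j (x l)) (i, j, l) \<in> ?W"
    by (rule base_span_mod) (use sentry in auto)
  then show ?case by (simp only: prod.case)
next
  case (mult f g)
  obtain q where "f - cst q \<in> K 1" using K0_const_mod_K1[OF mult(1)] by blast
  then have "(f - cst q) * g \<in> K 2" using mult by (intro mult_mem_le[of _ 1 _ 1]) auto
  then have "f * g - cst q * g \<in> K 2" by (simp add: algebra_simps)
  from span_mod_cong_K[OF this cst_mult_span_mod[OF mult(3)]] show ?case .
next
  case zero
  show ?case by (rule K_subset_span_mod[OF zero_mem])
next
  case (add f g)
  from add(3,4) show ?case by (rule add_span_mod)
qed

end

section \<open>Generators of the second graded piece\<close>

text \<open>Indices for \<open>t\<close>, \<open>u\<close> and \<open>v\<close>. The set \<open>Y\<close> is treated as a family so that independence can be stated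
  before it is known that different indices give different functions.\<close>

datatype quad_index =
    T "nat \<times> nat" "nat \<times> nat" nat nat
  | U "nat \<times> nat" "nat \<times> nat" nat nat
  | V "nat \<times> nat" nat nat

definition quad_indices :: "nat \<Rightarrow> nat \<Rightarrow> quad_index set" where
  "quad_indices m n =
     {T (i, j) (h, k) p q | i j h k p q. (i, j, h, k) \<in> index_J m \<and> p \<in> {1..n} \<and> q \<in> {1..n} \<and> p < q} \<union>
     {U (i, j) (h, k) p q | i j h k p q. (i, j, h, k) \<in> index_I m \<and> p \<in> {1..n} \<and> q \<in> {1..n} \<and> p \<le> q} \<union>
     {V (i, j) p q | i j p q. i \<in> {1..m} \<and> j \<in> {1..m} \<and> (i, j) \<noteq> (m, m) \<and> p \<in> {1..n} \<and> q \<in> {1..n} \<and> p \<le> q}"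

text \<open>The values may lie in any ring: functions of representations for \<open>Y\<close> itself, real numbers for the
  quadratic forms obtained from relations.\<close>

primrec quad :: "(nat \<times> nat \<Rightarrow> nat \<Rightarrow> 'c) \<Rightarrow> quad_index \<Rightarrow> 'c::comm_ring_1" where
  "quad s (T a b p q) = s a p * s b q - s a q * s b p"
| "quad s (U a b p q) = s a p * s b q + s a q * s b p"
| "quad s (V a p q) = s a p * s a q"

lemma index_I_bounds:
  "(i, j, h, k) \<in> index_I m \<Longrightarrow> (i, j) \<in> {1..m} \<times> {1..m} \<and> (h, k) \<in> {1..m} \<times> {1..m}"
  by (simp add: index_I_def)

lemma index_J_subset: "index_J m \<subseteq> index_I m"
  unfolding index_J_def by (rule Diff_subset)

lemma quad_indices_cases [consumes 1, case_names T U V]: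
  assumes "i \<in> quad_indices m n"
  obtains a b p q where "i = T a b p q" "a \<in> {1..m} \<times> {1..m}" "b \<in> {1..m} \<times> {1..m}" "p \<in> {1..n}" "q \<in> {1..n}"
    | a b p q where "i = U a b p q" "a \<in> {1..m} \<times> {1..m}" "b \<in> {1..m} \<times> {1..m}" "p \<in> {1..n}" "q \<in> {1..n}"
    | a p q where "i = V a p q" "a \<in> {1..m} \<times> {1..m}" "p \<in> {1..n}" "q \<in> {1..n}"
proof -
  from assms consider
    (1) i1 j h k p q where "i = T (i1, j) (h, k) p q" "(i1, j, h, k) \<in> index_J m" "p \<in> {1..n}" "q \<in> {1..n}"
    | (2) i1 j h k p q where "i = U (i1, j) (h, k) p q" "(i1, j, h, k) \<in> index_I m" "p \<in> {1..n}" "q \<in> {1..n}"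
    | (3) i1 j p q where "i = V (i1, j) p q" "i1 \<in> {1..m}" "j \<in> {1..m}" "p \<in> {1..n}" "q \<in> {1..n}"
    unfolding quad_indices_def by blast
  then show thesis
  proof cases
    case 1
    then show thesis using that(1) index_I_bounds subsetD[OF index_J_subset] by blast
  next
    case 2
    then show thesis using that(2) index_I_bounds by blast
  next
    case 3
    then show thesis using that(3) by blast
  qed
qed

lemma finite_quad_indices: "finite (quad_indices m n)"
proof -
  let ?P = "({1..m} \<times> {1..m}) :: (nat \<times> nat) set" and ?N = "{1..n}"
  have "quad_indices m n \<subseteq>
      (\<Union>a\<in>?P. \<Union>b\<in>?P. \<Union>p\<in>?N. \<Union>q\<in>?N. {T a b p q, U a b p q}) \<union>
      (\<Union>a\<in>?P. \<Union>p\<in>?N. \<Union>q\<in>?N. {V a p q})"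
    by (rule subsetI, erule quad_indices_cases) blast+
  then show ?thesis by (rule finite_subset) auto
qed

definition proper_pairs :: "nat \<Rightarrow> (nat \<times> nat) set" where
  "proper_pairs m = {1..m} \<times> {1..m} - {(m, m)}"

lemma index_I_cases:
  assumes "a \<in> proper_pairs m" "b \<in> proper_pairs m"
  shows "a = b \<or> (fst a, snd a, fst b, snd b) \<in> index_I m \<or> (fst b, snd b, fst a, snd a) \<in> index_I m"
  using assms by (cases a; cases b) (auto simp: proper_pairs_def index_I_def)

lemma index_J_if_regular:
  assumes "(i, j, h, k) \<in> index_I m" "\<not> (i = 1 \<and> k = 1)" "\<not> (j = 1 \<and> h = 1)"
  shows "(i, j, h, k) \<in> index_J m"
  using assms by (auto simp: index_J_def)

context free_abelian_reps
begin

definition s :: "nat \<times> nat \<Rightarrow> nat \<Rightarrow> ('a \<Rightarrow> complex mat) \<Rightarrow> complex" where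
  "s a l = sentry (fst a) (snd a) (x l)"

abbreviation "W \<equiv> span_mod (quad s) (quad_indices m n) 3"

lemma s_mem_K1: "a \<in> {1..m} \<times> {1..m} \<Longrightarrow> l \<in> {1..n} \<Longrightarrow> s a l \<in> K 1"
  using sentry_x_mem_K1 unfolding s_def by auto

lemma s_mult_mem_K2:
  "a \<in> {1..m} \<times> {1..m} \<Longrightarrow> b \<in> {1..m} \<times> {1..m} \<Longrightarrow> p \<in> {1..n} \<Longrightarrow> q \<in> {1..n} \<Longrightarrow> s a p * s b q \<in> K 2"
  using mult_mem_le[OF s_mem_K1 s_mem_K1] by simp

lemma quad_mem_K2: "i \<in> quad_indices m n \<Longrightarrow> quad s i \<in> K 2"
  by (erule quad_indices_cases) (simp_all only: quad.simps add_mem diff_mem s_mult_mem_K2)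

text \<open>The condition \<open>det \<rho>(x l) = 1\<close> enters here, through \<open>det_one_plus\<close> with \<open>\<rho>(x l) = 1 + s(x l)\<close>.\<close>

lemma trace_mem_K2:
  assumes l: "l \<in> {1..n}"
  shows "(\<Sum>r\<in>{1..m}. s (r, r) l) \<in> K 2"
proof -
  define S where "S i j = s (Suc i, Suc j) l" for i j
  define M where "M = mat m m (\<lambda>(i, j). (if i = j then 1 else 0) + S i j)"
  have "det M - 1 - (\<Sum>i<m. S i i) \<in> K 2"
    unfolding M_def
  proof (rule det_one_plus)
    show "S i j \<in> K 1" if "i < m" "j < m" for i j
      unfolding S_def by (rule s_mem_K1) (use that l in auto)
  qed
  moreover have "det M - 1 \<in> K 2"
  proof (rule mem_K_if_zero)
    fix \<rho> assume \<rho>: "\<rho> \<in> R"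
    have \<rho>l: "\<rho> (x l) \<in> carrier_mat m m" "det (\<rho> (x l)) = 1"
      using rep_carrier[OF \<rho> x_carrier[OF l]] by (auto simp: SL_sel)
    interpret ev: comm_ring_hom "\<lambda>f :: ('a \<Rightarrow> complex mat) \<Rightarrow> complex. f \<rho>"
      by unfold_locales auto
    have "map_mat (\<lambda>f. f \<rho>) M = \<rho> (x l)"
      by (rule eq_matI) (use \<rho>l in \<open>auto simp: M_def S_def s_def sentry_def entry_def\<close>)
    then have "det M \<rho> = 1" using ev.hom_det[of M] \<rho>l by simp
    then show "(det M - 1) \<rho> = 0" by simp
  qed
  ultimately have "(det M - 1) - (det M - 1 - (\<Sum>i<m. S i i)) \<in> K 2" by (rule diff_mem[rotated])
  then have "(\<Sum>i<m. S i i) \<in> K 2" by simp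
  also have "(\<Sum>i<m. S i i) = (\<Sum>r\<in>{1..m}. s (r, r) l)"
    unfolding sum_shift_index by (rule sum.cong) (auto simp: S_def)
  finally show ?thesis .
qed

lemma mult_trace_mem_K3:
  assumes "a \<in> {1..m} \<times> {1..m}" "p \<in> {1..n}" "q \<in> {1..n}"
  shows "(\<Sum>r\<in>{1..m}. s a p * s (r, r) q) \<in> K 3"
  using mult_mem_le[OF s_mem_K1[OF assms(1,2)] trace_mem_K2[OF assms(3)], of 3]
  by (simp add: sum_distrib_left)

lemma quad_mem_W: "i \<in> quad_indices m n \<Longrightarrow> quad s i \<in> W"
  by (rule base_span_mod[OF finite_quad_indices])

lemma U_mem_W:
  assumes a: "a \<in> proper_pairs m" and b: "b \<in> proper_pairs m" and pq: "p \<in> {1..n}" "q \<in> {1..n}"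
  shows "quad s (U a b p q) \<in> W"
proof -
  have le: "quad s (U a b p q) \<in> W"
    if "a \<in> proper_pairs m" "b \<in> proper_pairs m" "p \<in> {1..n}" "q \<in> {1..n}" "p \<le> q" for a b p q
  proof -
    have UI: "quad s (U a b p q) \<in> W" if "(fst a, snd a, fst b, snd b) \<in> index_I m" for a b
      by (rule quad_mem_W) (use that \<open>p \<in> _\<close> \<open>q \<in> _\<close> \<open>p \<le> q\<close> in \<open>cases a; cases b; auto simp: quad_indices_def\<close>)
    have swap: "quad s (U b a p q) = quad s (U a b p q)" by (simp add: mult.commute add.commute)
    have "quad s (V a p q) \<in> W"
      by (rule quad_mem_W) (use that in \<open>cases a; auto simp: quad_indices_def proper_pairs_def\<close>)
    from add_span_mod[OF this this] have "quad s (U a b p q) \<in> W" if "a = b"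
      using that by (simp add: mult.commute)
    then show ?thesis using index_I_cases[OF that(1,2)] UI[of a b] UI[of b a] unfolding swap by blast
  qed
  have "quad s (U a b q p) = quad s (U a b p q)" by (simp add: add.commute)
  then show ?thesis using le[OF a b pq] le[OF a b pq(2,1)] nat_le_linear[of p q] by metis
qed

text \<open>The commutation of \<open>\<rho>(x p)\<close> and \<open>\<rho>(x q)\<close> enters here. The product of \<open>\<rho>(x p) - 1\<close> and \<open>\<rho>(x q) - 1\<close>
  differs from \<open>\<rho>(x p x q)\<close> by a matrix symmetric in \<open>p\<close> and \<open>q\<close>.\<close>

lemma T_mem_W:
  assumes pq: "p \<in> {1..n}" "q \<in> {1..n}" and ab: "a \<in> {1..m} \<times> {1..m}" "b \<in> {1..m} \<times> {1..m}"
  shows "quad s (T a b p q) \<in> W"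
proof -
  define t where "t a b = quad s (T a b p q)" for a b
  have anti: "t b a = - t a b" for a b by (simp add: t_def mult.commute)
  interpret commutator_relations m W t
  proof
    show "m \<ge> 2" by (rule m2)
    show "0 \<in> W" by (rule K_subset_span_mod[OF zero_mem])
    show "t b a = - t a b" for a b by (rule anti)
  next
    fix a :: "nat \<times> nat" assume a: "a \<in> {1..m} \<times> {1..m}"
    have "(\<Sum>r\<in>{1..m}. s a p * s (r, r) q) - (\<Sum>r\<in>{1..m}. s a q * s (r, r) p) \<in> K 3"
      using a pq by (intro diff_mem mult_trace_mem_K3)
    then show "(\<Sum>r\<in>{1..m}. t a (r, r)) \<in> W"
      by (intro K_subset_span_mod) (simp add: t_def sum_subtractf)
  next
    fix i j assume ij: "i \<in> {1..m}" "j \<in> {1..m}"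
    have "(\<Sum>k\<in>{1..m}. t (i, k) (k, j)) \<in> K 3"
    proof (rule mem_K_if_zero)
      fix \<rho> assume \<rho>: "\<rho> \<in> R"
      have prod: "(\<Sum>k\<in>{1..m}. s (i, k) p \<rho> * s (k, j) q \<rho>) =
          entry i j (x p \<otimes>\<^bsub>H\<^esub> x q) \<rho> - entry i j (x p) \<rho> - entry i j (x q) \<rho> + (if i = j then 1 else 0)"
        if "p \<in> {1..n}" "q \<in> {1..n}" for p q
      proof -
        have "(\<Sum>k\<in>{1..m}. s (i, k) p \<rho> * s (k, j) q \<rho>) =
          (\<Sum>k\<in>{1..m}. entry i k (x p) \<rho> * entry k j (x q) \<rho>
            - (if k = j then entry i k (x p) \<rho> else 0) - (if k = i then entry k j (x q) \<rho> else 0)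
            + (if k = i then if i = j then 1 else 0 else 0))"
          by (rule sum.cong) (auto simp: s_def sentry_def algebra_simps)
        also have "\<dots> = (\<Sum>k\<in>{1..m}. entry i k (x p) \<rho> * entry k j (x q) \<rho>)
            - entry i j (x p) \<rho> - entry i j (x q) \<rho> + (if i = j then 1 else 0)"
          using ij by (simp add: sum.distrib sum_subtractf sum.delta)
        also have "(\<Sum>k\<in>{1..m}. entry i k (x p) \<rho> * entry k j (x q) \<rho>) = entry i j (x p \<otimes>\<^bsub>H\<^esub> x q) \<rho>"
          by (rule entry_mult[symmetric]) (use \<rho> that x_carrier ij in auto)
        finally show ?thesis .
      qed
      have "x p \<otimes>\<^bsub>H\<^esub> x q = x q \<otimes>\<^bsub>H\<^esub> x p" using pq x_carrier by (intro H.m_comm)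
      then have "(\<Sum>k\<in>{1..m}. s (i, k) p \<rho> * s (k, j) q \<rho>) - (\<Sum>k\<in>{1..m}. s (i, k) q \<rho> * s (k, j) p \<rho>) = 0"
        using prod[OF pq] prod[OF pq(2,1)] by simp
      then show "(\<Sum>k\<in>{1..m}. t (i, k) (k, j)) \<rho> = 0"
        by (simp add: t_def sum_fun_apply sum_subtractf)
    qed
    then show "(\<Sum>k\<in>{1..m}. t (i, k) (k, j)) \<in> W" by (rule K_subset_span_mod)
  next
    fix a b :: "nat \<times> nat"
    assume ab: "a \<in> {1..m} \<times> {1..m} - {(m, m)}" "b \<in> {1..m} \<times> {1..m} - {(m, m)}"
      and reg: "\<not> (fst a = 1 \<and> snd b = 1)" "\<not> (snd a = 1 \<and> fst b = 1)"
    have base: "quad s (T a b p q) \<in> W"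
      if "(fst a, snd a, fst b, snd b) \<in> index_J m" "p \<in> {1..n}" "q \<in> {1..n}" "p < q" for a b p q
      by (rule quad_mem_W) (use that in \<open>cases a; cases b; auto simp: quad_indices_def\<close>)
    have anti_pq: "quad s (T a b q p) = - quad s (T a b p q)" for a b by simp
    have J: "t a b \<in> W" if "(fst a, snd a, fst b, snd b) \<in> index_J m" for a b
    proof -
      consider "p < q" | "q < p" | "p = q" by linarith
      then show ?thesis
      proof cases
        case 1
        then show ?thesis using base[OF that pq] by (simp only: t_def)
      next
        case 2
        then show ?thesis using uminus_span_mod[OF base[OF that pq(2,1)]] by (simp add: t_def)
      next
        case 3
        then show ?thesis using K_subset_span_mod[OF zero_mem[of 3]] by (simp add: t_def)
      qed
    qed
    consider "a = b" | "(fst a, snd a, fst b, snd b) \<in> index_I m" | "(fst b, snd b, fst a, snd a) \<in> index_I m"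
      using index_I_cases[of a m b] ab unfolding proper_pairs_def by blast
    then show "t a b \<in> W"
    proof cases
      case 1
      then show ?thesis using K_subset_span_mod[OF zero_mem[of 3]] by (simp add: t_def mult.commute)
    next
      case 2
      then show ?thesis using reg by (intro J index_J_if_regular) auto
    next
      case 3
      then have "t b a \<in> W" using reg by (intro J index_J_if_regular) auto
      then show ?thesis using uminus_span_mod anti[of a b] by metis
    qed
  qed (fact add_span_mod uminus_span_mod half_span_mod)+
  from all_mem[OF ab] show ?thesis by (simp only: t_def)
qed

lemma s_mult_mem_W:
  assumes ab: "a \<in> {1..m} \<times> {1..m}" "b \<in> {1..m} \<times> {1..m}" and pq: "p \<in> {1..n}" "q \<in> {1..n}"
  shows "s a p * s b q \<in> W"
proof -
  have proper: "s a p * s b q \<in> W" if ab: "a \<in> proper_pairs m" "b \<in> proper_pairs m" for a b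
  proof (rule half_span_mod)
    have "quad s (U a b p q) + quad s (T a b p q) \<in> W"
      using ab pq by (intro add_span_mod U_mem_W T_mem_W) (auto simp: proper_pairs_def)
    then show "s a p * s b q + s a p * s b q \<in> W" by simp
  qed
  \<comment> \<open>The trace relation expresses the last diagonal coordinate by the others.\<close>
  have last: "f (m, m) \<in> W"
    if "(\<Sum>r\<in>{1..m}. f (r, r)) \<in> K 3" "\<And>a. a \<in> proper_pairs m \<Longrightarrow> f a \<in> W"
    for f :: "nat \<times> nat \<Rightarrow> ('a \<Rightarrow> complex mat) \<Rightarrow> complex"
  proof -
    have "(\<Sum>r\<in>{1..m}. f (r, r)) = f (m, m) + (\<Sum>r\<in>{1..m} - {m}. f (r, r))"
      using m2 by (intro sum.remove) auto
    moreover have "(\<Sum>r\<in>{1..m} - {m}. f (r, r)) \<in> W"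
      by (rule sum_span_mod) (use that(2) in \<open>auto simp: proper_pairs_def\<close>)
    moreover have "(\<Sum>r\<in>{1..m}. f (r, r)) \<in> W" using that(1) by (rule K_subset_span_mod)
    ultimately show ?thesis
      using add_span_mod[OF _ uminus_span_mod, of "\<Sum>r\<in>{1..m}. f (r, r)" _ _ _ "\<Sum>r\<in>{1..m} - {m}. f (r, r)"]
      by simp
  qed
  have right: "s a p * s b q \<in> W" if a: "a \<in> proper_pairs m" and b: "b \<in> {1..m} \<times> {1..m}" for a b
  proof (cases "b = (m, m)")
    case True
    have "a \<in> {1..m} \<times> {1..m}" using a by (simp add: proper_pairs_def)
    from mult_trace_mem_K3[OF this pq] show ?thesis
      unfolding True using proper[OF a] by (rule last)
  next
    case False
    then show ?thesis using proper a b by (simp add: proper_pairs_def)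
  qed
  show ?thesis
  proof (cases "a = (m, m)")
    case True
    have "(\<Sum>r\<in>{1..m}. s (r, r) p * s b q) \<in> K 3"
      using mult_trace_mem_K3[OF ab(2) pq(2,1)] by (simp add: mult.commute)
    then show ?thesis unfolding True using right[OF _ ab(2)] by (rule last)
  next
    case False
    then show ?thesis using right ab by (simp add: proper_pairs_def)
  qed
qed

text \<open>Both factors may be replaced by linear combinations of the \<open>s a l\<close>: the errors lie in \<open>J\<^sup>2\<close> and
  become errors in \<open>J\<^sup>3\<close> after multiplication.\<close>

lemma K1_mult_span:
  assumes f: "f \<in> K 1" and g: "g \<in> K 1"
  shows "f * g \<in> W"
proof -
  let ?I = "{1..m} \<times> {1..m} \<times> {1..n}"
  let ?y = "\<lambda>(i, j, l). sentry i j (x l)"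
  have y: "?y i = s (fst i, fst (snd i)) (snd (snd i))" for i by (cases i) (simp add: s_def)
  obtain a where a: "f - (\<Sum>i\<in>?I. cst (a i) * ?y i) \<in> K 2"
    using K1_span[OF f] unfolding span_mod_def by blast
  obtain b where b: "g - (\<Sum>i\<in>?I. cst (b i) * ?y i) \<in> K 2"
    using K1_span[OF g] unfolding span_mod_def by blast
  let ?f = "\<Sum>i\<in>?I. cst (a i) * ?y i" and ?g = "\<Sum>i\<in>?I. cst (b i) * ?y i"
  have g1: "?g \<in> K 1"
  proof (rule sum_mem)
    fix i assume "i \<in> ?I"
    then show "cst (b i) * ?y i \<in> K 1"
      unfolding y by (intro cst_mult_mem s_mem_K1) auto
  qed
  have "f * (g - ?g) \<in> K 3" using f b by (rule mult_mem_le) simp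
  moreover have "(f - ?f) * ?g \<in> K 3" using a g1 by (rule mult_mem_le) simp
  ultimately have "f * (g - ?g) + (f - ?f) * ?g \<in> K 3" by (rule add_mem)
  moreover have "f * (g - ?g) + (f - ?f) * ?g = f * g - ?f * ?g" by (simp add: algebra_simps)
  ultimately have "f * g - ?f * ?g \<in> K 3" by simp
  moreover have "?f * ?g \<in> W"
    unfolding sum_product
  proof (intro sum_span_mod)
    fix i j assume ij: "i \<in> ?I" "j \<in> ?I"
    have "cst (a i) * (cst (b j) * (?y i * ?y j)) \<in> W"
      unfolding y by (intro cst_mult_span_mod s_mult_mem_W) (use ij in auto)
    then show "cst (a i) * ?y i * (cst (b j) * ?y j) \<in> W" by (simp only: mult.assoc mult.left_commute)
  qed
  ultimately show ?thesis by (rule span_mod_cong_K)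
qed

proposition K2_span: "f \<in> K 2 \<Longrightarrow> f \<in> W"
  unfolding numeral_2_eq_2
proof (induction rule: K_Suc_induct)
  case (cong f g)
  have "g - f \<in> K 3" by (rule mem_K_if_zero) (simp add: cong(1))
  then show ?case by (rule span_mod_cong_K[OF _ cong(2)])
next
  case (mult g h)
  have "h \<in> K 1" unfolding mem_K1_iff by (rule mult(2))
  then show ?case using K1_mult_span[of g h] mult(1) unfolding One_nat_def by blast
next
  case (add g h)
  from add(3,4) show ?case by (rule add_span_mod)
qed

end

section \<open>Quadratic forms that vanish on commuting tuples\<close>

primrec qtag :: "quad_index \<Rightarrow> nat \<times> nat" where
  "qtag (T a b p q) = (p, q)" | "qtag (U a b p q) = (p, q)" | "qtag (V a p q) = (p, q)"

text \<open>For a fixed pair \<open>(p, q)\<close> the quadratic expressions are bilinear in the matrices at \<open>p\<close> and \<open>q\<close>.\<close>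

primrec quad2 :: "(nat \<times> nat \<Rightarrow> real) \<Rightarrow> (nat \<times> nat \<Rightarrow> real) \<Rightarrow> quad_index \<Rightarrow> real" where
  "quad2 A B (T a b p q) = A a * B b - B a * A b"
| "quad2 A B (U a b p q) = A a * B b + B a * A b"
| "quad2 A B (V a p q) = A a * B a"

lemma quad_eq_quad2: "qtag i = (p, q) \<Longrightarrow> quad \<sigma> i = quad2 (\<lambda>a. \<sigma> a p) (\<lambda>a. \<sigma> a q) i"
  by (cases i) auto

lemma quad2_zero [simp]: "quad2 0 B i = 0" "quad2 A 0 i = 0"
  by (cases i; simp)+

definition mtrace :: "nat \<Rightarrow> (nat \<times> nat \<Rightarrow> real) \<Rightarrow> real" where
  "mtrace m A = (\<Sum>r\<in>{1..m}. A (r, r))"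

definition traceless :: "nat \<Rightarrow> (nat \<times> nat \<Rightarrow> real) \<Rightarrow> nat \<times> nat \<Rightarrow> real" where
  "traceless m A = (\<lambda>(i, j). A (i, j) - (if i = j then mtrace m A / real m else 0))"

lemma mtrace_add: "mtrace m (A + B) = mtrace m A + mtrace m B"
  by (simp add: mtrace_def sum.distrib)

lemma mtrace_zero: "mtrace m 0 = 0"
  by (simp add: mtrace_def)

lemma traceless_add: "traceless m (A + B) = traceless m A + traceless m B"
  by (auto simp: traceless_def mtrace_add fun_eq_iff add_divide_distrib)

lemma traceless_zero [simp]: "traceless m 0 = 0"
  by (auto simp: traceless_def mtrace_zero fun_eq_iff)

lemma traceless_id: "mtrace m A = 0 \<Longrightarrow> traceless m A = A"
  by (auto simp: traceless_def fun_eq_iff)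

lemma mtrace_munit: "mtrace m (munit i j) = (if i = j \<and> i \<in> {1..m} then 1 else 0)"
proof -
  have "mtrace m (munit i j) = (\<Sum>r\<in>{1..m}. if r = i then if i = j then 1 else 0 else 0)"
    unfolding mtrace_def by (rule sum.cong) (auto simp: munit_def)
  then show ?thesis by (simp add: sum.delta)
qed

text \<open>The basis of the traceless matrices dual to the coordinates other than \<open>(m, m)\<close>.\<close>

definition sl_unit :: "nat \<Rightarrow> nat \<times> nat \<Rightarrow> nat \<times> nat \<Rightarrow> real" where
  "sl_unit m a = munit (fst a) (snd a) - (if fst a = snd a then munit m m else 0)"

lemma traceless_sl_unit:
  assumes "a \<in> {1..m} \<times> {1..m}"
  shows "traceless m (sl_unit m a) = sl_unit m a"
proof (rule traceless_id)
  have "mtrace m (sl_unit m a + (if fst a = snd a then munit m m else 0)) = mtrace m (munit (fst a) (snd a))"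
    by (simp add: sl_unit_def)
  then show "mtrace m (sl_unit m a) = 0"
    using assms by (auto simp: mtrace_add mtrace_munit mtrace_zero split: if_splits)
qed

lemma sl_unit_eval:
  "b \<in> proper_pairs m \<Longrightarrow> sl_unit m a b = (if b = a then 1 else 0)"
  by (cases a) (auto simp: sl_unit_def munit_def proper_pairs_def)

lemma index_I_proper:
  "(i, j, h, k) \<in> index_I m \<Longrightarrow> (i, j) \<in> proper_pairs m \<and> (h, k) \<in> proper_pairs m \<and> (i, j) \<noteq> (h, k)"
  by (auto simp: index_I_def proper_pairs_def)

lemma index_I_asym: "(i, j, h, k) \<in> index_I m \<Longrightarrow> (h, k, i, j) \<notin> index_I m"
  by (auto simp: index_I_def)

lemma quad_indices_T: "T a b p q \<in> quad_indices m n \<longleftrightarrow>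
    (fst a, snd a, fst b, snd b) \<in> index_J m \<and> p \<in> {1..n} \<and> q \<in> {1..n} \<and> p < q"
  by (cases a; cases b) (auto simp: quad_indices_def)

lemma quad_indices_U: "U a b p q \<in> quad_indices m n \<longleftrightarrow>
    (fst a, snd a, fst b, snd b) \<in> index_I m \<and> p \<in> {1..n} \<and> q \<in> {1..n} \<and> p \<le> q"
  by (cases a; cases b) (auto simp: quad_indices_def)

lemma quad_indices_V: "V a p q \<in> quad_indices m n \<longleftrightarrow>
    a \<in> proper_pairs m \<and> p \<in> {1..n} \<and> q \<in> {1..n} \<and> p \<le> q"
  by (cases a) (auto simp: quad_indices_def proper_pairs_def)

lemma index_I_proper':
  assumes "(fst a, snd a, fst b, snd b) \<in> index_I m"
  shows "a \<in> proper_pairs m" "b \<in> proper_pairs m" "a \<noteq> b"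
  using index_I_proper[OF assms] by auto

lemmas index_J_proper = index_I_proper'[OF subsetD[OF index_J_subset]]

lemma sum_eq_single:
  assumes "finite I" "i \<in> I" "\<And>j. j \<in> I \<Longrightarrow> j \<noteq> i \<Longrightarrow> f j = (0::'c::comm_monoid_add)"
  shows "sum f I = f i"
proof -
  have "sum f I = sum f {i}" by (rule sum.mono_neutral_right) (use assms in auto)
  then show ?thesis by simp
qed

locale vanishing_quadratic_form =
  fixes m n :: nat and c :: "quad_index \<Rightarrow> real"
  assumes m2: "m \<ge> 2"
    and vanish: "\<And>A. (\<And>p q. matmul m (A p) (A q) = matmul m (A q) (A p)) \<Longrightarrow>
      (\<Sum>i\<in>quad_indices m n. c i * quad (\<lambda>a l. traceless m (A l) a) i) = 0"
begin

definition block :: "nat \<Rightarrow> nat \<Rightarrow> quad_index set" where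
  "block p q = {i \<in> quad_indices m n. qtag i = (p, q)}"

definition F :: "nat \<Rightarrow> nat \<Rightarrow> (nat \<times> nat \<Rightarrow> real) \<Rightarrow> (nat \<times> nat \<Rightarrow> real) \<Rightarrow> real" where
  "F p q A B = (\<Sum>i\<in>block p q. c i * quad2 A B i)"

lemma finite_block: "finite (block p q)"
  by (simp add: block_def finite_quad_indices)

lemma F_zero [simp]: "F p q 0 B = 0" "F p q A 0 = 0"
  by (simp_all add: F_def)

lemma block_empty: "\<not> p \<le> q \<Longrightarrow> block p q = {}"
proof -
  have "p \<le> q" if "i \<in> block p q" for i
    using that by (cases i) (auto simp: block_def quad_indices_T quad_indices_U quad_indices_V)
  then show "\<not> p \<le> q \<Longrightarrow> block p q = {}" by blast
qed

lemma F_empty: "q < p \<Longrightarrow> F p q A B = 0"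
  by (simp add: F_def block_empty)

lemma blocks_vanish:
  assumes "\<And>p q. matmul m (A p) (A q) = matmul m (A q) (A p)"
  shows "(\<Sum>(p, q)\<in>{1..n} \<times> {1..n}. F p q (traceless m (A p)) (traceless m (A q))) = 0"
proof -
  let ?f = "\<lambda>i. c i * quad (\<lambda>a l. traceless m (A l) a) i"
  have tag: "qtag ` quad_indices m n \<subseteq> {1..n} \<times> {1..n}"
    by (auto elim!: quad_indices_cases)
  have "(\<Sum>i\<in>quad_indices m n. ?f i) = (\<Sum>y\<in>{1..n} \<times> {1..n}. sum ?f {i \<in> quad_indices m n. qtag i = y})"
    by (rule sum.group[symmetric]) (use tag finite_quad_indices in auto)
  also have "\<dots> = (\<Sum>(p, q)\<in>{1..n} \<times> {1..n}. F p q (traceless m (A p)) (traceless m (A q)))"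
    unfolding F_def block_def by (intro sum.cong) (auto simp: quad_eq_quad2)
  finally show ?thesis using vanish[OF assms] by simp
qed

lemma F_diag_vanish:
  assumes p: "p \<in> {1..n}"
  shows "F p p (traceless m A) (traceless m A) = 0"
proof -
  define D where "D l = (if l = p then A else 0)" for l
  have "(\<Sum>(k, l)\<in>{1..n} \<times> {1..n}. F k l (traceless m (D k)) (traceless m (D l)))
      = F p p (traceless m (D p)) (traceless m (D p))"
    by (subst sum_eq_single[of _ "(p, p)"]) (use p in \<open>auto simp: D_def split: if_splits\<close>)
  moreover have "matmul m (D k) (D l) = matmul m (D l) (D k)" for k l by (simp add: D_def)
  ultimately show ?thesis using blocks_vanish[of D] by (simp add: D_def)
qed

text \<open>The tuple with \<open>A\<close> at \<open>p\<close>, \<open>B\<close> at \<open>q\<close> and zeros elsewhere also sees the blocks \<open>(p, p)\<close> and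
  \<open>(q, q)\<close>, which vanish by \<open>F_diag_vanish\<close>.\<close>

lemma F_vanish:
  assumes pq: "p \<in> {1..n}" "q \<in> {1..n}" "p < q" and comm: "matmul m A B = matmul m B A"
  shows "F p q (traceless m A) (traceless m B) = 0"
proof -
  define D where "D l = (if l = p then A else if l = q then B else 0)" for l
  let ?f = "\<lambda>(k, l). F k l (traceless m (D k)) (traceless m (D l))"
  have "(\<Sum>y\<in>{1..n} \<times> {1..n}. ?f y) = (\<Sum>y\<in>{(p, p), (q, q), (p, q)}. ?f y)"
  proof (rule sum.mono_neutral_right)
    show "\<forall>y\<in>{1..n} \<times> {1..n} - {(p, p), (q, q), (p, q)}. ?f y = 0"
      using pq by (auto simp: D_def F_empty split: if_splits)
  qed (use pq in auto)
  also have "\<dots> = ?f (p, p) + ?f (q, q) + ?f (p, q)" using pq by simp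
  also have "\<dots> = F p q (traceless m A) (traceless m B)"
    using pq F_diag_vanish by (simp add: D_def)
  finally show ?thesis using blocks_vanish[of D] comm by (simp add: D_def)
qed

lemma F_diagonal_vanish:
  assumes "p \<in> {1..n}" "q \<in> {1..n}" "p \<le> q"
  shows "F p q (traceless m A) (traceless m A) = 0"
  using assms F_diag_vanish F_vanish[of p q A A] by (cases "p = q") auto

text \<open>On the diagonal \<open>A = B\<close> the terms \<open>T\<close> drop out. Among the others, evaluation at one dual unit isolates
  a coefficient of type \<open>V\<close>, and evaluation at the sum of two units one of type \<open>U\<close>.\<close>

lemma V_coeff_zero:
  assumes V: "V a p q \<in> quad_indices m n"
  shows "c (V a p q) = 0"
proof -
  let ?A = "sl_unit m a"
  have a: "a \<in> proper_pairs m" using V by (simp add: quad_indices_V)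
  then have tr: "traceless m ?A = ?A" by (intro traceless_sl_unit) (simp add: proper_pairs_def)
  have "F p q ?A ?A = c (V a p q) * quad2 ?A ?A (V a p q)"
    unfolding F_def
  proof (rule sum_eq_single[OF finite_block])
    show "V a p q \<in> block p q" using V by (simp add: block_def)
    fix j assume j: "j \<in> block p q" "j \<noteq> V a p q"
    show "c j * quad2 ?A ?A j = 0"
    proof (cases j)
      case (U b d r t)
      then show ?thesis
        using j index_I_proper'[of b d m] by (auto simp: block_def quad_indices_U sl_unit_eval)
    next
      case (V b r t)
      then show ?thesis using j by (auto simp: block_def quad_indices_V sl_unit_eval)
    qed simp
  qed
  then show ?thesis
    using F_diagonal_vanish[of p q ?A] V a by (simp add: tr quad_indices_V sl_unit_eval)
qed

lemma U_coeff_zero: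
  assumes U: "U a b p q \<in> quad_indices m n"
  shows "c (U a b p q) = 0"
proof -
  let ?A = "sl_unit m a + sl_unit m b"
  have I: "(fst a, snd a, fst b, snd b) \<in> index_I m" using U by (simp add: quad_indices_U)
  note ab = index_I_proper'[OF I]
  have tr: "traceless m ?A = ?A"
    using ab traceless_sl_unit by (simp add: traceless_add proper_pairs_def)
  have "F p q ?A ?A = c (U a b p q) * quad2 ?A ?A (U a b p q)"
    unfolding F_def
  proof (rule sum_eq_single[OF finite_block])
    show "U a b p q \<in> block p q" using U by (simp add: block_def)
    fix j assume j: "j \<in> block p q" "j \<noteq> U a b p q"
    show "c j * quad2 ?A ?A j = 0"
    proof (cases j)
      case (U d e r t)
      then have de: "(fst d, snd d, fst e, snd e) \<in> index_I m" "r = p" "t = q"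
        using j by (auto simp: block_def quad_indices_U)
      then have "\<not> (d = a \<and> e = b)" "\<not> (d = b \<and> e = a)"
        using j U index_I_asym[OF I] by auto
      then show ?thesis
        using U index_I_proper'[OF de(1)] by (auto simp: sl_unit_eval)
    next
      case (V d r t)
      then show ?thesis using j V_coeff_zero[of d r t] by (auto simp: block_def)
    qed simp
  qed
  moreover have "quad2 ?A ?A (U a b p q) = 2" using ab by (simp add: sl_unit_eval)
  ultimately show ?thesis
    using F_diagonal_vanish[of p q ?A] U by (simp add: tr quad_indices_U)
qed

lemma F_alternating: "F p q B A = - F p q A B"
  unfolding F_def sum_negf[symmetric]
proof (rule sum.cong[OF refl])
  fix i assume "i \<in> block p q"
  then show "c i * quad2 B A i = - (c i * quad2 A B i)"
    using U_coeff_zero V_coeff_zero by (cases i) (auto simp: block_def algebra_simps)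
qed

lemma F_add_left: "F p q (A + B) D = F p q A D + F p q B D"
  unfolding F_def sum.distrib[symmetric]
proof (rule sum.cong[OF refl])
  fix i
  show "c i * quad2 (A + B) D i = c i * quad2 A D i + c i * quad2 B D i"
    by (cases i) (auto simp: algebra_simps)
qed

lemma F_sl_units_zero:
  assumes "\<And>d e. (fst d, snd d, fst e, snd e) \<in> index_J m \<Longrightarrow> (d, e) \<noteq> (a, b) \<and> (d, e) \<noteq> (b, a)"
  shows "F p q (sl_unit m a) (sl_unit m b) = 0"
  unfolding F_def
proof (rule sum.neutral, rule ballI)
  fix j assume j: "j \<in> block p q"
  show "c j * quad2 (sl_unit m a) (sl_unit m b) j = 0"
  proof (cases j)
    case (T d e r t)
    then have de: "(fst d, snd d, fst e, snd e) \<in> index_J m" using j by (auto simp: block_def quad_indices_T)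
    then show ?thesis using T assms[OF de] index_J_proper[OF de] by (auto simp: sl_unit_eval)
  qed (use j U_coeff_zero V_coeff_zero in \<open>auto simp: block_def\<close>)
qed

text \<open>With the coefficients of \<open>U\<close> and \<open>V\<close> gone, each block is an alternating form on all matrices after
  composition with the projection to the traceless part; the projection preserves commutation.
  The absence of the indices in \<open>index_I m - index_J m\<close> provides the hypotheses of \<open>zero_on_units\<close>.\<close>

lemma T_coeff_zero:
  assumes T: "T a b p q \<in> quad_indices m n"
  shows "c (T a b p q) = 0"
proof -
  have pq: "p \<in> {1..n}" "q \<in> {1..n}" "p < q" and J: "(fst a, snd a, fst b, snd b) \<in> index_J m"
    using T by (auto simp: quad_indices_T)
  define \<omega> where "\<omega> A B = F p q (traceless m A) (traceless m B)" for A B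
  interpret alternating_on_matrices m \<omega>
    by unfold_locales
      (auto simp: \<omega>_def traceless_add F_add_left F_vanish[OF pq] intro: F_alternating)
  have sl: "\<omega> (sl_unit m a) (sl_unit m b) = F p q (sl_unit m a) (sl_unit m b)"
    if "a \<in> {1..m} \<times> {1..m}" "b \<in> {1..m} \<times> {1..m}" for a b
    using that by (simp add: \<omega>_def traceless_sl_unit)
  have munit_off: "sl_unit m (i, j) = munit i j" if "i \<noteq> j" for i j
    using that by (simp add: sl_unit_def)
  have zero: "\<omega> (sl_unit m a) (sl_unit m b) = 0"
    if "a \<in> {1..m} \<times> {1..m}" "b \<in> {1..m} \<times> {1..m}"
      "(fst a, snd a, fst b, snd b) \<notin> index_J m" "(fst b, snd b, fst a, snd a) \<notin> index_J m" for a b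
    unfolding sl[OF that(1,2)] by (rule F_sl_units_zero) (use that in auto)
  have units: "\<omega> (munit i j) (munit h k) = 0"
    if "i \<in> {1..m}" "j \<in> {1..m}" "h \<in> {1..m}" "k \<in> {1..m}" for i j h k
  proof (rule zero_on_units[OF m2 _ _ _ that])
    show "\<omega> (munit 1 j) (munit i 1) = 0" if "i \<in> {2..m}" "j \<in> {2..m}" for i j
      using zero[of "(1, j)" "(i, 1)"] that munit_off[of 1 j] munit_off[of i 1]
      by (auto simp: index_J_def index_I_def)
    show "\<omega> (munit 1 1 - munit m m) (munit i 1) = 0" if "i \<in> {2..m}" for i
      using zero[of "(1, 1)" "(i, 1)"] that munit_off[of i 1]
      by (auto simp: index_J_def index_I_def sl_unit_def)
    show "\<omega> (munit 1 1 - munit m m) (munit 1 j) = 0" if "j \<in> {2..m}" for j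
      using zero[of "(1, 1)" "(1, j)"] that munit_off[of 1 j]
      by (auto simp: index_J_def index_I_def sl_unit_def)
  qed
  note ab = index_J_proper[OF J]
  have "\<omega> (sl_unit m a) (sl_unit m b) = 0"
  proof -
    have *: "a \<in> {1..m} \<times> {1..m}" "b \<in> {1..m} \<times> {1..m}" "m \<in> {1..m}"
      using ab m2 by (auto simp: proper_pairs_def)
    have "\<omega> 0 D = 0" "\<omega> D 0 = 0" for D by (simp_all add: \<omega>_def)
    then show ?thesis
      unfolding sl_unit_def diff_left diff_right using * units
      by (cases a; cases b) (auto simp: diff_left diff_right)
  qed
  moreover have "F p q (sl_unit m a) (sl_unit m b) = c (T a b p q) * quad2 (sl_unit m a) (sl_unit m b) (T a b p q)"
    unfolding F_def
  proof (rule sum_eq_single[OF finite_block])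
    show "T a b p q \<in> block p q" using T by (simp add: block_def)
    fix j assume j: "j \<in> block p q" "j \<noteq> T a b p q"
    show "c j * quad2 (sl_unit m a) (sl_unit m b) j = 0"
    proof (cases j)
      case (T d e r t)
      then have de: "(fst d, snd d, fst e, snd e) \<in> index_J m" "r = p" "t = q"
        using j by (auto simp: block_def quad_indices_T)
      have "(fst d, snd d, fst e, snd e) \<in> index_I m" using de(1) index_J_subset by blast
      then have "\<not> (d = a \<and> e = b)" "\<not> (d = b \<and> e = a)"
        using j T de index_I_asym[OF subsetD[OF index_J_subset J]] by auto
      then show ?thesis
        using T index_J_proper[OF de(1)] by (auto simp: sl_unit_eval)
    qed (use j U_coeff_zero V_coeff_zero in \<open>auto simp: block_def\<close>)
  qed
  ultimately show ?thesis
    using sl[of a b] ab by (auto simp: sl_unit_eval proper_pairs_def)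
qed

proposition coeff_zero: "i \<in> quad_indices m n \<Longrightarrow> c i = 0"
  using T_coeff_zero U_coeff_zero V_coeff_zero by (cases i) auto

end

section \<open>Curves of representations through the trivial one\<close>

text \<open>Functions of order at least \<open>k\<close> at \<open>0\<close>. Asking for a limit of \<open>f e / e\<^sup>k\<close>, and not just for a bound,
  makes the limit laws yield the axioms of a filtration.\<close>

definition vanishing :: "nat \<Rightarrow> (real \<Rightarrow> 'c::real_normed_field) set" where
  "vanishing k = {f. \<exists>L. ((\<lambda>e. f e / of_real e ^ k) \<longlongrightarrow> L) (at 0)}"

lemma vanishingI: "((\<lambda>e. f e / of_real e ^ k) \<longlongrightarrow> L) (at 0) \<Longrightarrow> f \<in> vanishing k"
  by (auto simp: vanishing_def)

lemma vanishing_Suc_tendsto_0: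
  assumes "f \<in> vanishing (Suc k)"
  shows "((\<lambda>e. f e / of_real e ^ k) \<longlongrightarrow> 0) (at 0)"
proof -
  obtain L where L: "((\<lambda>e. f e / of_real e ^ Suc k) \<longlongrightarrow> L) (at 0)"
    using assms by (auto simp: vanishing_def)
  have "((\<lambda>e. of_real e :: 'a) \<longlongrightarrow> 0) (at 0)"
    using tendsto_of_real[OF tendsto_ident_at[of "0::real" UNIV]] by simp
  from tendsto_mult[OF this L]
  have "((\<lambda>e. of_real e * (f e / of_real e ^ Suc k)) \<longlongrightarrow> 0) (at 0)" by simp
  moreover have "eventually (\<lambda>e. of_real e * (f e / of_real e ^ Suc k) = f e / of_real e ^ k) (at (0::real))"
    by (simp add: eventually_at_filter)
  ultimately show ?thesis by (rule Lim_transform_eventually)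
qed

lemma ring_filtration_vanishing: "ring_filtration (vanishing :: nat \<Rightarrow> (real \<Rightarrow> 'c::real_normed_field) set)"
proof
  show "(1 :: real \<Rightarrow> 'c) \<in> vanishing 0" by (auto simp: vanishing_def one_fun_def)
  show "(0 :: real \<Rightarrow> 'c) \<in> vanishing k" for k by (auto simp: vanishing_def)
  show "f + g \<in> vanishing k" if "f \<in> vanishing k" "g \<in> vanishing k" for f g :: "real \<Rightarrow> 'c" and k
    using that by (auto simp: vanishing_def add_divide_distrib intro: tendsto_add)
  show "- f \<in> vanishing k" if "f \<in> vanishing k" for f :: "real \<Rightarrow> 'c" and k
    using that by (auto simp: vanishing_def intro: tendsto_minus)
  show "f * g \<in> vanishing (j + k)" if fg: "f \<in> vanishing j" "g \<in> vanishing k" for f g :: "real \<Rightarrow> 'c" and j k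
  proof -
    obtain L M where "((\<lambda>e. f e / of_real e ^ j) \<longlongrightarrow> L) (at 0)" "((\<lambda>e. g e / of_real e ^ k) \<longlongrightarrow> M) (at 0)"
      using fg by (auto simp: vanishing_def)
    from tendsto_mult[OF this] show ?thesis
      by (intro vanishingI[of _ _ "L * M"]) (simp add: power_add)
  qed
  show "vanishing (Suc k) \<subseteq> (vanishing k :: (real \<Rightarrow> 'c) set)" for k
    using vanishing_Suc_tendsto_0 by (auto simp: vanishing_def)
qed

lemma tendsto_det:
  fixes M :: "real \<Rightarrow> 'c::real_normed_field mat"
  assumes M: "\<And>e. M e \<in> carrier_mat k k" and conv: "\<And>i j. i < k \<Longrightarrow> j < k \<Longrightarrow> ((\<lambda>e. M e $$ (i, j)) \<longlongrightarrow> L i j) F"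
  shows "((\<lambda>e. det (M e)) \<longlongrightarrow> det (mat k k (\<lambda>(i, j). L i j))) F"
proof -
  have "((\<lambda>e. \<Sum>p | p permutes {0..<k}. of_int (sign p) * (\<Prod>i = 0..<k. M e $$ (i, p i))) \<longlongrightarrow>
      (\<Sum>p | p permutes {0..<k}. of_int (sign p) * (\<Prod>i = 0..<k. L i (p i)))) F"
  proof (intro tendsto_sum tendsto_mult tendsto_const tendsto_prod)
    fix p i assume "p \<in> {p. p permutes {0..<k}}" "i \<in> {0..<k}"
    then show "((\<lambda>e. M e $$ (i, p i)) \<longlongrightarrow> L i (p i)) F"
      using permutes_in_image[of p "{0..<k}" i] by (intro conv) auto
  qed
  moreover have "det (mat k k (\<lambda>(i, j). L i j)) = (\<Sum>p | p permutes {0..<k}. of_int (sign p) * (\<Prod>i = 0..<k. L i (p i)))"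
    by (subst det_def'[of _ k]) (auto intro!: sum.cong prod.cong)
  ultimately show ?thesis using det_def'[OF M] by simp
qed

text \<open>The matrix \<open>1 + e A\<close>, with rows and columns counted from \<open>0\<close>.\<close>

definition real_mat :: "nat \<Rightarrow> (nat \<times> nat \<Rightarrow> real) \<Rightarrow> real \<Rightarrow> real mat" where
  "real_mat m A e = mat m m (\<lambda>(i, j). (if i = j then 1 else 0) + e * A (Suc i, Suc j))"

text \<open>Multiplying by a scalar reaches determinant \<open>1\<close> without disturbing commutation. The value is
  meaningful where the determinant is positive, thus for small \<open>e\<close>.\<close>

definition scale :: "nat \<Rightarrow> (nat \<times> nat \<Rightarrow> real) \<Rightarrow> real \<Rightarrow> real" where
  "scale m A e = det (real_mat m A e) powr (- 1 / real m)"

definition curve :: "nat \<Rightarrow> (nat \<times> nat \<Rightarrow> real) \<Rightarrow> real \<Rightarrow> complex mat" where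
  "curve m A e = map_mat complex_of_real (scale m A e \<cdot>\<^sub>m real_mat m A e)"

lemma real_mat_carrier [simp]: "real_mat m A e \<in> carrier_mat m m"
  by (simp add: real_mat_def)

lemma real_mat_dim [simp]: "dim_row (real_mat m A e) = m" "dim_col (real_mat m A e) = m"
  by (simp_all add: real_mat_def)

lemma det_real_mat_0: "det (real_mat m A 0) = 1"
proof -
  have "real_mat m A 0 = 1\<^sub>m m" by (rule eq_matI) (auto simp: real_mat_def)
  then show ?thesis by simp
qed

text \<open>This is \<open>det_one_plus\<close> for the filtration by order of vanishing.\<close>

lemma DERIV_det_real_mat: "((\<lambda>e. det (real_mat m A e)) has_real_derivative mtrace m A) (at 0)"
proof -
  interpret ring_filtration "vanishing :: nat \<Rightarrow> (real \<Rightarrow> real) set" by (rule ring_filtration_vanishing)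
  define S where "S i j = (\<lambda>e. e * A (Suc i, Suc j))" for i j
  define M where "M = mat m m (\<lambda>(i, j). (if i = j then 1 else 0) + S i j)"
  have "S i j \<in> vanishing 1" for i j
  proof (rule vanishingI)
    have "eventually (\<lambda>e. A (Suc i, Suc j) = S i j e / of_real e ^ 1) (at 0)"
      by (simp add: eventually_at_filter S_def)
    with tendsto_const show "((\<lambda>e. S i j e / of_real e ^ 1) \<longlongrightarrow> A (Suc i, Suc j)) (at 0)"
      by (rule Lim_transform_eventually)
  qed
  then have K2: "det M - 1 - (\<Sum>i<m. S i i) \<in> vanishing (Suc 1)"
    using det_one_plus[of m S] unfolding M_def by (simp add: numeral_2_eq_2)
  have ev: "det M e = det (real_mat m A e)" for e
  proof -
    interpret ev: comm_ring_hom "\<lambda>f :: real \<Rightarrow> real. f e" by unfold_locales auto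
    have "map_mat (\<lambda>f. f e) M = real_mat m A e"
      by (rule eq_matI) (auto simp: M_def real_mat_def S_def)
    then show ?thesis using ev.hom_det[of M] by simp
  qed
  have tr: "(\<Sum>i<m. S i i) e = e * mtrace m A" for e
  proof -
    have "(\<Sum>i<m. A (Suc i, Suc i)) = mtrace m A"
      unfolding mtrace_def sum_shift_index by (rule sum.cong) auto
    then show ?thesis by (simp add: S_def sum_fun_apply flip: sum_distrib_left)
  qed
  from vanishing_Suc_tendsto_0[OF K2]
  have "((\<lambda>e. (det (real_mat m A e) - 1 - e * mtrace m A) / e + mtrace m A) \<longlongrightarrow> 0 + mtrace m A) (at 0)"
    by (intro tendsto_add tendsto_const) (simp add: ev tr)
  moreover have "eventually (\<lambda>e. (det (real_mat m A e) - 1 - e * mtrace m A) / e + mtrace m A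
      = (det (real_mat m A (0 + e)) - det (real_mat m A 0)) / e) (at 0)"
    by (simp add: eventually_at_filter det_real_mat_0 field_simps)
  ultimately show ?thesis
    unfolding DERIV_def by (auto intro: Lim_transform_eventually)
qed

lemma eventually_det_pos: "eventually (\<lambda>e. det (real_mat m A e) > 0) (at 0)"
proof -
  have "((\<lambda>e. det (real_mat m A e)) \<longlongrightarrow> 1) (at 0)"
    using DERIV_isCont[OF DERIV_det_real_mat[of m A]] by (simp add: isCont_def det_real_mat_0)
  then show ?thesis by (rule order_tendstoD) simp
qed

lemma scale_0: "scale m A 0 = 1"
  by (simp add: scale_def det_real_mat_0)

lemma DERIV_scale: "(scale m A has_real_derivative - mtrace m A / real m) (at 0)"
  using DERIV_fun_powr[OF DERIV_det_real_mat[of m A], of "- 1 / real m"]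
  by (simp add: det_real_mat_0 scale_def[abs_def])

lemma curve_entry:
  assumes "i \<in> {1..m}" "j \<in> {1..m}"
  shows "curve m A e $$ (i - 1, j - 1) = of_real (scale m A e * ((if i = j then 1 else 0) + e * A (i, j)))"
  using assms by (auto simp: curve_def real_mat_def)

lemma curve_SL:
  assumes m: "m > 0" and pos: "det (real_mat m A e) > 0"
  shows "curve m A e \<in> carrier (SL m)"
proof -
  let ?d = "det (real_mat m A e)"
  have "det (scale m A e \<cdot>\<^sub>m real_mat m A e) = scale m A e ^ m * ?d"
    by (simp add: det_smult)
  also have "scale m A e ^ m = ?d powr (- 1)"
    using pos m by (simp add: scale_def powr_realpow[symmetric] powr_powr)
  also have "\<dots> * ?d = 1" using pos by (simp add: powr_minus)
  finally have "det (scale m A e \<cdot>\<^sub>m real_mat m A e) = 1" .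
  then have "det (curve m A e) = 1" unfolding curve_def by (simp add: of_real_hom.hom_det)
  then show ?thesis by (simp add: SL_sel curve_def)
qed

lemma real_mat_comm:
  assumes "matmul m A B = matmul m B A"
  shows "real_mat m A e * real_mat m B e = real_mat m B e * real_mat m A e"
proof -
  have prod: "(real_mat m A e * real_mat m B e) $$ (i, j) = (if i = j then 1 else 0)
      + e * A (Suc i, Suc j) + e * B (Suc i, Suc j) + e * e * matmul m A B (Suc i, Suc j)"
    if ij: "i < m" "j < m" for A B i j
  proof -
    have "(real_mat m A e * real_mat m B e) $$ (i, j)
        = (\<Sum>k<m. ((if i = k then 1 else 0) + e * A (Suc i, Suc k)) * ((if k = j then 1 else 0) + e * B (Suc k, Suc j)))"
      using ij by (auto simp: scalar_prod_def real_mat_def atLeast0LessThan)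
    also have "\<dots> = (\<Sum>k<m. (if k = i then if i = j then 1 else 0 else 0)
        + (if k = j then e * A (Suc i, Suc k) else 0) + (if k = i then e * B (Suc k, Suc j) else 0)
        + e * e * (A (Suc i, Suc k) * B (Suc k, Suc j)))"
      by (rule sum.cong) (auto simp: algebra_simps)
    also have "\<dots> = (if i = j then 1 else 0) + e * A (Suc i, Suc j) + e * B (Suc i, Suc j)
        + e * e * (\<Sum>k<m. A (Suc i, Suc k) * B (Suc k, Suc j))"
      using ij by (simp add: sum.distrib sum.delta sum_distrib_left)
    also have "(\<Sum>k<m. A (Suc i, Suc k) * B (Suc k, Suc j)) = matmul m A B (Suc i, Suc j)"
      unfolding matmul_def sum_shift_index by (simp cong: sum.cong) (rule sum.cong, auto)
    finally show ?thesis .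
  qed
  show ?thesis
    by (rule eq_matI) (simp_all add: prod assms algebra_simps del: index_mult_mat(1))
qed

lemma curve_comm:
  assumes "matmul m A B = matmul m B A"
  shows "curve m A e * curve m B e = curve m B e * curve m A e"
proof -
  have "(scale m A e \<cdot>\<^sub>m real_mat m A e) * (scale m B e \<cdot>\<^sub>m real_mat m B e)
      = (scale m B e \<cdot>\<^sub>m real_mat m B e) * (scale m A e \<cdot>\<^sub>m real_mat m A e)"
    using real_mat_comm[OF assms, of e]
    by (simp add: mult_smult_assoc_mat[of _ m m _ m] mult_smult_distrib[of _ m m _ m])
      (rule eq_matI; simp del: index_mult_mat(1))
  then show ?thesis
    unfolding curve_def by (simp add: of_real_hom.mat_hom_mult[of _ m m _ m, symmetric])
qed

lemma complex_of_rat_eq: "complex_of_rat q = of_real (real_of_rat q)"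
  by (cases q) (simp add: of_rat_rat)

locale commuting_directions = free_abelian_reps H n m x
  for H :: "('a, 'b) monoid_scheme" and n m and x :: "nat \<Rightarrow> 'a" +
  fixes A :: "nat \<Rightarrow> nat \<times> nat \<Rightarrow> real"
  assumes commute: "matmul m (A p) (A q) = matmul m (A q) (A p)"
begin

definition admissible :: "real \<Rightarrow> bool" where
  "admissible e \<longleftrightarrow> (\<forall>l\<in>{1..n}. det (real_mat m (A l) e) > 0)"

lemma eventually_admissible: "eventually admissible (at 0)"
  unfolding admissible_def by (intro eventually_ball_finite ballI eventually_det_pos) auto

lemma exists_curve: "\<exists>\<rho>. \<forall>e. \<rho> e \<in> R \<and> (admissible e \<longrightarrow> (\<forall>l\<in>{1..n}. \<rho> e (x l) = curve m (A l) e))"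
proof (rule choice, rule allI)
  fix e
  show "\<exists>\<rho>. \<rho> \<in> R \<and> (admissible e \<longrightarrow> (\<forall>l\<in>{1..n}. \<rho> (x l) = curve m (A l) e))"
  proof (cases "admissible e")
    case True
    have "\<exists>\<rho>\<in>R. \<forall>l\<in>{1..n}. \<rho> (x l) = curve m (A l) e"
      by (rule exists_rep[OF free])
        (use True m2 in \<open>auto simp: admissible_def intro!: curve_SL curve_comm commute\<close>)
    then show ?thesis by blast
  next
    case False
    have "\<exists>\<rho>\<in>R. \<forall>l\<in>{1..n}. \<rho> (x l) = 1\<^sub>m m"
      by (rule exists_rep[OF free]) (auto simp: SL_sel)
    then show ?thesis using False by blast
  qed
qed

text \<open>A single choice of representations for all \<open>e\<close>; where \<open>e\<close> is not admissible, any representation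
  will do, since only the behaviour near \<open>0\<close> matters.\<close>

definition \<rho> :: "real \<Rightarrow> 'a \<Rightarrow> complex mat" where
  "\<rho> = (SOME \<rho>. \<forall>e. \<rho> e \<in> R \<and> (admissible e \<longrightarrow> (\<forall>l\<in>{1..n}. \<rho> e (x l) = curve m (A l) e)))"

lemma \<rho>_rep: "\<rho> e \<in> R" and \<rho>_x: "admissible e \<Longrightarrow> l \<in> {1..n} \<Longrightarrow> \<rho> e (x l) = curve m (A l) e"
  using someI_ex[OF exists_curve] unfolding \<rho>_def[symmetric] by blast+

sublocale van: ring_filtration "vanishing :: nat \<Rightarrow> (real \<Rightarrow> complex) set"
  by (rule ring_filtration_vanishing)

text \<open>The factor \<open>scale\<close> has derivative \<open>- tr(A l) / m\<close> at \<open>0\<close>, which turns \<open>A l\<close> into its traceless part.\<close>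

lemma s_limit:
  assumes a: "a \<in> {1..m} \<times> {1..m}" and l: "l \<in> {1..n}"
  shows "((\<lambda>e. s a l (\<rho> e) / of_real e) \<longlongrightarrow> of_real (traceless m (A l) a)) (at 0)"
proof -
  obtain i j where ij: "a = (i, j)" "i \<in> {1..m}" "j \<in> {1..m}" using a by auto
  let ?g = "scale m (A l)" and ?d = "if i = j then 1 else 0 :: real"
  have "((\<lambda>e. (?g (0 + e) - ?g 0) / e) \<longlongrightarrow> - mtrace m (A l) / real m) (at 0)"
    using DERIV_scale[of m "A l"] unfolding DERIV_def by simp
  moreover have "(?g \<longlongrightarrow> 1) (at 0)"
    using DERIV_isCont[OF DERIV_scale[of m "A l"]] by (simp add: isCont_def scale_0)
  ultimately have "((\<lambda>e. ?d * ((?g (0 + e) - ?g 0) / e) + ?g e * A l (i, j))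
      \<longlongrightarrow> ?d * (- mtrace m (A l) / real m) + 1 * A l (i, j)) (at 0)"
    by (intro tendsto_add tendsto_mult tendsto_const)
  also have "?d * (- mtrace m (A l) / real m) + 1 * A l (i, j) = traceless m (A l) a"
    by (simp add: traceless_def ij)
  finally have lim: "((\<lambda>e. complex_of_real (?d * ((?g (0 + e) - ?g 0) / e) + ?g e * A l (i, j)))
      \<longlongrightarrow> of_real (traceless m (A l) a)) (at 0)"
    by (rule tendsto_of_real)
  have "eventually (\<lambda>e. e \<noteq> 0) (at (0::real))" by (simp add: eventually_at_filter)
  with eventually_admissible
  have "eventually (\<lambda>e. complex_of_real (?d * ((?g (0 + e) - ?g 0) / e) + ?g e * A l (i, j))
      = s a l (\<rho> e) / of_real e) (at 0)"
  proof eventually_elim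
    case (elim e)
    have "s a l (\<rho> e) = curve m (A l) e $$ (i - 1, j - 1) - (if i = j then 1 else 0)"
      using \<rho>_x[OF elim(1) l] by (simp add: s_def ij sentry_def entry_def)
    also have "\<dots> = of_real (?g e * (?d + e * A l (i, j)) - ?d)"
      unfolding curve_entry[OF ij(2,3)] by simp
    finally show ?case using elim(2) by (simp add: scale_0 field_simps)
  qed
  with lim show ?thesis by (rule Lim_transform_eventually)
qed

lemma sentry_vanishing:
  assumes "i \<in> {1..m}" "j \<in> {1..m}" "l \<in> {1..n}"
  shows "(\<lambda>e. sentry i j (x l) (\<rho> e)) \<in> vanishing 1"
  using s_limit[of "(i, j)" l] assms by (intro vanishingI) (auto simp: s_def)

lemma const_vanishing: "(\<lambda>e. c) \<in> vanishing 0"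
  by (auto simp: vanishing_def)

text \<open>The entries of an inverse in the special linear group are cofactors, hence polynomials in the
  entries; this is why they converge along the curve.\<close>

lemma entry_inv_vanishing:
  assumes h: "h \<in> carrier H" and ij: "i \<in> {1..m}" "j \<in> {1..m}"
    and conv: "\<And>i j. i \<in> {1..m} \<Longrightarrow> j \<in> {1..m} \<Longrightarrow> (\<lambda>e. entry i j h (\<rho> e)) \<in> vanishing 0"
  shows "(\<lambda>e. entry i j (inv\<^bsub>H\<^esub> h) (\<rho> e)) \<in> vanishing 0"
proof -
  have c: "\<rho> e h \<in> carrier_mat m m" for e using rep_mat \<rho>_rep h by blast
  have "\<forall>i j. \<exists>L. i < m \<longrightarrow> j < m \<longrightarrow> ((\<lambda>e. \<rho> e h $$ (i, j)) \<longlongrightarrow> L) (at 0)"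
  proof (intro allI)
    fix i j
    show "\<exists>L. i < m \<longrightarrow> j < m \<longrightarrow> ((\<lambda>e. \<rho> e h $$ (i, j)) \<longlongrightarrow> L) (at 0)"
      using conv[of "Suc i" "Suc j"] by (auto simp: vanishing_def entry_def)
  qed
  then obtain L where L: "\<And>i j. i < m \<Longrightarrow> j < m \<Longrightarrow> ((\<lambda>e. \<rho> e h $$ (i, j)) \<longlongrightarrow> L i j) (at 0)"
    by metis
  have "((\<lambda>e. det (mat_delete (\<rho> e h) (j - 1) (i - 1))) \<longlongrightarrow>
      det (mat (m - 1) (m - 1) (\<lambda>(k, l). L (insert_index (j - 1) k) (insert_index (i - 1) l)))) (at 0)"
  proof (rule tendsto_det)
    show "mat_delete (\<rho> e h) (j - 1) (i - 1) \<in> carrier_mat (m - 1) (m - 1)" for e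
      by (rule mat_delete_carrier[OF c])
    fix k l assume kl: "k < m - 1" "l < m - 1"
    have "mat_delete (\<rho> e h) (j - 1) (i - 1) $$ (k, l) = \<rho> e h $$ (insert_index (j - 1) k, insert_index (i - 1) l)" for e
      using mat_delete_index[of "\<rho> e h" "m - 1" "j - 1" "i - 1" k l] c[of e] ij kl m2 by auto
    moreover have "insert_index (j - 1) k < m" "insert_index (i - 1) l < m"
      using kl by (auto simp: insert_index_def)
    ultimately show "((\<lambda>e. mat_delete (\<rho> e h) (j - 1) (i - 1) $$ (k, l)) \<longlongrightarrow>
        L (insert_index (j - 1) k) (insert_index (i - 1) l)) (at 0)"
      using L by simp
  qed
  then have "(\<lambda>e. det (mat_delete (\<rho> e h) (j - 1) (i - 1))) \<in> vanishing 0"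
    by (auto simp: vanishing_def)
  then have "(\<lambda>e. (-1) ^ (j - 1 + (i - 1))) * (\<lambda>e. det (mat_delete (\<rho> e h) (j - 1) (i - 1))) \<in> vanishing 0"
    by (rule van.mult_mem_le[OF const_vanishing]) simp
  also have "(\<lambda>e. (-1) ^ (j - 1 + (i - 1))) * (\<lambda>e. det (mat_delete (\<rho> e h) (j - 1) (i - 1)))
      = (\<lambda>e. entry i j (inv\<^bsub>H\<^esub> h) (\<rho> e))"
  proof
    fix e
    have "\<rho> e (inv\<^bsub>H\<^esub> h) = inv\<^bsub>SL m\<^esub> \<rho> e h"
      by (rule group_hom.hom_inv[OF rep_group_hom[OF \<rho>_rep] h])
    also have "\<dots> = adj_mat (\<rho> e h)"
      by (rule SL_inv[OF rep_carrier[OF \<rho>_rep h]])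
    finally show "((\<lambda>e. (-1) ^ (j - 1 + (i - 1))) * (\<lambda>e. det (mat_delete (\<rho> e h) (j - 1) (i - 1)))) e
        = entry i j (inv\<^bsub>H\<^esub> h) (\<rho> e)"
      using c[of e] ij by (auto simp: entry_def adj_mat_def cofactor_def)
  qed
  finally show ?thesis .
qed

lemma entry_vanishing:
  assumes "h \<in> carrier H" "i \<in> {1..m}" "j \<in> {1..m}"
  shows "(\<lambda>e. entry i j h (\<rho> e)) \<in> vanishing 0"
proof -
  have "\<forall>i\<in>{1..m}. \<forall>j\<in>{1..m}. (\<lambda>e. entry i j h (\<rho> e)) \<in> vanishing 0"
    using free assms(1)
  proof (rule free_abelian_induct; intro ballI)
    fix i j assume ij: "i \<in> {1..m}" "j \<in> {1..m}"
    show "(\<lambda>e. entry i j \<one>\<^bsub>H\<^esub> (\<rho> e)) \<in> vanishing 0"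
      unfolding entry_one[OF \<rho>_rep ij] by (rule const_vanishing)
    fix l assume l: "l \<in> {1..n}"
    have "(\<lambda>e. sentry i j (x l) (\<rho> e)) + (\<lambda>e. if i = j then 1 else 0) \<in> vanishing 0"
      using sentry_vanishing[OF ij l] van.antimono[of 0 1] by (intro van.add_mem const_vanishing) auto
    also have "(\<lambda>e. sentry i j (x l) (\<rho> e)) + (\<lambda>e. if i = j then 1 else 0) = (\<lambda>e. entry i j (x l) (\<rho> e))"
      by (auto simp: sentry_def fun_eq_iff)
    finally show "(\<lambda>e. entry i j (x l) (\<rho> e)) \<in> vanishing 0" .
  next
    fix g h i j
    assume gh: "g \<in> carrier H" "h \<in> carrier H" and ij: "i \<in> {1..m}" "j \<in> {1..m}"
      and IH: "\<forall>i\<in>{1..m}. \<forall>j\<in>{1..m}. (\<lambda>e. entry i j g (\<rho> e)) \<in> vanishing 0"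
        "\<forall>i\<in>{1..m}. \<forall>j\<in>{1..m}. (\<lambda>e. entry i j h (\<rho> e)) \<in> vanishing 0"
    have "(\<Sum>k\<in>{1..m}. (\<lambda>e. entry i k g (\<rho> e)) * (\<lambda>e. entry k j (inv\<^bsub>H\<^esub> h) (\<rho> e))) \<in> vanishing 0"
    proof (rule van.sum_mem)
      fix k assume k: "k \<in> {1..m}"
      have "(\<lambda>e. entry i k g (\<rho> e)) \<in> vanishing 0" using IH ij k by blast
      moreover have "(\<lambda>e. entry k j (inv\<^bsub>H\<^esub> h) (\<rho> e)) \<in> vanishing 0"
        by (rule entry_inv_vanishing[OF gh(2) k ij(2)]) (use IH in blast)
      ultimately show "(\<lambda>e. entry i k g (\<rho> e)) * (\<lambda>e. entry k j (inv\<^bsub>H\<^esub> h) (\<rho> e)) \<in> vanishing 0"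
        by (rule van.mult_mem_le) simp
    qed
    also have "(\<Sum>k\<in>{1..m}. (\<lambda>e. entry i k g (\<rho> e)) * (\<lambda>e. entry k j (inv\<^bsub>H\<^esub> h) (\<rho> e)))
        = (\<lambda>e. entry i j (g \<otimes>\<^bsub>H\<^esub> inv\<^bsub>H\<^esub> h) (\<rho> e))"
      using entry_mult[OF \<rho>_rep gh(1) H.inv_closed[OF gh(2)] ij] by (simp add: fun_eq_iff sum_fun_apply)
    finally show "(\<lambda>e. entry i j (g \<otimes>\<^bsub>H\<^esub> inv\<^bsub>H\<^esub> h) (\<rho> e)) \<in> vanishing 0" .
  qed
  then show ?thesis using assms by blast
qed

lemma \<rho>_comp_ops:
  "(\<lambda>e. (f + g) (\<rho> e)) = (\<lambda>e. f (\<rho> e)) + (\<lambda>e. g (\<rho> e))"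
  "(\<lambda>e. (f * g) (\<rho> e)) = (\<lambda>e. f (\<rho> e)) * (\<lambda>e. g (\<rho> e))"
  by (auto simp: fun_eq_iff)

lemma K0_vanishing: "f \<in> K 0 \<Longrightarrow> (\<lambda>e. f (\<rho> e)) \<in> vanishing 0"
proof (induction rule: K0_induct)
  case (cong f g)
  have "(\<lambda>e. g (\<rho> e)) = (\<lambda>e. f (\<rho> e))" using cong(1)[OF \<rho>_rep] by simp
  then show ?case using cong(2) by simp
next
  case (entry i j h)
  then show ?case by (intro entry_vanishing)
next
  case (cst q)
  show ?case unfolding cst_def by (rule const_vanishing)
next
  case (add f g)
  then show ?case unfolding \<rho>_comp_ops by (rule van.add_mem)
next
  case (mult f g)
  then show ?case unfolding \<rho>_comp_ops by (rule van.mult_mem_le) simp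
qed

lemma K1_vanishing: "f \<in> K 1 \<Longrightarrow> (\<lambda>e. f (\<rho> e)) \<in> vanishing 1"
proof (induction rule: K1_induct)
  case (cong f g)
  have "(\<lambda>e. g (\<rho> e)) = (\<lambda>e. f (\<rho> e))" using cong(1)[OF \<rho>_rep] by simp
  then show ?case using cong(2) by simp
next
  case (sentry i j l)
  then show ?case by (rule sentry_vanishing)
next
  case zero
  show ?case using van.zero_mem[of 1] by (simp add: zero_fun_def)
next
  case (add f g)
  from add(3,4) show ?case unfolding \<rho>_comp_ops by (rule van.add_mem)
next
  case (mult f g)
  from K0_vanishing[OF mult(1)] mult(3) show ?case unfolding \<rho>_comp_ops by (rule van.mult_mem_le) simp
qed

text \<open>Products add orders of vanishing, so it suffices that elements of the algebra have order \<open>0\<close> and those of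
  \<open>J\<close> order \<open>1\<close>.\<close>

lemma K_vanishing: "f \<in> K k \<Longrightarrow> (\<lambda>e. f (\<rho> e)) \<in> vanishing k"
proof (induction k arbitrary: f)
  case 0
  then show ?case by (rule K0_vanishing)
next
  case (Suc k)
  from Suc.prems show ?case
  proof (induction rule: K_Suc_induct)
    case (cong f g)
    have "(\<lambda>e. g (\<rho> e)) = (\<lambda>e. f (\<rho> e))" using cong(1)[OF \<rho>_rep] by simp
    then show ?case using cong(2) by simp
  next
    case (mult g h)
    have "h \<in> K 1" unfolding mem_K1_iff by (rule mult(2))
    then have "(\<lambda>e. h (\<rho> e)) \<in> vanishing 1" by (rule K1_vanishing)
    with Suc.IH[OF mult(1)] show ?case unfolding \<rho>_comp_ops by (rule van.mult_mem_le) simp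
  next
    case (add g h)
    from add(3,4) show ?case unfolding \<rho>_comp_ops by (rule van.add_mem)
  qed
qed

lemma quad_limit:
  assumes "i \<in> quad_indices m n"
  shows "((\<lambda>e. quad s i (\<rho> e) / of_real e ^ 2) \<longlongrightarrow> of_real (quad (\<lambda>a l. traceless m (A l) a) i)) (at 0)"
proof -
  have mult: "((\<lambda>e. s a p (\<rho> e) * s b q (\<rho> e) / of_real e ^ 2) \<longlongrightarrow>
      of_real (traceless m (A p) a) * of_real (traceless m (A q) b)) (at 0)"
    if "a \<in> {1..m} \<times> {1..m}" "b \<in> {1..m} \<times> {1..m}" "p \<in> {1..n}" "q \<in> {1..n}" for a b p q
    using tendsto_mult[OF s_limit[OF that(1,3)] s_limit[OF that(2,4)]]
    by (simp add: power2_eq_square)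
  from assms show ?thesis
  proof (cases rule: quad_indices_cases)
    case (T a b p q)
    from tendsto_diff[OF mult[OF T(2,3,4,5)] mult[OF T(2,3,5,4)]] show ?thesis
      by (simp add: T(1) diff_divide_distrib)
  next
    case (U a b p q)
    from tendsto_add[OF mult[OF U(2,3,4,5)] mult[OF U(2,3,5,4)]] show ?thesis
      by (simp add: U(1) add_divide_distrib)
  next
    case (V a p q)
    from mult[OF V(2,2,3,4)] show ?thesis by (simp add: V(1))
  qed
qed

text \<open>After division by \<open>e\<^sup>2\<close> the relation tends to \<open>0\<close>, because it vanishes to third order, and
  also to the quadratic expression in the directions \<open>A l\<close>.\<close>

lemma quad_relation:
  assumes "(\<Sum>i\<in>quad_indices m n. cst (c i) * quad s i) \<in> K 3"
  shows "(\<Sum>i\<in>quad_indices m n. of_rat (c i) * quad (\<lambda>a l. traceless m (A l) a) i) = (0::real)"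
proof -
  let ?I = "quad_indices m n"
  have "(\<lambda>e. (\<Sum>i\<in>?I. cst (c i) * quad s i) (\<rho> e)) \<in> vanishing (Suc 2)"
    using K_vanishing[OF assms] by (simp add: numeral_3_eq_3 numeral_2_eq_2)
  then have "((\<lambda>e. (\<Sum>i\<in>?I. cst (c i) * quad s i) (\<rho> e) / of_real e ^ 2) \<longlongrightarrow> 0) (at 0)"
    by (rule vanishing_Suc_tendsto_0)
  also have "(\<lambda>e. (\<Sum>i\<in>?I. cst (c i) * quad s i) (\<rho> e) / of_real e ^ 2)
      = (\<lambda>e. \<Sum>i\<in>?I. of_rat (c i) * (quad s i (\<rho> e) / of_real e ^ 2))"
    by (simp add: sum_fun_apply cst_def sum_divide_distrib)
  finally have "((\<lambda>e. \<Sum>i\<in>?I. of_rat (c i) * (quad s i (\<rho> e) / of_real e ^ 2)) \<longlongrightarrow> 0) (at 0)" .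
  moreover have "((\<lambda>e. \<Sum>i\<in>?I. of_rat (c i) * (quad s i (\<rho> e) / of_real e ^ 2)) \<longlongrightarrow>
      (\<Sum>i\<in>?I. of_rat (c i) * of_real (quad (\<lambda>a l. traceless m (A l) a) i))) (at 0)"
    by (intro tendsto_sum tendsto_mult tendsto_const quad_limit)
  ultimately have "(\<Sum>i\<in>?I. of_rat (c i) * complex_of_real (quad (\<lambda>a l. traceless m (A l) a) i)) = 0"
    by (rule LIM_unique[rotated])
  also have "(\<Sum>i\<in>?I. of_rat (c i) * complex_of_real (quad (\<lambda>a l. traceless m (A l) a) i))
      = of_real (\<Sum>i\<in>?I. of_rat (c i) * quad (\<lambda>a l. traceless m (A l) a) i)"
    by (simp add: complex_of_rat_eq)
  finally show ?thesis by (simp only: of_real_eq_0_iff)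
qed

end

proposition (in free_abelian_reps) quad_independent:
  assumes c: "(\<Sum>i\<in>quad_indices m n. cst (c i) * quad s i) \<in> K 3" and i: "i \<in> quad_indices m n"
  shows "c i = 0"
proof -
  interpret vanishing_quadratic_form m n "\<lambda>i. of_rat (c i)"
  proof
    fix A :: "nat \<Rightarrow> nat \<times> nat \<Rightarrow> real"
    assume "\<And>p q. matmul m (A p) (A q) = matmul m (A q) (A p)"
    then interpret commuting_directions H n m x A by unfold_locales
    show "(\<Sum>i\<in>quad_indices m n. of_rat (c i) * quad (\<lambda>a l. traceless m (A l) a) i) = (0::real)"
      by (rule quad_relation[OF c])
  qed (rule m2)
  from coeff_zero[OF i] show ?thesis by simp
qed

section \<open>The basis theorem\<close>

context free_abelian_reps
begin

lemma elem_eq_quad: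
  "elem_t H m x i j h k p q = restrict (quad s (T (i, j) (h, k) p q)) R"
  "elem_u H m x i j h k p q = restrict (quad s (U (i, j) (h, k) p q)) R"
  "elem_v H m x i j p q = restrict (quad s (V (i, j) p q)) R"
  by (auto simp: elem_t_def elem_u_def elem_v_def Let_def coord_s_eq s_def fun_algebra_minus
      fun_algebra_sel fun_eq_iff)

lemma basis_Y_eq: "basis_Y H m n x = (\<lambda>i. restrict (quad s i) R) ` quad_indices m n"
proof -
  have T: "f ` {T (i, j) (h, k) p q | i j h k p q. P i j h k p q} = {f (T (i, j) (h, k) p q) | i j h k p q. P i j h k p q}"
    and U: "f ` {U (i, j) (h, k) p q | i j h k p q. P i j h k p q} = {f (U (i, j) (h, k) p q) | i j h k p q. P i j h k p q}"
    and V: "f ` {V (i, j) p q | i j p q. Q i j p q} = {f (V (i, j) p q) | i j p q. Q i j p q}"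
    for f :: "quad_index \<Rightarrow> ('a \<Rightarrow> complex mat) \<Rightarrow> complex" and P Q
    by blast+
  show ?thesis
    unfolding basis_Y_def quad_indices_def elem_eq_quad image_Un T U V by (rule refl)
qed

lemma gr_basis:
  "vectorspace (class_ring :: rat ring) (gr A J 2)"
  "inj_on (gr_class A J 2) (basis_Y H m n x)"
  "vectorspace.basis (class_ring :: rat ring) (gr A J 2) (gr_class A J 2 ` basis_Y H m n x)"
proof -
  interpret graded_piece A J 2
    by (intro graded_piece.intro graded_piece_axioms.intro algebra_A ideal)
  let ?I = "quad_indices m n" and ?y = "\<lambda>i. restrict (quad s i) R"
  have comb: "(\<Oplus>\<^bsub>A\<^esub>i\<in>?I. a i \<odot>\<^bsub>A\<^esub> ?y i) = restrict (\<Sum>i\<in>?I. cst (a i) * quad s i) R"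
    and comb_mem: "(\<Sum>i\<in>?I. cst (a i) * quad s i) \<in> K 0" for a
  proof -
    have mem: "cst (a i) * quad s i \<in> K 0" if "i \<in> ?I" for i
      using quad_mem_K2[OF that] antimono[of 0 2] by (auto intro!: cst_mult_mem)
    then show "(\<Sum>i\<in>?I. cst (a i) * quad s i) \<in> K 0" by (rule sum_mem)
    show "(\<Oplus>\<^bsub>A\<^esub>i\<in>?I. a i \<odot>\<^bsub>A\<^esub> ?y i) = restrict (\<Sum>i\<in>?I. cst (a i) * quad s i) R"
      unfolding restrict_ops(3) cst_def[symmetric]
      by (rule finsum_restrict[OF mem finite_quad_indices])
  qed
  have K3: "restrict f R \<in> ideal_pow A J (Suc 2) \<longleftrightarrow> f \<in> K 3" for f
    by (simp add: K_def del: ideal_pow.simps)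
  have indep: "\<forall>i\<in>?I. a i = 0" if "(\<Oplus>\<^bsub>A\<^esub>i\<in>?I. a i \<odot>\<^bsub>A\<^esub> ?y i) \<in> ideal_pow A J (Suc 2)" for a
    using that unfolding comb K3 by (blast intro: quad_independent)
  have span: "\<exists>a. f \<ominus>\<^bsub>A\<^esub> (\<Oplus>\<^bsub>A\<^esub>i\<in>?I. a i \<odot>\<^bsub>A\<^esub> ?y i) \<in> ideal_pow A J (Suc 2)"
    if f: "f \<in> ideal_pow A J 2" for f
  proof -
    obtain a where a: "f - (\<Sum>i\<in>?I. cst (a i) * quad s i) \<in> K 3"
      using K2_span[OF pow_subset_K[OF f]] unfolding span_mod_def by blast
    let ?g = "\<Sum>i\<in>?I. cst (a i) * quad s i"
    have "restrict ?g R \<in> B" using comb_mem[of a] by (simp add: K_def)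
    then have "f \<ominus>\<^bsub>A\<^esub> restrict ?g R = restrict f R \<oplus>\<^bsub>A\<^esub> restrict (- ?g) R"
      using restrict_B[of f] pow_subset[of 2] f by (simp only: C.minus_eq restrict_uminus subsetD)
    also have "\<dots> = restrict (f - ?g) R" unfolding restrict_ops by simp
    finally have "f \<ominus>\<^bsub>A\<^esub> restrict ?g R \<in> ideal_pow A J (Suc 2)" using a unfolding K3[symmetric] by (simp only:)
    then show ?thesis unfolding comb[symmetric] by blast
  qed
  have y: "?y i \<in> ideal_pow A J 2" if "i \<in> ?I" for i
    using quad_mem_K2[OF that] by (simp only: K_def mem_Collect_eq)
  show "vectorspace (class_ring :: rat ring) (gr A J 2)" by (rule vectorspace_V)
  show "inj_on (gr_class A J 2) (basis_Y H m n x)"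
    "vectorspace.basis (class_ring :: rat ring) (gr A J 2) (gr_class A J 2 ` basis_Y H m n x)"
    unfolding basis_Y_eq using basis_of_family[OF finite_quad_indices y indep span] by blast+
qed

end

theorem proposition7p2:
  fixes H :: "('a, 'b) monoid_scheme" and x :: "nat \<Rightarrow> 'a" and m n :: nat
  assumes "m \<ge> 2"
    and "free_abelian_with_basis H n x"
  shows "vectorspace (class_ring :: rat ring) (gr (rep_algebra H m) (ideal_J H m n x) 2) \<and>
    inj_on (gr_class (rep_algebra H m) (ideal_J H m n x) 2) (basis_Y H m n x) \<and>
    vectorspace.basis (class_ring :: rat ring) (gr (rep_algebra H m) (ideal_J H m n x) 2)
      (gr_class (rep_algebra H m) (ideal_J H m n x) 2 ` basis_Y H m n x)"
proof -
  interpret free_abelian_reps H n m x using assms by unfold_locales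
  show ?thesis using gr_basis unfolding rep_algebra_eq[symmetric] by blast
qed

end
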